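(* Let $n\ge 1$ be an integer, let $\Omega\subseteq\mathbb{R}^n$ be a nonempty open set with finite Lebesgue measure, and let $1<p<\infty$. Let $f:[0,\infty)\to[0,\infty)$ be Borel measurable with $\lim_{t\to\infty}f(t)=\infty$. Then $$\sup\left\{\int_{\Omega}f(|u|)\,e^{\alpha_{n,p}|u|^{p'}}\,dx \;:\; u\in \tilde{H}^{\frac np,p}(\Omega),\ \|u\|^p_{L^p(\Omega)}+\|(-\Delta)^{\frac{n}{2p}}u\|_{L^p(\mathbb{R}^n)}^p\leq 1\right\}=\infty .$$
   Context: Here $p'=\frac{p}{p-1}$ and $$\alpha_{n,p}=\frac{n}{|S^{n-1}|}\left(\frac{\Gamma\left(\frac{n}{2p}\right)2^{\frac np}\pi^{\frac n2}}{\Gamma\left(\frac{np-n}{2p}\right)}\right)^{p'},$$ where $|S^{n-1}|$ is the surface measure of the unit sphere in $\mathbb{R}^n$ (so $|S^0|=2$). Fractional Laplacian: let $\mathcal{S}(\mathbb{R}^n)$ be the Schwartz space and $\mathcal{F}$ (also $\hat{\ }$) the normalized (unitary) Fourier transform $\hat\varphi(\xi)=(2\pi)^{-n/2}\int_{\mathbb{R}^n} e^{-ix\cdot\xi}\varphi(x)\,dx$. For $s>0$ and $\varphi\in\mathcal{S}(\mathbb{R}^n)$, $(-\Delta)^s\varphi=\mathcal{F}^{-1}(|\xi|^{2s}\hat\varphi)$. For $u$ in $L_s(\mathbb{R}^n)=\{u\in L^1_{loc}(\mathbb{R}^n):\int_{\mathbb{R}^n}\frac{|u(x)|}{1+|x|^{n+2s}}dx<\infty\}$,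 $(-\Delta)^su$ is defined by duality: $\langle(-\Delta)^su,\varphi\rangle=\int_{\mathbb{R}^n}u\,(-\Delta)^s\varphi\,dx$ for $\varphi\in\mathcal{S}(\mathbb{R}^n)$. For an open set $\Omega\subseteq\mathbb{R}^n$, $s>0$, $1\le p\le\infty$, $$\tilde{H}^{s,p}(\Omega)=\left\{u\in L^p(\Omega): u=0\text{ on }\mathbb{R}^n\setminus\Omega,\ (-\Delta)^{\frac s2}u\in L^p(\mathbb{R}^n)\right\}.$$ *)

theory Defs
  imports "HOL-Analysis.Analysis"
begin

section \<open>Schwartz functions and the Fourier transform\<close>

fun iter_deriv :: "'a list \<Rightarrow> ('a::euclidean_space \<Rightarrow> complex) \<Rightarrow> 'a \<Rightarrow> complex" where
  "iter_deriv [] f = f"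
| "iter_deriv (v # vs) f = (\<lambda>x. frechet_derivative (iter_deriv vs f) (at x) v)"

text \<open>The lists of basis vectors play the role of multi-indices. Differentiability of all iterated
  partial derivatives is the same as being infinitely differentiable.\<close>

definition schwartz :: "('a::euclidean_space \<Rightarrow> complex) set" where
  "schwartz = {\<phi>. \<forall>vs \<in> lists Basis.
      (\<forall>x. iter_deriv vs \<phi> differentiable (at x)) \<and>
      (\<forall>k::nat. bounded (range (\<lambda>x. norm x ^ k * norm (iter_deriv vs \<phi> x))))}"

definition fourier :: "('a::euclidean_space \<Rightarrow> complex) \<Rightarrow> 'a \<Rightarrow> complex" where
  "fourier \<phi> \<xi> = complex_of_real ((2 * pi) powr (- real DIM('a) / 2)) *
     (LINT x|lebesgue. exp (- (\<i> * complex_of_real (x \<bullet> \<xi>))) * \<phi> x)"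

definition fourier_inv :: "('a::euclidean_space \<Rightarrow> complex) \<Rightarrow> 'a \<Rightarrow> complex" where
  "fourier_inv \<psi> x = complex_of_real ((2 * pi) powr (- real DIM('a) / 2)) *
     (LINT \<xi>|lebesgue. exp (\<i> * complex_of_real (x \<bullet> \<xi>)) * \<psi> \<xi>)"


section \<open>The fractional Laplacian\<close>

definition frac_laplacian_schwartz ::
    "real \<Rightarrow> ('a::euclidean_space \<Rightarrow> complex) \<Rightarrow> 'a \<Rightarrow> complex" where
  "frac_laplacian_schwartz s \<phi> =
     fourier_inv (\<lambda>\<xi>. complex_of_real (norm \<xi> powr (2 * s)) * fourier \<phi> \<xi>)"

definition L_space :: "real \<Rightarrow> ('a::euclidean_space \<Rightarrow> real) set" where
  "L_space s = {u. (\<forall>K. compact K \<longrightarrow> u absolutely_integrable_on K) \<and>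
     integrable lebesgue (\<lambda>x. \<bar>u x\<bar> / (1 + norm x powr (real DIM('a) + 2 * s)))}"

definition frac_laplacian ::
    "real \<Rightarrow> ('a::euclidean_space \<Rightarrow> real) \<Rightarrow> ('a \<Rightarrow> complex) \<Rightarrow> complex" where
  "frac_laplacian s u \<phi> =
     (LINT x|lebesgue. complex_of_real (u x) * frac_laplacian_schwartz s \<phi> x)"

text \<open>The distribution \<^term>\<open>frac_laplacian s u\<close> is the function \<open>g\<close>. Such a \<open>g\<close> is unique almost
  everywhere.\<close>

definition has_frac_laplacian ::
    "real \<Rightarrow> ('a::euclidean_space \<Rightarrow> real) \<Rightarrow> ('a \<Rightarrow> real) \<Rightarrow> bool" where
  "has_frac_laplacian s u g \<longleftrightarrow> u \<in> L_space s \<and>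
     (\<forall>\<phi> \<in> schwartz. integrable lebesgue (\<lambda>x. complex_of_real (g x) * \<phi> x) \<and>
        frac_laplacian s u \<phi> = (LINT x|lebesgue. complex_of_real (g x) * \<phi> x))"


section \<open>Function spaces\<close>

text \<open>Elements of these spaces are functions rather than classes of functions equal almost
  everywhere. The exponent \<open>p\<close> is finite.\<close>

definition Lp :: "real \<Rightarrow> 'a::euclidean_space set \<Rightarrow> ('a \<Rightarrow> real) set" where
  "Lp p A = {u. u \<in> borel_measurable (lebesgue_on A) \<and>
     integrable (lebesgue_on A) (\<lambda>x. \<bar>u x\<bar> powr p)}"

definition Lp_norm :: "real \<Rightarrow> 'a::euclidean_space set \<Rightarrow> ('a \<Rightarrow> real) \<Rightarrow> real" where
  "Lp_norm p A u = (LINT x|lebesgue_on A. \<bar>u x\<bar> powr p) powr (1 / p)"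

definition H_tilde :: "real \<Rightarrow> real \<Rightarrow> 'a::euclidean_space set \<Rightarrow> ('a \<Rightarrow> real) set" where
  "H_tilde s p \<Omega> = {u \<in> Lp p \<Omega>. (AE x in lebesgue. x \<notin> \<Omega> \<longrightarrow> u x = 0) \<and>
     (\<exists>g \<in> Lp p UNIV. has_frac_laplacian (s / 2) u g)}"


section \<open>The sharp constant\<close>

text \<open>Surface measure of a subset \<open>E\<close> of the unit sphere, in the normalisation that makes
  integration in polar coordinates valid: \<open>DIM('a)\<close> times the volume of the cone over \<open>E\<close>.\<close>

definition sphere_measure :: "'a::euclidean_space set \<Rightarrow> real" where
  "sphere_measure E =
     real DIM('a) * measure lebesgue {t *\<^sub>R x | t x. 0 < t \<and> t \<le> 1 \<and> x \<in> E}"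

lemma sphere_measure_unit_sphere:
  "sphere_measure (sphere (0::'a::euclidean_space) 1) =
     real DIM('a) * unit_ball_vol (real DIM('a))"
proof -
  have "{t *\<^sub>R x | t x. 0 < t \<and> t \<le> 1 \<and> x \<in> sphere (0::'a) 1} = cball 0 1 - {0}"
  proof (intro equalityI subsetI)
    fix y :: 'a assume "y \<in> cball 0 1 - {0}"
    then have "0 < norm y \<and> norm y \<le> 1 \<and> y /\<^sub>R norm y \<in> sphere 0 1 \<and>
        y = norm y *\<^sub>R (y /\<^sub>R norm y)"
      by simp
    then show "y \<in> {t *\<^sub>R x | t x. 0 < t \<and> t \<le> 1 \<and> x \<in> sphere (0::'a) 1}" by blast
  qed auto
  moreover have "measure lebesgue (cball (0::'a) 1 - {0}) = measure lebesgue (cball (0::'a) 1)"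
    by (rule measure_Diff_null_set) auto
  ultimately show ?thesis
    by (simp add: sphere_measure_def content_cball)
qed

lemma sphere_measure_S0: "sphere_measure (sphere (0::real ^ 1) 1) = 2"
  by (simp add: sphere_measure_unit_sphere unit_ball_vol_1)

definition moser_alpha :: "'a::euclidean_space itself \<Rightarrow> real \<Rightarrow> real" where
  "moser_alpha _ p = (let n = real DIM('a) in
     n / sphere_measure (sphere (0::'a) 1) *
     (Gamma (n / (2 * p)) * 2 powr (n / p) * pi powr (n / 2) / Gamma ((n * p - n) / (2 * p)))
       powr (p / (p - 1)))"

end

theory Submission
  imports Defs "HOL-Probability.Probability" "HOL-Real_Asymp.Real_Asymp"
begin

text \<open>
Write \<open>n\<close> for the dimension, \<open>\<sigma> = n / p\<close> and \<open>p' = p / (p - 1)\<close>. The exponential with the sharp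
constant is saturated, up to a bounded factor, by truncated logarithms that concentrate at a point.
A further factor \<open>f\<close> that tends to infinity then makes the integrals diverge.

Fix a radial bump \<open>\<psi>\<close> (\<open>profile\<close>) supported in the unit ball with \<open>\<psi>(0) = 1\<close>, a ball of radius \<open>r\<close>
around \<open>a\<close> inside the domain, and for \<open>0 < \<epsilon> < r\<close> superpose dilates of \<open>\<psi>\<close>: the function
\<open>u(x) = \<integral>\<^sub>\<epsilon>\<^sup>r \<psi>((x - a) / t) dt / t\<close> (\<open>log_bump\<close>) vanishes outside that ball and
is at most \<open>ln (r / \<bar>x - a\<bar>)\<close> inside it, hence bounded in \<open>L\<^sup>p\<close> uniformly in \<open>\<epsilon>\<close>, and it is at least
\<open>L - O(1)\<close> on the ball of radius \<open>\<epsilon>\<close>, where \<open>L = ln (r / \<epsilon>)\<close>. If \<open>h\<close> (\<open>profile_laplacian\<close>) is the fractional Laplacian of order \<open>\<sigma>\<close> of \<open>\<psi>\<close>,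
then homogeneity gives for \<open>u\<close> the fractional Laplacian \<open>g(x) = \<integral>\<^sub>\<epsilon>\<^sup>r t\<^sup>-\<^sup>\<sigma> h((x - a) / t) dt / t\<close>
(\<open>log_bump_laplacian\<close>, lemma \<open>has_frac_laplacian_log_bump\<close>).

Put \<open>\<rho> = \<bar>x - a\<bar>\<close>. Extended over all \<open>t > 0\<close>, the last integral is exactly \<open>K \<rho>\<^sup>-\<^sup>\<sigma>\<close>, where
\<open>K = \<integral> s\<^sup>\<sigma>\<^sup>-\<^sup>1 h(s e) ds\<close> (\<open>profile_moment\<close>) does not depend on the unit vector \<open>e\<close> because \<open>h\<close> is
radial. Since \<open>h\<close> is bounded and \<open>h(x) = O(\<bar>x\<bar>\<^sup>-\<^sup>\<sigma>\<^sup>-\<^sup>n)\<close>, the missing ends contribute only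
\<open>\<rho>\<^sup>-\<^sup>\<sigma> O((\<epsilon> / \<rho>)\<^sup>n + (\<rho> / r)\<^sup>\<sigma>)\<close>. As \<open>\<sigma> p = n\<close>, polar coordinates yield
\<open>\<integral> \<bar>g\<bar>\<^sup>p \<le> S K\<^sup>p L + O(1)\<close> with \<open>S\<close> the area of the unit sphere
(lemma \<open>nn_integral_log_bump_laplacian_powr_le\<close>).

The sharp constant enters through \<open>S K = \<integral> \<bar>x\<bar>\<^sup>\<sigma>\<^sup>-\<^sup>n h(x) dx\<close>. Convolution with \<open>\<bar>x\<bar>\<^sup>\<sigma>\<^sup>-\<^sup>n\<close> inverts the
fractional Laplacian up to a factor that is an explicit quotient of Gamma functions; evaluated at
the origin this gives \<open>\<psi>(0)\<close> times that factor (lemma \<open>integral_riesz_profile_laplacian\<close>), which is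
precisely what makes \<open>\<alpha> = (n / S) (S K) powr p'\<close> (lemma \<open>moser_alpha_eq\<close>). Dividing \<open>u\<close> by
\<open>(S K\<^sup>p L + O(1)) powr (1 / p)\<close> therefore produces admissible functions \<open>v\<close> with
\<open>\<alpha> (v powr p') \<ge> n L - O(1)\<close> on the ball of radius \<open>\<epsilon>\<close> (lemma
\<open>normalised_exponent_lower_bound\<close>). The factor \<open>exp (n L) = (r / \<epsilon>)\<^sup>n\<close> compensates
the volume of this ball, so the integral of the exponential over it stays bounded away from zero while \<open>v\<close>, and with it \<open>f(v)\<close>,
tends to infinity there.

On the Fourier side, the duality that defines the fractional Laplacian reduces to Fubini's theorem
once the transforms of Schwartz functions and of \<open>\<psi>\<close> are known to decay. The decay of \<open>h\<close> itself
comes from writing \<open>\<bar>\<xi>\<bar>\<^sup>\<sigma>\<close> as an average of the multipliers \<open>(1 - exp (- t \<bar>\<xi>\<bar>\<^sup>2))\<^sup>M\<close> over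
\<open>t > 0\<close>: these act on \<open>\<psi>\<close> as combinations of heat flows, which are tiny away from the support of
\<open>\<psi>\<close>.
\<close>

section \<open>Integration on Euclidean spaces\<close>

lemma
  assumes "f \<in> borel_measurable M" "\<And>x. 0 \<le> f x" "0 \<le> c"
    and "(\<integral>\<^sup>+x. ennreal (f x) \<partial>M) = ennreal c"
  shows integrable_of_nn_integral: "integrable M f" and integral_of_nn_integral: "integral\<^sup>L M f = c"
  using nn_integral_eq_integrable[of f M c] assms by auto

text \<open>The Bochner integral of a non-integrable function is \<open>0\<close>, so a bound by a Lebesgue integral
of nonnegative functions holds for inner integrals whose integrability has not been established.\<close>

lemma norm_integral_le_nn_integral:
  fixes f :: "'a \<Rightarrow> 'b::{banach, second_countable_topology}"
  assumes "\<And>x. norm (f x) \<le> g x" "(\<integral>\<^sup>+x. ennreal (g x) \<partial>M) \<le> ennreal c" "0 \<le> c"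
  shows "norm (integral\<^sup>L M f) \<le> c"
proof (cases "integrable M f")
  case True
  then have "ennreal (norm (integral\<^sup>L M f)) \<le> (\<integral>\<^sup>+x. norm (f x) \<partial>M)" by (rule integral_norm_bound_ennreal)
  also have "\<dots> \<le> (\<integral>\<^sup>+x. ennreal (g x) \<partial>M)" by (intro nn_integral_mono ennreal_leI assms(1))
  also have "\<dots> \<le> ennreal c" by fact
  finally show ?thesis using assms(3) by simp
qed (use assms(3) in \<open>simp add: not_integrable_integral_eq\<close>)

lemma integrable_lborel_pair_mult:
  fixes f :: "'a::euclidean_space \<Rightarrow> real" and g :: "'b::euclidean_space \<Rightarrow> real"
  assumes f: "integrable lborel f" and g: "integrable lborel g"
  shows "integrable (lborel \<Otimes>\<^sub>M lborel) (\<lambda>(x, y). f x * g y)"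
proof -
  have [measurable]: "f \<in> borel_measurable borel" "g \<in> borel_measurable borel" using f g by auto
  show ?thesis
    by (rule lborel_pair.Fubini_integrable) (use f g in \<open>auto simp: abs_mult\<close>)
qed

lemma nn_integral_lborel_affine:
  fixes a :: "'a::euclidean_space"
  assumes [measurable]: "f \<in> borel_measurable borel" and c: "c \<noteq> 0"
  shows "(\<integral>\<^sup>+x. f x \<partial>lborel) = ennreal (\<bar>c\<bar> ^ DIM('a)) * (\<integral>\<^sup>+x. f (a + c *\<^sub>R x) \<partial>lborel)"
  by (subst lborel_affine[OF c, of a]) (simp add: nn_integral_density nn_integral_distr nn_integral_cmult)

lemma nn_integral_lborel_translation:
  fixes a :: "'a::euclidean_space"
  assumes [measurable]: "f \<in> borel_measurable borel"
  shows "(\<integral>\<^sup>+x. f (a + x) \<partial>lborel) = (\<integral>\<^sup>+x. f x \<partial>lborel)"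
  using nn_integral_lborel_affine[of f 1 a] by simp

lemma
  fixes a :: "'a::euclidean_space" and f :: "'a \<Rightarrow> 'b::{banach, second_countable_topology}"
  assumes [measurable]: "f \<in> borel_measurable borel" and c: "c \<noteq> 0"
  shows integrable_lborel_affine: "integrable lborel (\<lambda>x. f (a + c *\<^sub>R x)) \<longleftrightarrow> integrable lborel f"
    and integral_lborel_affine: "(LINT x|lborel. f x) = (\<bar>c\<bar> ^ DIM('a)) *\<^sub>R (LINT x|lborel. f (a + c *\<^sub>R x))"
proof -
  have "integrable lborel f \<longleftrightarrow> integrable (density (distr lborel borel (\<lambda>x. a + c *\<^sub>R x)) (\<lambda>_. ennreal (\<bar>c\<bar>^DIM('a)))) f"
    using lborel_affine[OF c, of a] by simp
  also have "\<dots> \<longleftrightarrow> integrable lborel (\<lambda>x. f (a + c *\<^sub>R x))"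
    using c integrable_scaleR_right[of "inverse (\<bar>c\<bar> ^ DIM('a))" lborel
        "\<lambda>x. \<bar>c\<bar> ^ DIM('a) *\<^sub>R f (a + c *\<^sub>R x)"]
    by (subst integrable_density) (auto simp: integrable_distr_eq)
  finally show "integrable lborel (\<lambda>x. f (a + c *\<^sub>R x)) \<longleftrightarrow> integrable lborel f" by simp
  have "(LINT x|lborel. f x) = (LINT x|density (distr lborel borel (\<lambda>x. a + c *\<^sub>R x)) (\<lambda>_. ennreal (\<bar>c\<bar>^DIM('a))). f x)"
    using lborel_affine[OF c, of a] by simp
  also have "\<dots> = (\<bar>c\<bar> ^ DIM('a)) *\<^sub>R (LINT x|lborel. f (a + c *\<^sub>R x))"
    by (subst integral_density) (auto simp: integral_distr)
  finally show "(LINT x|lborel. f x) = (\<bar>c\<bar> ^ DIM('a)) *\<^sub>R (LINT x|lborel. f (a + c *\<^sub>R x))" .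
qed

lemma borel_measurable_orthogonal_transformation:
  fixes R :: "'a::euclidean_space \<Rightarrow> 'a"
  assumes "orthogonal_transformation R"
  shows "R \<in> borel_measurable borel"
  using linear_continuous_on[of R UNIV] orthogonal_transformation_linear[OF assms]
  by (intro borel_measurable_continuous_onI) (simp add: linear_conv_bounded_linear)

text \<open>Uniqueness of an invariant measure, in the classical double-integral form. With \<open>g\<close>
the indicator of the unit ball, shift the variable of \<open>f\<close> by every \<open>y\<close> weighted with \<open>g y\<close>, exchange
the integrals, and undo the shift on the side of \<open>g\<close>. The rotation then only meets \<open>g\<close>, which is
radial and even, so the two sides agree after multiplication by the volume of the ball.\<close>

lemma nn_integral_lborel_orthogonal:
  fixes R :: "'a::euclidean_space \<Rightarrow> 'a"
  assumes R: "orthogonal_transformation R" and f[measurable]: "f \<in> borel_measurable borel"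
  shows "(\<integral>\<^sup>+x. f (R x) \<partial>lborel) = (\<integral>\<^sup>+x. f x \<partial>lborel)"
proof -
  define Q where "Q = inv R"
  have lin: "linear R" and nR: "\<And>x. norm (R x) = norm x"
    using R by (auto simp: orthogonal_transformation)
  have RQ: "R (Q y) = y" for y
    unfolding Q_def using orthogonal_transformation_surj[OF R] by (simp add: surj_f_inv_f)
  have [measurable]: "R \<in> borel_measurable borel" "Q \<in> borel_measurable borel"
    unfolding Q_def using R orthogonal_transformation_inv[OF R]
    by (simp_all add: borel_measurable_orthogonal_transformation)
  define g :: "'a \<Rightarrow> ennreal" where "g y = indicator (ball 0 1) y" for y
  have [measurable]: "g \<in> borel_measurable borel" unfolding g_def by (intro borel_measurable_indicator) simp
  define c where "c = (\<integral>\<^sup>+y. g y \<partial>lborel)"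
  have c_eq: "c = emeasure lborel (ball (0::'a) 1)"
    unfolding c_def g_def by (subst nn_integral_indicator) auto
  \<comment> \<open>the rotation is absorbed here, because \<open>g\<close> is radial\<close>
  have g_shift: "(\<integral>\<^sup>+x. g (y - R x) \<partial>lborel) = c" for y
  proof -
    have "g (y - R x) = g (- Q y + x)" for x
    proof -
      have "y - R x = R (Q y - x)" using RQ lin by (simp add: linear_diff)
      then have "norm (y - R x) = norm (- Q y + x)" using nR by (simp add: norm_minus_commute)
      then show ?thesis by (simp add: g_def indicator_def)
    qed
    then show ?thesis using nn_integral_lborel_translation[of g "- Q y"] by (simp add: c_def)
  qed
  have "c * (\<integral>\<^sup>+x. f (R x) \<partial>lborel) = (\<integral>\<^sup>+y. g y * (\<integral>\<^sup>+x. f (R x) \<partial>lborel) \<partial>lborel)"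
    unfolding c_def by (simp add: nn_integral_multc)
  also have "\<dots> = (\<integral>\<^sup>+y. g y * (\<integral>\<^sup>+x. f (R x + y) \<partial>lborel) \<partial>lborel)"
  proof (rule nn_integral_cong, rule arg_cong2[where f="(*)", OF refl])
    fix y
    have "R (Q y + x) = R x + y" for x using RQ lin by (simp add: linear_add add.commute)
    then show "(\<integral>\<^sup>+x. f (R x) \<partial>lborel) = (\<integral>\<^sup>+x. f (R x + y) \<partial>lborel)"
      using nn_integral_lborel_translation[of "\<lambda>x. f (R x)" "Q y"] by simp
  qed
  also have "\<dots> = (\<integral>\<^sup>+y. (\<integral>\<^sup>+x. g y * f (R x + y) \<partial>lborel) \<partial>lborel)"
    by (simp add: nn_integral_cmult)
  also have "\<dots> = (\<integral>\<^sup>+x. (\<integral>\<^sup>+y. g y * f (R x + y) \<partial>lborel) \<partial>lborel)"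
    by (rule lborel_pair.Fubini') measurable
  also have "\<dots> = (\<integral>\<^sup>+x. (\<integral>\<^sup>+y. g (y - R x) * f y \<partial>lborel) \<partial>lborel)"
  proof (rule nn_integral_cong)
    fix x
    show "(\<integral>\<^sup>+y. g y * f (R x + y) \<partial>lborel) = (\<integral>\<^sup>+y. g (y - R x) * f y \<partial>lborel)"
      using nn_integral_lborel_translation[of "\<lambda>y. g (y - R x) * f y" "R x"] by simp
  qed
  also have "\<dots> = (\<integral>\<^sup>+y. (\<integral>\<^sup>+x. g (y - R x) * f y \<partial>lborel) \<partial>lborel)"
    by (rule lborel_pair.Fubini') measurable
  also have "\<dots> = c * (\<integral>\<^sup>+x. f x \<partial>lborel)"
    by (simp add: nn_integral_multc g_shift nn_integral_cmult)
  finally have *: "c * (\<integral>\<^sup>+x. f (R x) \<partial>lborel) = c * (\<integral>\<^sup>+x. f x \<partial>lborel)" .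
  have "c \<noteq> 0" "c \<noteq> \<infinity>"
    using content_ball_pos[of 1 "0::'a"] emeasure_lborel_ball_finite[of "0::'a" 1]
    unfolding c_eq by (auto simp: measure_def)
  with * show ?thesis by (simp add: ennreal_mult_cancel_left)
qed

lemma lborel_distr_orthogonal:
  fixes R :: "'a::euclidean_space \<Rightarrow> 'a"
  assumes R: "orthogonal_transformation R"
  shows "distr lborel borel R = lborel"
proof (rule measure_eqI)
  fix A assume "A \<in> sets (distr lborel borel R)"
  then have A[measurable]: "A \<in> sets borel" by simp
  have [measurable]: "R \<in> borel_measurable borel"
    using R by (rule borel_measurable_orthogonal_transformation)
  show "emeasure (distr lborel borel R) A = emeasure lborel A"
    using nn_integral_lborel_orthogonal[OF R, of "indicator A"]
    by (simp add: nn_integral_distr flip: nn_integral_indicator)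
qed simp

lemma integral_lborel_orthogonal:
  fixes R :: "'a::euclidean_space \<Rightarrow> 'a" and f :: "'a \<Rightarrow> 'b::{banach, second_countable_topology}"
  assumes R: "orthogonal_transformation R" and [measurable]: "f \<in> borel_measurable borel"
  shows "(LINT x|lborel. f (R x)) = (LINT x|lborel. f x)"
proof -
  note [measurable] = borel_measurable_orthogonal_transformation[OF R]
  have "(LINT x|lborel. f (R x)) = (LINT x|distr lborel borel R. f x)"
    by (subst integral_distr) auto
  then show ?thesis by (simp add: lborel_distr_orthogonal[OF R])
qed

text \<open>The reflection in the hyperplane orthogonal to \<open>a - b\<close>. It is the source of
radial symmetry: a quantity that is invariant under all orthogonal maps depends on the norm only.\<close>

lemma exists_reflection:
  fixes a b :: "'a::euclidean_space"
  assumes "norm a = norm b"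
  obtains R where "orthogonal_transformation R" "R a = b"
proof -
  define v where "v = a - b"
  define R where "R x = x - (2 * (x \<bullet> v) / (v \<bullet> v)) *\<^sub>R v" for x
  have ab: "a \<bullet> a = b \<bullet> b" using assms by (simp add: norm_eq)
  have "orthogonal_transformation R"
    unfolding orthogonal_transformation_def
  proof (intro conjI allI)
    show "linear R" unfolding R_def
      by (intro linearI) (auto simp: algebra_simps inner_add_left add_divide_distrib)
    show "R x \<bullet> R y = x \<bullet> y" for x y
      by (cases "v = 0") (auto simp: R_def algebra_simps inner_commute inner_diff_left inner_diff_right)
  qed
  moreover have "R a = b"
  proof (cases "v = 0")
    case False
    have "2 * (a \<bullet> v) = v \<bullet> v" unfolding v_def using ab by (simp add: algebra_simps inner_commute)
    then show ?thesis using False by (simp add: R_def v_def)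
  qed (auto simp: R_def v_def)
  ultimately show ?thesis using that by blast
qed

section \<open>Polar coordinates\<close>

text \<open>Polar coordinates for radial functions. Both measures give \<open>{..b}\<close> the volume
\<open>\<omega> b\<^sup>n\<close> of a ball, and half-lines form a generator that is stable under intersection.\<close>

lemma distr_norm_lborel:
  "distr lborel borel (norm :: 'a::euclidean_space \<Rightarrow> real) =
    density lborel (\<lambda>r. ennreal (indicator {0..} r * (sphere_measure (sphere (0::'a) 1) * r ^ (DIM('a) - 1))))"
    (is "?L = ?R")
proof (rule measure_eqI_generator_eq[where E="range atMost" and A="\<lambda>i. {..real i}" and \<Omega>=UNIV])
  define S where "S = sphere_measure (sphere (0::'a) 1)"
  define V where "V = unit_ball_vol (real DIM('a))"
  have S: "S = real DIM('a) * V" unfolding S_def V_def by (rule sphere_measure_unit_sphere)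
  have V0: "0 \<le> V" unfolding V_def by simp
  have L: "emeasure ?L {..b} = ennreal (if b \<ge> 0 then V * b ^ DIM('a) else 0)" for b
  proof -
    have "emeasure ?L {..b} = emeasure lborel (norm -` {..b} :: 'a set)"
      by (subst emeasure_distr) auto
    also have "(norm -` {..b} :: 'a set) = cball 0 b" by (auto simp: dist_norm)
    also have "emeasure lborel (cball (0::'a) b) = ennreal (if b \<ge> 0 then V * b ^ DIM('a) else 0)"
      by (cases "b \<ge> 0") (auto simp: emeasure_cball V_def)
    finally show ?thesis .
  qed
  have R: "emeasure ?R {..b} = ennreal (if b \<ge> 0 then V * b ^ DIM('a) else 0)" for b
  proof (cases "b \<ge> 0")
    case True
    have "emeasure ?R {..b} = (\<integral>\<^sup>+r. ennreal (S * r ^ (DIM('a) - 1)) * indicator {0..b} r \<partial>lborel)"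
      unfolding S_def[symmetric]
      by (subst emeasure_density) (auto intro!: nn_integral_cong simp: indicator_def)
    also have "\<dots> = ennreal (V * b ^ DIM('a) - V * 0 ^ DIM('a))"
    proof (rule nn_integral_FTC_Icc[where F="\<lambda>r. V * r ^ DIM('a)"])
      fix r assume "r \<in> {0..b}"
      then show "0 \<le> S * r ^ (DIM('a) - 1)" unfolding S using V0 by simp
      show "((\<lambda>r. V * r ^ DIM('a)) has_real_derivative S * r ^ (DIM('a) - 1)) (at r)"
        unfolding S by (auto intro!: derivative_eq_intros)
    qed (use True in auto)
    finally show ?thesis using True by (simp add: zero_power)
  next
    case False
    then have "ennreal (indicator {0..} r * c) * indicator {..b} r = 0" for c r :: real
      by (auto simp: indicator_def)
    then show ?thesis using False
      by (subst emeasure_density, simp, simp, simp only:) simp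
  qed
  show "emeasure ?L X = emeasure ?R X" if "X \<in> range atMost" for X
    using that L R by auto
  show "emeasure ?L {..real i} \<noteq> \<infinity>" for i by (simp add: L)
  show "sets ?L = sigma_sets UNIV (range atMost)" "sets ?R = sigma_sets UNIV (range atMost)"
    by (simp_all add: borel_eq_atMost)
  show "Int_stable (range (atMost :: real \<Rightarrow> _))"
    by (auto simp: Int_stable_def)
  show "range (\<lambda>i. {..real i}) \<subseteq> range atMost" by auto
  show "(\<Union>i. {..real i}) = UNIV"
    using real_arch_simple by (auto simp: set_eq_iff)
qed auto

text \<open>A function of the type alone, as only the dimension matters.\<close>

definition sphere_area :: "'a::euclidean_space itself \<Rightarrow> real" where
  "sphere_area _ = sphere_measure (sphere (0::'a) 1)"

lemma sphere_area_pos: "0 < sphere_area TYPE('a::euclidean_space)"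
  unfolding sphere_area_def sphere_measure_unit_sphere
  by (auto simp: unit_ball_vol_pos)

lemma nn_integral_radial:
  assumes [measurable]: "F \<in> borel_measurable borel"
  shows "(\<integral>\<^sup>+x. F (norm (x::'a::euclidean_space)) \<partial>lborel) =
    ennreal (sphere_area TYPE('a)) *
      (\<integral>\<^sup>+r. ennreal (indicator {0..} r * r ^ (DIM('a) - 1)) * F r \<partial>lborel)"
proof -
  have "(\<integral>\<^sup>+x. F (norm (x::'a)) \<partial>lborel) = (\<integral>\<^sup>+r. F r \<partial>distr lborel borel (norm :: 'a \<Rightarrow> real))"
    by (subst nn_integral_distr) auto
  also have "\<dots> = (\<integral>\<^sup>+r. ennreal (indicator {0..} r * (sphere_area TYPE('a) * r ^ (DIM('a) - 1))) * F r \<partial>lborel)"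
    unfolding distr_norm_lborel sphere_area_def by (subst nn_integral_density) auto
  also have "\<dots> = (\<integral>\<^sup>+r. ennreal (sphere_area TYPE('a)) * (ennreal (indicator {0..} r * r ^ (DIM('a) - 1)) * F r) \<partial>lborel)"
    using sphere_area_pos[where 'a='a]
    by (intro nn_integral_cong) (auto simp: indicator_def ennreal_mult mult.assoc)
  finally show ?thesis by (simp add: nn_integral_cmult)
qed

lemma integral_radial:
  fixes F :: "real \<Rightarrow> real"
  assumes [measurable]: "F \<in> borel_measurable borel"
  shows "(LINT x|lborel. F (norm (x::'a::euclidean_space))) =
    sphere_area TYPE('a) * (LINT r|lborel. indicator {0..} r * r ^ (DIM('a) - 1) * F r)"
proof -
  have "(LINT x|lborel. F (norm (x::'a))) = (LINT r|distr lborel borel (norm :: 'a \<Rightarrow> real). F r)"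
    by (subst integral_distr) auto
  also have "\<dots> = (LINT r|lborel. sphere_area TYPE('a) * (indicator {0..} r * r ^ (DIM('a) - 1) * F r))"
    unfolding distr_norm_lborel sphere_area_def[of "TYPE('a)", symmetric] using sphere_area_pos[where 'a='a]
    by (subst integral_density) (auto simp: indicator_def mult_ac intro!: Bochner_Integration.integral_cong)
  finally show ?thesis by simp
qed

lemma integrable_radial_iff:
  fixes F :: "real \<Rightarrow> real"
  assumes [measurable]: "F \<in> borel_measurable borel"
  shows "integrable lborel (\<lambda>x. F (norm (x::'a::euclidean_space))) \<longleftrightarrow>
    integrable lborel (\<lambda>r. indicator {0..} r * r ^ (DIM('a) - 1) * F r)"
proof -
  have "integrable lborel (\<lambda>x. F (norm (x::'a))) \<longleftrightarrow> integrable (distr lborel borel (norm :: 'a \<Rightarrow> real)) F"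
    by (subst integrable_distr_eq) auto
  also have "\<dots> \<longleftrightarrow> integrable lborel (\<lambda>r. sphere_area TYPE('a) * (indicator {0..} r * r ^ (DIM('a) - 1) * F r))"
    unfolding distr_norm_lborel sphere_area_def[of "TYPE('a)", symmetric] using sphere_area_pos[where 'a='a]
    by (subst integrable_density) (auto simp: indicator_def mult_ac intro!: Bochner_Integration.integrable_cong)
  also have "\<dots> \<longleftrightarrow> integrable lborel (\<lambda>r. indicator {0..} r * r ^ (DIM('a) - 1) * F r)"
    using sphere_area_pos[where 'a='a] by (simp add: integrable_mult_right_iff)
  finally show ?thesis .
qed

text \<open>The exponent \<open>n + 1\<close> is the least integer that works. Multiples of this function are the
majorants when difference quotients are compared with derivatives under the integral.\<close>

lemma integrable_inverse_power_decay:
  "integrable lborel (\<lambda>x::'a::euclidean_space. 1 / (1 + norm x) ^ (DIM('a) + 1))"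
proof (rule integrableI_nonneg)
  let ?n = "DIM('a)"
  have "(\<integral>\<^sup>+x. ennreal (1 / (1 + norm (x::'a)) ^ (?n + 1)) \<partial>lborel) =
      ennreal (sphere_area TYPE('a)) *
      (\<integral>\<^sup>+r. ennreal (indicator {0..} r * r ^ (?n - 1)) * ennreal (1 / (1 + r) ^ (?n + 1)) \<partial>lborel)"
    by (rule nn_integral_radial) measurable
  also have "(\<integral>\<^sup>+r. ennreal (indicator {0..} r * r ^ (?n - 1)) * ennreal (1 / (1 + r) ^ (?n + 1)) \<partial>lborel)
      \<le> (\<integral>\<^sup>+r. ennreal (1 / (1 + r) ^ 2) * indicator {0..} r \<partial>lborel)"
  proof (intro nn_integral_mono)
    fix r :: real
    have "r ^ (?n - 1) / (1 + r) ^ (?n + 1) \<le> 1 / (1 + r) ^ 2" if "0 \<le> r"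
    proof -
      have e: "(1 + r) ^ (?n + 1) = (1 + r) ^ (?n - 1) * (1 + r) ^ 2"
        by (subst power_add[symmetric]) (use DIM_positive[where 'a='a] in \<open>simp add: numeral_2_eq_2\<close>)
      have "r ^ (?n - 1) \<le> (1 + r) ^ (?n - 1)" using that by (intro power_mono) auto
      then show ?thesis using that unfolding e by (simp add: field_simps)
    qed
    then show "ennreal (indicator {0..} r * r ^ (?n - 1)) * ennreal (1 / (1 + r) ^ (?n + 1))
      \<le> ennreal (1 / (1 + r) ^ 2) * indicator {0..} r"
      by (auto simp: indicator_def ennreal_mult[symmetric] intro!: ennreal_leI)
  qed
  also have "(\<integral>\<^sup>+r. ennreal (1 / (1 + r) ^ 2) * indicator {0..} r \<partial>lborel) = ennreal (0 - (- 1 / (1 + 0)))"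
  proof (rule nn_integral_FTC_atLeast)
    show "DERIV (\<lambda>r. - 1 / (1 + r)) r :> 1 / (1 + r)\<^sup>2" if "0 \<le> r" for r :: real
      using that by (auto intro!: derivative_eq_intros simp: power2_eq_square)
    show "((\<lambda>r::real. - 1 / (1 + r)) \<longlongrightarrow> 0) at_top" by real_asymp
  qed auto
  finally show "(\<integral>\<^sup>+x. ennreal (1 / (1 + norm (x::'a)) ^ (?n + 1)) \<partial>lborel) < \<infinity>"
    by (simp add: ennreal_mult_less_top le_less_trans mult_left_mono)
qed auto

section \<open>Powers, Gamma integrals and Gaussian integrals\<close>

lemma powr_half_square: "(x\<^sup>2) powr (a / 2) = \<bar>x\<bar> powr a" for x :: real
proof (cases "x = 0")
  case False
  then have "x\<^sup>2 = \<bar>x\<bar> powr 2" by simp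
  then show ?thesis by (simp only: powr_powr) simp
qed simp

text \<open>The mean value theorem for a power. It controls how much an error term perturbs the
leading constant of an \<open>L\<^sup>p\<close> integral, and is also Bernoulli's inequality for real exponents when read
with \<open>K + y = 1\<close>.\<close>

lemma powr_add_le_linear:
  fixes p K y Y :: real
  assumes p: "1 < p" and K: "0 < K" and y: "0 \<le> y" "y \<le> Y"
  shows "(K + y) powr p \<le> K powr p + p * (K + Y) powr (p - 1) * y"
proof (cases "y = 0")
  case False
  then have y0: "K < K + y" using y by simp
  have "\<exists>z>K. z < K + y \<and> (K + y) powr p - K powr p = (K + y - K) * (p * z powr (p - 1))"
    using K by (intro MVT2[OF y0]) (auto intro!: derivative_eq_intros)
  then obtain z where z: "K < z" "z < K + y" "(K + y) powr p - K powr p = y * (p * z powr (p - 1))" by auto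
  have "z powr (p - 1) \<le> (K + Y) powr (p - 1)" using z K y p by (intro powr_mono2) auto
  then have "y * (p * z powr (p - 1)) \<le> y * (p * (K + Y) powr (p - 1))"
    using y p by (intro mult_left_mono) auto
  then show ?thesis using z by (simp add: mult_ac)
qed simp

lemma nn_integral_Gamma_scaled:
  assumes a: "0 < a" and l: "0 < l"
  shows "(\<integral>\<^sup>+t. ennreal (indicator {0<..} t * (t powr (a - 1) * exp (- l * t))) \<partial>lborel) =
    ennreal (Gamma a * l powr (- a))" (is "?I = _")
proof -
  have "(\<integral>\<^sup>+t. ennreal (indicator {0..} t * (t powr (a - 1) / exp t)) \<partial>lborel) = ennreal (Gamma a)"
    using nn_integral_has_integral_lebesgue[OF _ Gamma_integral_real[OF a]] by simp
  also have "(\<integral>\<^sup>+t. ennreal (indicator {0..} t * (t powr (a - 1) / exp t)) \<partial>lborel) =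
      ennreal \<bar>l\<bar> * (\<integral>\<^sup>+t. ennreal (indicator {0..} (0 + l * t) * ((0 + l * t) powr (a - 1) / exp (0 + l * t))) \<partial>lborel)"
    by (rule nn_integral_real_affine) (use l in auto)
  also have "(\<integral>\<^sup>+t. ennreal (indicator {0..} (0 + l * t) * ((0 + l * t) powr (a - 1) / exp (0 + l * t))) \<partial>lborel) =
      (\<integral>\<^sup>+t. ennreal (l powr (a - 1)) * ennreal (indicator {0<..} t * (t powr (a - 1) * exp (- l * t))) \<partial>lborel)"
    using l by (intro nn_integral_cong)
      (auto simp: indicator_def powr_mult exp_minus divide_inverse ennreal_mult[symmetric] zero_le_mult_iff mult_ac)
  also have "\<dots> = ennreal (l powr (a - 1)) *
      (\<integral>\<^sup>+t. ennreal (indicator {0<..} t * (t powr (a - 1) * exp (- l * t))) \<partial>lborel)"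
    by (rule nn_integral_cmult) measurable
  finally have "ennreal (Gamma a) = ennreal \<bar>l\<bar> * (ennreal (l powr (a - 1)) * ?I)" by simp
  also have "\<dots> = ennreal (\<bar>l\<bar> * l powr (a - 1)) * ?I"
    by (simp only: mult.assoc[symmetric] ennreal_mult abs_ge_zero powr_ge_zero)
  also have "\<bar>l\<bar> * l powr (a - 1) = l powr a" using l by (simp add: powr_diff)
  finally have "ennreal (l powr (- a)) * ennreal (Gamma a) = ennreal (l powr (- a)) * ennreal (l powr a) * ?I"
    by (simp only: mult.assoc)
  also have "ennreal (l powr (- a)) * ennreal (l powr a) = 1"
    using l by (simp add: ennreal_mult[symmetric] powr_minus)
  finally show ?thesis
    using a by (simp only: mult_1 ennreal_mult[symmetric] Gamma_real_nonneg powr_ge_zero mult.commute less_imp_le)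
qed

text \<open>The substitution \<open>t \<mapsto> c / t\<close> in the Gamma integral. Such integrals evaluate time
integrals of the heat kernel at a fixed point.\<close>

lemma nn_integral_Gamma_inverse:
  assumes a: "0 < a" and c: "0 < c"
  shows "(\<integral>\<^sup>+t. ennreal (indicator {0<..} t * (t powr (- a - 1) * exp (- c / t))) \<partial>lborel) =
    ennreal (Gamma a * c powr (- a))"
proof -
  define f where "f t = t powr (a - 1) / exp t" for t :: real
  have hi: "(f has_integral Gamma a) {0<..}"
  proof -
    have "negligible {x \<in> {0..} - {0<..}. f x \<noteq> 0}" "negligible {x \<in> {0<..} - {0..}. f x \<noteq> 0}"
      by (rule negligible_subset[of "{0}"]; auto)+
    from has_integral_spike_set_eq[OF this] show ?thesis
      using Gamma_integral_real[OF a] by (simp add: f_def[abs_def])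
  qed
  then have ai: "f absolutely_integrable_on {0<..}"
    by (intro nonnegative_absolutely_integrable_1) (auto simp: f_def)
  have img: "(\<lambda>t. c / t) ` {0<..} = {0<..}"
  proof
    show "{0<..} \<subseteq> (\<lambda>t. c / t) ` {0<..}"
    proof
      fix x :: real assume "x \<in> {0<..}"
      then have "x = c / (c / x)" "c / x \<in> {0<..}" using c by auto
      then show "x \<in> (\<lambda>t. c / t) ` {0<..}" by blast
    qed
  qed (use c in auto)
  have "(\<lambda>x. \<bar>- c / x\<^sup>2\<bar> *\<^sub>R f (c / x)) absolutely_integrable_on {0<..} \<and>
      integral {0<..} (\<lambda>x. \<bar>- c / x\<^sup>2\<bar> *\<^sub>R f (c / x)) = Gamma a \<longleftrightarrow>
      f absolutely_integrable_on (\<lambda>t. c / t) ` {0<..} \<and> integral ((\<lambda>t. c / t) ` {0<..}) f = Gamma a"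
  proof (rule has_absolute_integral_change_of_variables_real)
    show "((\<lambda>t. c / t) has_real_derivative - c / x\<^sup>2) (at x within {0<..})" if "x \<in> {0<..}" for x
      using that by (auto intro!: derivative_eq_intros simp: power2_eq_square)
    show "inj_on ((/) c) {0<..}" using c by (auto simp: inj_on_def)
  qed auto
  then have "((\<lambda>x. \<bar>- c / x\<^sup>2\<bar> *\<^sub>R f (c / x)) has_integral Gamma a) {0<..}"
    unfolding img using ai hi
    by (metis (no_types, lifting) integrable_integral integral_unique set_lebesgue_integral_eq_integral(1))
  then have "((\<lambda>x. c powr (- a) * (\<bar>- c / x\<^sup>2\<bar> *\<^sub>R f (c / x))) has_integral c powr (- a) * Gamma a) {0<..}"
    by (rule has_integral_mult_right)
  moreover have "c powr (- a) * (\<bar>- c / x\<^sup>2\<bar> *\<^sub>R f (c / x)) = x powr (- a - 1) * exp (- c / x)" if "x \<in> {0<..}" for x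
  proof -
    have x: "0 < x" using that by simp
    have "c powr (- a) * (\<bar>- c / x\<^sup>2\<bar> *\<^sub>R f (c / x)) =
        (c powr (- a) * c * c powr (a - 1)) * (x powr (- (a - 1)) * x powr (- 2)) * exp (- (c / x))"
    proof -
      have "(c / x) powr (a - 1) = c powr (a - 1) * x powr (- (a - 1))"
        using x c by (subst powr_divide) (simp_all only: powr_minus divide_inverse less_imp_le)
      moreover have "\<bar>- c / x\<^sup>2\<bar> = c * x powr (- 2)"
        using x c by (simp add: powr_minus divide_inverse)
      ultimately show ?thesis
        by (simp only: f_def real_scaleR_def divide_inverse[of _ "exp _"] exp_minus mult_ac)
    qed
    also have "c powr (- a) * c * c powr (a - 1) = 1"
      using c by (simp add: powr_mult_base powr_add[symmetric] mult.assoc)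
    also have "x powr (- (a - 1)) * x powr (- 2) = x powr (- a - 1)"
      by (subst powr_add[symmetric]) (rule arg_cong[where f="(powr) x"], simp)
    finally show ?thesis by simp
  qed
  ultimately have "((\<lambda>x. x powr (- a - 1) * exp (- c / x)) has_integral c powr (- a) * Gamma a) {0<..}"
    using has_integral_cong[of "{0<..}"] by (metis (no_types, lifting))
  from nn_integral_has_integral_lebesgue[OF _ this]
  show ?thesis by (simp add: mult.commute)
qed

lemma
  fixes f :: "'a::euclidean_space \<Rightarrow> real \<Rightarrow> complex"
  assumes f: "\<And>b. b \<in> Basis \<Longrightarrow> integrable lborel (f b)"
  shows integrable_lborel_prod: "integrable lborel (\<lambda>x. \<Prod>b\<in>Basis. f b (x \<bullet> b))"
    and integral_lborel_prod: "(LINT x|lborel. (\<Prod>b\<in>Basis. f b (x \<bullet> b))) = (\<Prod>b\<in>Basis. (LINT t|lborel. f b t))"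
proof -
  interpret product_sigma_finite "\<lambda>_::'a. lborel :: real measure" ..
  have [measurable]: "f b \<in> borel_measurable borel" if "b \<in> Basis" for b
    using f[OF that] by (simp add: borel_measurable_integrable)
  have eq: "(\<Prod>b\<in>Basis. f b ((\<Sum>b\<in>Basis. y b *\<^sub>R b) \<bullet> b)) = (\<Prod>b\<in>Basis. f b (y b))" for y
    by (intro prod.cong) auto
  have "integrable (\<Pi>\<^sub>M b\<in>Basis. lborel) (\<lambda>y. \<Prod>b\<in>Basis. f b (y b))"
    by (rule product_integrable_prod) (use f in auto)
  then show "integrable lborel (\<lambda>x. \<Prod>b\<in>Basis. f b (x \<bullet> b))"
    by (subst lborel_eq, subst integrable_distr_eq) (simp_all add: eq)
  show "(LINT x|lborel. (\<Prod>b\<in>Basis. f b (x \<bullet> b))) = (\<Prod>b\<in>Basis. (LINT t|lborel. f b t))"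
    using product_integral_prod[of Basis f] f
    by (subst lborel_eq, subst integral_distr) (simp_all add: eq)
qed

text \<open>The characteristic function of the standard normal distribution, rescaled.\<close>

lemma
  assumes s: "0 < s"
  shows integrable_gaussian_real: "integrable lborel (\<lambda>t::real. iexp (y * t) * complex_of_real (exp (- s * t\<^sup>2)))"
    and integral_gaussian_real:
      "(LINT t|lborel. iexp (y * t) * complex_of_real (exp (- s * t\<^sup>2))) =
        complex_of_real (sqrt (pi / s) * exp (- y\<^sup>2 / (4 * s)))"
proof -
  define c where "c = 1 / sqrt (2 * s)"
  have c: "c > 0" "c\<^sup>2 = 1 / (2 * s)" using s by (auto simp: c_def power_divide)
  define f where "f t = iexp (y * t) * complex_of_real (exp (- s * t\<^sup>2))" for t
  have eq: "f (0 + c * x) = complex_of_real (sqrt (2 * pi)) *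
      (complex_of_real (std_normal_density x) * iexp ((y * c) * x))" for x
    using s by (simp add: f_def std_normal_density_def power_mult_distrib c(2) mult_ac)
  have ch: "(LINT x|lborel. complex_of_real (std_normal_density x) * iexp ((y * c) * x)) =
      complex_of_real (exp (- (y * c)\<^sup>2 / 2))"
  proof -
    have "char std_normal_distribution (y * c) =
        (LINT x|lborel. std_normal_density x *\<^sub>R iexp ((y * c) * x))"
      unfolding char_def by (subst integral_density) auto
    then show ?thesis using char_std_normal_distribution by (simp add: fun_eq_iff scaleR_conv_of_real)
  qed
  have int: "integrable lborel (\<lambda>x. complex_of_real (std_normal_density x) * iexp ((y * c) * x))"
  proof (rule Bochner_Integration.integrable_bound[where f=std_normal_density])
    show "integrable lborel std_normal_density"
      using integrable_std_normal_moment[of 0] by simp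
  qed (auto simp: norm_mult)
  show "integrable lborel (\<lambda>t::real. iexp (y * t) * complex_of_real (exp (- s * t\<^sup>2)))"
    using lborel_integrable_real_affine_iff[of c f 0] c int unfolding eq
    by (simp add: f_def[abs_def])
  have "(LINT t|lborel. f t) = c *\<^sub>R (LINT x|lborel. f (0 + c * x))"
    using lborel_integral_real_affine[of c f 0] c by simp
  also have "\<dots> = complex_of_real (c * sqrt (2 * pi) * exp (- (y * c)\<^sup>2 / 2))"
    unfolding eq using ch by (simp add: scaleR_conv_of_real)
  also have "c * sqrt (2 * pi) = sqrt (pi / s)"
    using s by (simp add: c_def real_sqrt_divide real_sqrt_mult)
  also have "- (y * c)\<^sup>2 / 2 = - y\<^sup>2 / (4 * s)" using c s by (simp add: power_mult_distrib)
  finally show "(LINT t|lborel. iexp (y * t) * complex_of_real (exp (- s * t\<^sup>2))) =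
        complex_of_real (sqrt (pi / s) * exp (- y\<^sup>2 / (4 * s)))"
    by (simp add: f_def)
qed

text \<open>The integrand is a product of one-dimensional ones over the coordinates.\<close>

lemma
  fixes x :: "'a::euclidean_space"
  assumes s: "0 < s"
  shows integrable_gaussian: "integrable lborel (\<lambda>\<xi>. iexp (x \<bullet> \<xi>) * complex_of_real (exp (- s * (norm \<xi>)\<^sup>2)))" (is ?I)
    and integral_gaussian:
      "(LINT \<xi>|lborel. iexp (x \<bullet> \<xi>) * complex_of_real (exp (- s * (norm \<xi>)\<^sup>2))) =
        complex_of_real ((pi / s) powr (real DIM('a) / 2) * exp (- (norm x)\<^sup>2 / (4 * s)))" (is ?E)
proof -
  define f where "f b t = iexp ((x \<bullet> b) * t) * complex_of_real (exp (- s * t\<^sup>2))" for b t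
  have eq: "iexp (x \<bullet> \<xi>) * complex_of_real (exp (- s * (norm \<xi>)\<^sup>2)) = (\<Prod>b\<in>Basis. f b (\<xi> \<bullet> b))" for \<xi>
  proof -
    have "(norm \<xi>)\<^sup>2 = (\<Sum>b\<in>Basis. (\<xi> \<bullet> b)\<^sup>2)"
      unfolding power2_norm_eq_inner by (subst euclidean_inner) (simp add: power2_eq_square)
    moreover have "x \<bullet> \<xi> = (\<Sum>b\<in>Basis. (x \<bullet> b) * (\<xi> \<bullet> b))" by (rule euclidean_inner)
    ultimately show ?thesis
      by (simp add: f_def prod.distrib exp_sum[symmetric] sum_distrib_left flip: of_real_prod exp_of_real)
  qed
  have f: "integrable lborel (f b)" for b unfolding f_def by (rule integrable_gaussian_real[OF s])
  show ?I unfolding eq by (rule integrable_lborel_prod) (rule f)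
  have "(\<Prod>b\<in>(Basis::'a set). sqrt (pi / s) * exp (- (x \<bullet> b)\<^sup>2 / (4 * s))) =
     (pi / s) powr (real DIM('a) / 2) * exp (- (norm x)\<^sup>2 / (4 * s))"
  proof -
    have "(norm x)\<^sup>2 = (\<Sum>b\<in>Basis. (x \<bullet> b)\<^sup>2)"
      unfolding power2_norm_eq_inner by (subst euclidean_inner) (simp add: power2_eq_square)
    then have "(\<Prod>b\<in>(Basis::'a set). exp (- (x \<bullet> b)\<^sup>2 / (4 * s))) = exp (- (norm x)\<^sup>2 / (4 * s))"
      by (simp add: exp_sum[symmetric] sum_divide_distrib[symmetric] sum_negf)
    moreover have "sqrt (pi / s) ^ DIM('a) = (pi / s) powr (real DIM('a) / 2)"
      using s by (simp add: powr_half_sqrt[symmetric] powr_powr flip: powr_realpow)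
    ultimately show ?thesis by (simp add: prod.distrib)
  qed
  then show ?E
    unfolding eq using integral_lborel_prod[of f, OF f]
    by (simp only: f_def integral_gaussian_real[OF s] flip: of_real_prod)
qed

section \<open>The Fourier transform of integrable functions\<close>

text \<open>The two transforms differ by a reflection only, so that all estimates
need to be made for one of them.\<close>

lemma fourier_inv_eq_fourier: "fourier_inv f x = fourier f (- x)"
  unfolding fourier_inv_def fourier_def by (simp add: inner_commute)

lemma fourier_lborel:
  assumes [measurable]: "f \<in> borel_measurable borel"
  shows "fourier f (\<xi>::'a::euclidean_space) = complex_of_real ((2 * pi) powr (- real DIM('a) / 2)) *
     (LINT x|lborel. iexp (- (x \<bullet> \<xi>)) * f x)"
  unfolding fourier_def by (subst integral_completion) (auto simp: mult_ac)

lemma borel_measurable_fourier: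
  fixes f :: "'a::euclidean_space \<Rightarrow> complex"
  assumes [measurable]: "f \<in> borel_measurable borel"
  shows "fourier f \<in> borel_measurable borel"
proof -
  have "(\<lambda>\<xi>. complex_of_real ((2 * pi) powr (- real DIM('a) / 2)) *
     (LINT x|lborel. iexp (- (x \<bullet> \<xi>)) * f x)) \<in> borel_measurable borel"
    by measurable
  then show ?thesis by (simp add: fourier_lborel[OF assms, abs_def])
qed

lemma integrable_iexp_mult:
  assumes "integrable lborel f"
  shows "integrable lborel (\<lambda>x::'a::euclidean_space. iexp (- (x \<bullet> \<xi>)) * f x)"
  by (rule Bochner_Integration.integrable_bound[OF assms])
    (use borel_measurable_integrable[OF assms] in \<open>auto simp: norm_mult\<close>)

lemma fourier_bounded:
  assumes f: "integrable lborel f"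
  shows "\<exists>C\<ge>0. \<forall>\<xi>::'a::euclidean_space. norm (fourier f \<xi>) \<le> C"
proof -
  have [measurable]: "f \<in> borel_measurable borel" using f by auto
  have "norm (fourier f \<xi>) \<le> (2 * pi) powr (- real DIM('a) / 2) * (LINT x|lborel. norm (f x))" for \<xi>
  proof -
    have "norm (LINT x|lborel. iexp (- (x \<bullet> \<xi>)) * f x) \<le> (LINT x|lborel. norm (iexp (- (x \<bullet> \<xi>)) * f x))"
      by (rule integral_norm_bound)
    then show ?thesis by (simp add: fourier_lborel norm_mult mult_left_mono)
  qed
  then show ?thesis by (intro exI[of _ "(2 * pi) powr (- real DIM('a) / 2) * (LINT x|lborel. norm (f x))"]) auto
qed

text \<open>Fubini's theorem: the kernel is symmetric in its two variables.\<close>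

lemma fourier_multiplication_formula:
  fixes f g :: "'a::euclidean_space \<Rightarrow> complex"
  assumes f: "integrable lborel f" and g: "integrable lborel g"
  shows "(LINT \<xi>|lborel. fourier f \<xi> * g \<xi>) = (LINT x|lborel. f x * fourier g x)"
proof -
  have [measurable]: "f \<in> borel_measurable borel" "g \<in> borel_measurable borel" using f g by auto
  let ?k = "\<lambda>x \<xi>. iexp (- (x \<bullet> \<xi>)) * f x * g \<xi>"
  have "integrable (lborel \<Otimes>\<^sub>M lborel) (\<lambda>(x, \<xi>). f x * g \<xi>)"
    by (rule lborel_pair.Fubini_integrable) (use f g in \<open>auto simp: norm_mult\<close>)
  then have "integrable (lborel \<Otimes>\<^sub>M lborel) (\<lambda>(x, \<xi>). ?k x \<xi>)"
    by (rule Bochner_Integration.integrable_bound) (auto simp: norm_mult)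
  then have "(LINT \<xi>|lborel. LINT x|lborel. ?k x \<xi>) = (LINT x|lborel. LINT \<xi>|lborel. ?k x \<xi>)"
    by (rule lborel_pair.Fubini_integral)
  moreover have "(LINT x|lborel. ?k x \<xi>) = (LINT x|lborel. iexp (- (x \<bullet> \<xi>)) * f x) * g \<xi>" for \<xi>
    by (rule integral_mult_left_zero)
  moreover have "(LINT \<xi>|lborel. ?k x \<xi>) = f x * (LINT \<xi>|lborel. iexp (- (\<xi> \<bullet> x)) * g \<xi>)" for x
    by (subst integral_mult_right_zero[symmetric]) (simp add: mult_ac inner_commute)
  ultimately show ?thesis
    by (simp add: fourier_lborel mult.assoc mult.left_commute[of _ "complex_of_real _"])
qed

lemma fourier_affine:
  fixes f :: "'a::euclidean_space \<Rightarrow> complex"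
  assumes [measurable]: "f \<in> borel_measurable borel" and c: "c \<noteq> 0"
  shows "fourier (\<lambda>x. f (a + c *\<^sub>R x)) \<xi> =
    complex_of_real (1 / \<bar>c\<bar> ^ DIM('a)) * iexp ((a \<bullet> \<xi>) / c) * fourier f (\<xi> /\<^sub>R c)"
proof -
  have "(LINT x|lborel. iexp (- (x \<bullet> (\<xi> /\<^sub>R c))) * f x) =
      (\<bar>c\<bar> ^ DIM('a)) *\<^sub>R (LINT x|lborel. iexp (- ((a + c *\<^sub>R x) \<bullet> (\<xi> /\<^sub>R c))) * f (a + c *\<^sub>R x))"
    by (rule integral_lborel_affine) (use c in auto)
  also have "(\<lambda>x. iexp (- ((a + c *\<^sub>R x) \<bullet> (\<xi> /\<^sub>R c))) * f (a + c *\<^sub>R x)) =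
      (\<lambda>x. iexp (- (a \<bullet> \<xi>) / c) * (iexp (- (x \<bullet> \<xi>)) * f (a + c *\<^sub>R x)))"
  proof
    fix x
    have "iexp (- ((a + c *\<^sub>R x) \<bullet> (\<xi> /\<^sub>R c))) = iexp (- (a \<bullet> \<xi>) / c) * iexp (- (x \<bullet> \<xi>))"
    proof -
      have "- ((a + c *\<^sub>R x) \<bullet> (\<xi> /\<^sub>R c)) = - (a \<bullet> \<xi>) / c + - (x \<bullet> \<xi>)"
        using c by (simp add: inner_add_left divide_inverse ring_distribs mult.commute mult.left_commute)
      then show ?thesis by (simp only: of_real_add distrib_left exp_add)
    qed
    then show "iexp (- ((a + c *\<^sub>R x) \<bullet> (\<xi> /\<^sub>R c))) * f (a + c *\<^sub>R x) =
      iexp (- (a \<bullet> \<xi>) / c) * (iexp (- (x \<bullet> \<xi>)) * f (a + c *\<^sub>R x))"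
      by (simp only: mult.assoc)
  qed
  finally have "(LINT x|lborel. iexp (- (x \<bullet> (\<xi> /\<^sub>R c))) * f x) = complex_of_real (\<bar>c\<bar> ^ DIM('a)) *
      (iexp (- (a \<bullet> \<xi>) / c) * (LINT x|lborel. iexp (- (x \<bullet> \<xi>)) * f (a + c *\<^sub>R x)))"
    by (simp only: integral_mult_right_zero scaleR_conv_of_real)
  moreover have "iexp ((a \<bullet> \<xi>) / c) * iexp (- (a \<bullet> \<xi>) / c) = 1"
    by (simp add: exp_minus)
  ultimately have "iexp ((a \<bullet> \<xi>) / c) * (LINT x|lborel. iexp (- (x \<bullet> (\<xi> /\<^sub>R c))) * f x) =
      (\<bar>c\<bar> ^ DIM('a)) *\<^sub>R (LINT x|lborel. iexp (- (x \<bullet> \<xi>)) * f (a + c *\<^sub>R x))"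
    by (simp only: scaleR_conv_of_real mult.left_commute[of "iexp ((a \<bullet> \<xi>) / c)" "complex_of_real _"])
      (simp only: mult.assoc[symmetric] mult_1)
  then have "(LINT x|lborel. iexp (- (x \<bullet> \<xi>)) * f (a + c *\<^sub>R x)) = complex_of_real (1 / \<bar>c\<bar> ^ DIM('a)) *
     (iexp ((a \<bullet> \<xi>) / c) * (LINT x|lborel. iexp (- (x \<bullet> (\<xi> /\<^sub>R c))) * f x))"
    using c by (simp add: scaleR_conv_of_real)
  then show ?thesis by (simp add: fourier_lborel mult_ac)
qed

lemma fourier_reflect:
  fixes f :: "'a::euclidean_space \<Rightarrow> complex"
  assumes "f \<in> borel_measurable borel"
  shows "fourier (\<lambda>x. f (- x)) \<xi> = fourier f (- \<xi>)"
  using fourier_affine[OF assms, of "-1" 0 \<xi>] by simp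

text \<open>A Fourier multiplier with an even symbol is symmetric. This takes two applications of the multiplication
formula and a reflection, and no inversion of the transform.\<close>

lemma multiplier_duality:
  fixes f g :: "'a::euclidean_space \<Rightarrow> complex"
  assumes f: "integrable lborel f" and g: "integrable lborel g"
    and m: "\<And>\<xi>. m (- \<xi>) = m \<xi>"
    and mf: "integrable lborel (\<lambda>\<xi>. m \<xi> * fourier f \<xi>)" and mg: "integrable lborel (\<lambda>\<xi>. m \<xi> * fourier g \<xi>)"
  shows "(LINT x|lborel. f x * fourier_inv (\<lambda>\<xi>. m \<xi> * fourier g \<xi>) x) =
    (LINT x|lborel. fourier_inv (\<lambda>\<xi>. m \<xi> * fourier f \<xi>) x * g x)"
proof -
  have [measurable]: "f \<in> borel_measurable borel" "g \<in> borel_measurable borel"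
    "(\<lambda>\<xi>. m \<xi> * fourier f \<xi>) \<in> borel_measurable borel" "(\<lambda>\<xi>. m \<xi> * fourier g \<xi>) \<in> borel_measurable borel"
    using f g mf mg by auto
  note [measurable] = borel_measurable_fourier[of f] borel_measurable_fourier[of g]
  have refl_int: "integrable lborel (\<lambda>\<xi>. h (- \<xi>))" if "integrable lborel h" for h :: "'a \<Rightarrow> complex"
    using that integrable_lborel_affine[of h "-1" 0] by auto
  have "(LINT x|lborel. f x * fourier_inv (\<lambda>\<xi>. m \<xi> * fourier g \<xi>) x) =
      (LINT x|lborel. f x * fourier (\<lambda>\<xi>. m (- \<xi>) * fourier g (- \<xi>)) x)"
    unfolding fourier_inv_eq_fourier by (subst fourier_reflect) auto
  also have "\<dots> = (LINT \<xi>|lborel. fourier f \<xi> * (m (- \<xi>) * fourier g (- \<xi>)))"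
    by (rule fourier_multiplication_formula[symmetric, OF f refl_int[OF mg]])
  also have "\<dots> = (LINT \<xi>|lborel. fourier g \<xi> * (m (- \<xi>) * fourier f (- \<xi>)))"
  proof -
    have "(\<lambda>\<xi>. m (- \<xi>) * fourier g (- \<xi>)) \<in> borel_measurable borel"
      using refl_int[OF mg] by auto
    then have "(\<lambda>\<xi>. fourier f \<xi> * (m (- \<xi>) * fourier g (- \<xi>))) \<in> borel_measurable borel"
      by measurable
    from integral_lborel_affine[OF this, of "-1" 0] show ?thesis
      by (simp add: m mult_ac)
  qed
  also have "\<dots> = (LINT x|lborel. g x * fourier (\<lambda>\<xi>. m (- \<xi>) * fourier f (- \<xi>)) x)"
    by (rule fourier_multiplication_formula[OF g refl_int[OF mf]])
  also have "\<dots> = (LINT x|lborel. fourier_inv (\<lambda>\<xi>. m \<xi> * fourier f \<xi>) x * g x)"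
    unfolding fourier_inv_eq_fourier by (subst fourier_reflect) (auto simp: mult.commute)
  finally show ?thesis .
qed

lemma fourier_radial:
  fixes f :: "'a::euclidean_space \<Rightarrow> complex"
  assumes [measurable]: "f \<in> borel_measurable borel"
    and rad: "\<And>x y. norm x = norm y \<Longrightarrow> f x = f y" and eq: "norm \<xi> = norm \<eta>"
  shows "fourier f \<xi> = fourier f \<eta>"
proof -
  obtain R where R: "orthogonal_transformation R" "R \<xi> = \<eta>" using exists_reflection[OF eq] .
  have "(LINT x|lborel. iexp (- (R x \<bullet> \<eta>)) * f (R x)) = (LINT x|lborel. iexp (- (x \<bullet> \<eta>)) * f x)"
    using R(1) by (rule integral_lborel_orthogonal) measurable
  moreover have "R x \<bullet> \<eta> = x \<bullet> \<xi>" for x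
    using R unfolding orthogonal_transformation_def by metis
  moreover have "f (R x) = f x" for x
    using R(1) by (intro rad) (simp add: orthogonal_transformation)
  ultimately show ?thesis by (simp add: fourier_lborel)
qed

lemma fourier_radial_real:
  fixes f :: "'a::euclidean_space \<Rightarrow> complex"
  assumes [measurable]: "f \<in> borel_measurable borel"
    and rad: "\<And>x y. norm x = norm y \<Longrightarrow> f x = f y" and real: "\<And>x. f x \<in> \<real>"
  shows "fourier f \<xi> \<in> \<real>"
proof -
  have "cnj (LINT x|lborel. iexp (- (x \<bullet> \<xi>)) * f x) = (LINT x|lborel. cnj (iexp (- (x \<bullet> \<xi>)) * f x))"
    by (rule Bochner_Integration.integral_cnj[symmetric])
  also have "\<dots> = (LINT x|lborel. iexp (- (x \<bullet> (- \<xi>))) * f x)"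
    using real by (simp add: exp_cnj Reals_cnj_iff)
  finally have "cnj (fourier f \<xi>) = fourier f (- \<xi>)" by (simp add: fourier_lborel)
  also have "\<dots> = fourier f \<xi>" by (rule fourier_radial[OF assms(1)]) (fact rad, simp)
  finally show ?thesis by (simp add: Reals_cnj_iff)
qed

section \<open>Decay of the Fourier transform of differentiable functions\<close>

text \<open>The class of integrable majorised functions used on the Fourier side: the bound is
robust under shifts of the argument by at most one, which integrability alone is not.\<close>

definition decaying :: "('a::euclidean_space \<Rightarrow> complex) \<Rightarrow> bool" where
  "decaying f \<longleftrightarrow> f \<in> borel_measurable borel \<and>
     (\<exists>C. \<forall>x. norm (f x) \<le> C / (1 + norm x) ^ (DIM('a) + 1))"

lemma decayingI:
  fixes f :: "'a::euclidean_space \<Rightarrow> complex"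
  assumes "f \<in> borel_measurable borel" "\<And>x. norm (f x) \<le> C / (1 + norm x) ^ (DIM('a) + 1)"
  shows "decaying f"
  using assms unfolding decaying_def by blast

lemma decaying_integrable:
  fixes f :: "'a::euclidean_space \<Rightarrow> complex"
  assumes "decaying f" shows "integrable lborel f"
proof -
  obtain C where [measurable]: "f \<in> borel_measurable borel"
    and C: "\<And>x. norm (f x) \<le> C / (1 + norm x) ^ (DIM('a) + 1)"
    using assms unfolding decaying_def by blast
  have "integrable lborel (\<lambda>x::'a. C * (1 / (1 + norm x) ^ (DIM('a) + 1)))"
    using integrable_inverse_power_decay by (rule integrable_mult_right)
  then show ?thesis
  proof (rule Bochner_Integration.integrable_bound)
    show "AE x in lborel. norm (f x) \<le> norm (C * (1 / (1 + norm x) ^ (DIM('a) + 1)))"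
      using C by (intro AE_I2) (smt (verit) mult_cancel_left1 real_norm_def times_divide_eq_right)
  qed simp
qed

lemma decaying_measurable: "decaying f \<Longrightarrow> f \<in> borel_measurable borel"
  by (simp add: decaying_def)

lemma decaying_add: "decaying f \<Longrightarrow> decaying g \<Longrightarrow> decaying (\<lambda>x. f x + g x)"
  for f :: "'a::euclidean_space \<Rightarrow> complex"
proof -
  assume "decaying f" "decaying g"
  then obtain C D where m[measurable]: "f \<in> borel_measurable borel" "g \<in> borel_measurable borel"
    and C: "\<And>x. norm (f x) \<le> C / (1 + norm x) ^ (DIM('a) + 1)"
    and D: "\<And>x. norm (g x) \<le> D / (1 + norm x) ^ (DIM('a) + 1)"
    unfolding decaying_def by blast
  show ?thesis
  proof (rule decayingI[where C="C + D"])
    show "norm (f x + g x) \<le> (C + D) / (1 + norm x) ^ (DIM('a) + 1)" for x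
      unfolding add_divide_distrib using C[of x] D[of x] norm_triangle_ineq[of "f x" "g x"] by linarith
  qed simp
qed

lemma decaying_cmult: "decaying f \<Longrightarrow> decaying (\<lambda>x. c * f x)"
  for f :: "'a::euclidean_space \<Rightarrow> complex"
proof -
  assume "decaying f"
  then obtain C where m[measurable]: "f \<in> borel_measurable borel"
    and C: "\<And>x. norm (f x) \<le> C / (1 + norm x) ^ (DIM('a) + 1)"
    unfolding decaying_def by blast
  show ?thesis
  proof (rule decayingI[where C="norm c * C"])
    show "norm (c * f x) \<le> (norm c * C) / (1 + norm x) ^ (DIM('a) + 1)" for x
      using mult_left_mono[OF C[of x] norm_ge_zero[of c]] by (simp add: norm_mult)
  qed simp
qed

text \<open>Integration by parts in the direction \<open>b\<close> without Fubini: translating \<open>f\<close> by \<open>t b\<close>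
multiplies the transform by \<open>exp (i t b \<bullet> \<xi>)\<close>, so the transform of the difference quotient is known
exactly, and as \<open>t\<close> tends to \<open>0\<close> dominated convergence gives the transform of the derivative.\<close>

lemma fourier_directional_derivative:
  fixes f f' :: "'a::euclidean_space \<Rightarrow> complex"
  assumes f: "decaying f" and f': "decaying f'" and b: "norm b = 1"
    and deriv: "\<And>x. ((\<lambda>t. f (x + t *\<^sub>R b)) has_vector_derivative f' x) (at 0)"
  shows "fourier f' \<xi> = \<i> * complex_of_real (b \<bullet> \<xi>) * fourier f \<xi>"
proof -
  have [measurable]: "f \<in> borel_measurable borel" "f' \<in> borel_measurable borel"
    using f f' by (auto simp: decaying_measurable)
  obtain C where C: "\<And>x. norm (f' x) \<le> C / (1 + norm x) ^ (DIM('a) + 1)"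
    using f' unfolding decaying_def by blast
  have C0: "0 \<le> C" using order_trans[OF norm_ge_zero C[of 0]] by simp
  \<comment> \<open>a null sequence in \<open>(0, 1]\<close>; steps of length at most one keep the decay bound under shifts\<close>
  define t where "t k = 1 / (real k + 1)" for k
  have t: "0 < t k" "t k \<le> 1" for k by (auto simp: t_def)
  have t_lim: "t \<longlonglongrightarrow> 0" unfolding t_def by real_asymp
  have t_at: "filterlim t (at 0) sequentially"
    using t_lim t by (intro filterlim_atI) (auto simp: less_imp_neq[symmetric])
  define q where "q k x = (f (x + t k *\<^sub>R b) - f x) / complex_of_real (t k)" for k x
  have [measurable]: "q k \<in> borel_measurable borel" for k unfolding q_def by measurable
  have q_lim: "(\<lambda>k. q k x) \<longlonglongrightarrow> f' x" for x
  proof -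
    have "((\<lambda>s. norm (f (x + s *\<^sub>R b) - f x - s *\<^sub>R f' x) / norm s) \<longlongrightarrow> 0) (at 0)"
      using deriv[of x] by (simp add: has_vector_derivative_def has_derivative_at)
    from filterlim_compose[OF this t_at]
    have "(\<lambda>k. norm (f (x + t k *\<^sub>R b) - f x - t k *\<^sub>R f' x) / norm (t k)) \<longlonglongrightarrow> 0" .
    also have "(\<lambda>k. norm (f (x + t k *\<^sub>R b) - f x - t k *\<^sub>R f' x) / norm (t k)) = (\<lambda>k. norm (q k x - f' x))"
    proof
      fix k
      have "q k x - f' x = (f (x + t k *\<^sub>R b) - f x - t k *\<^sub>R f' x) / complex_of_real (t k)"
        using t[of k] by (simp add: q_def scaleR_conv_of_real diff_divide_distrib)
      then show "norm (f (x + t k *\<^sub>R b) - f x - t k *\<^sub>R f' x) / norm (t k) = norm (q k x - f' x)"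
        by (simp add: norm_divide)
    qed
    finally show ?thesis by (simp add: tendsto_norm_zero_iff LIM_zero_iff)
  qed
  have deriv': "((\<lambda>t. f (x + t *\<^sub>R b)) has_vector_derivative f' (x + s *\<^sub>R b)) (at s)" for x s
  proof -
    have "((\<lambda>t. f ((x + s *\<^sub>R b) + t *\<^sub>R b)) has_vector_derivative f' (x + s *\<^sub>R b)) (at 0)"
      by (rule deriv)
    then have *: "((\<lambda>t. f ((x + s *\<^sub>R b) + t *\<^sub>R b)) has_vector_derivative f' (x + s *\<^sub>R b)) (at ((\<lambda>t. t - s) s))"
      by simp
    have "((\<lambda>t. t - s) has_vector_derivative 1) (at s)"
      by (auto intro!: derivative_eq_intros)
    from vector_diff_chain_at[OF this *]
    have "((\<lambda>t. f ((x + s *\<^sub>R b) + t *\<^sub>R b)) \<circ> (\<lambda>t. t - s) has_vector_derivative f' (x + s *\<^sub>R b)) (at s)"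
      by simp
    then show ?thesis by (simp add: o_def algebra_simps)
  qed
  \<comment> \<open>the mean value inequality along the segment from \<open>x\<close> to \<open>x + t k *\<^sub>R b\<close>, where \<open>1 + norm\<close> changes at most by a factor two\<close>
  have q_bound: "norm (q k x) \<le> C * 2 ^ (DIM('a) + 1) * (1 / (1 + norm x) ^ (DIM('a) + 1))" for k x
  proof -
    have pt: "norm (f' (x + s *\<^sub>R b)) \<le> C * 2 ^ (DIM('a) + 1) * (1 / (1 + norm x) ^ (DIM('a) + 1))"
      if s: "s \<in> {0..t k}" for s
    proof -
      have "norm x \<le> norm (x + s *\<^sub>R b) + norm (s *\<^sub>R b)"
        by (metis add_diff_cancel norm_triangle_ineq4)
      then have "(1 + norm x) / 2 \<le> 1 + norm (x + s *\<^sub>R b)"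
        using s t[of k] b norm_ge_zero[of "x + s *\<^sub>R b"] by (auto simp: field_simps simp del: norm_ge_zero)
      then have "((1 + norm x) / 2) ^ (DIM('a) + 1) \<le> (1 + norm (x + s *\<^sub>R b)) ^ (DIM('a) + 1)"
        by (intro power_mono) auto
      then have "C / (1 + norm (x + s *\<^sub>R b)) ^ (DIM('a) + 1) \<le> C / ((1 + norm x) / 2) ^ (DIM('a) + 1)"
        using C0 by (intro divide_left_mono mult_pos_pos zero_less_power) (auto simp: add_pos_nonneg)
      also have "\<dots> = C * 2 ^ (DIM('a) + 1) * (1 / (1 + norm x) ^ (DIM('a) + 1))"
        by (simp add: power_divide)
      finally show ?thesis using C[of "x + s *\<^sub>R b"] by linarith
    qed
    have "norm (f (x + t k *\<^sub>R b) - f (x + 0 *\<^sub>R b)) \<le>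
        (C * 2 ^ (DIM('a) + 1) * (1 / (1 + norm x) ^ (DIM('a) + 1))) * norm (t k - 0)"
    proof (rule differentiable_bound[where S="{0..t k}" and f'="\<lambda>s h. h *\<^sub>R f' (x + s *\<^sub>R b)"])
      show "((\<lambda>s. f (x + s *\<^sub>R b)) has_derivative (\<lambda>h. h *\<^sub>R f' (x + s *\<^sub>R b))) (at s within {0..t k})" for s
        using deriv'[of x s] by (simp add: has_vector_derivative_def has_derivative_at_withinI)
      show "onorm (\<lambda>h. h *\<^sub>R f' (x + s *\<^sub>R b)) \<le> C * 2 ^ (DIM('a) + 1) * (1 / (1 + norm x) ^ (DIM('a) + 1))"
        if "s \<in> {0..t k}" for s
      proof (rule onorm_le)
        fix h :: real
        show "norm (h *\<^sub>R f' (x + s *\<^sub>R b)) \<le> C * 2 ^ (DIM('a) + 1) * (1 / (1 + norm x) ^ (DIM('a) + 1)) * norm h"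
          using mult_left_mono[OF pt[OF that] norm_ge_zero[of h]] by (simp only: norm_scaleR real_norm_def mult.commute)
      qed
    qed (use t[of k] in auto)
    then show ?thesis using t[of k] by (simp add: q_def norm_divide pos_divide_le_eq)
  qed
  let ?I = "\<lambda>g. (LINT x|lborel. iexp (- (x \<bullet> \<xi>)) * g x)"
  have shift: "?I (q k) = (iexp (t k * (b \<bullet> \<xi>)) - 1) / complex_of_real (t k) * ?I f" for k
  proof -
    have i1: "integrable lborel (\<lambda>x. iexp (- (x \<bullet> \<xi>)) * f x)"
      using f by (intro integrable_iexp_mult decaying_integrable)
    then have i2: "integrable lborel (\<lambda>x. iexp (- ((t k *\<^sub>R b + 1 *\<^sub>R x) \<bullet> \<xi>)) * f (t k *\<^sub>R b + 1 *\<^sub>R x))"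
      by (subst integrable_lborel_affine) auto
    have e: "iexp (- (x \<bullet> \<xi>)) * q k x =
       (iexp (t k * (b \<bullet> \<xi>)) * (iexp (- ((t k *\<^sub>R b + 1 *\<^sub>R x) \<bullet> \<xi>)) * f (t k *\<^sub>R b + 1 *\<^sub>R x))
         - iexp (- (x \<bullet> \<xi>)) * f x) / complex_of_real (t k)" for x
    proof -
      have "iexp (t k * (b \<bullet> \<xi>)) * iexp (- ((t k *\<^sub>R b + 1 *\<^sub>R x) \<bullet> \<xi>)) = iexp (- (x \<bullet> \<xi>))"
        by (simp add: exp_add[symmetric] inner_add_left algebra_simps)
      then show ?thesis by (simp add: q_def mult.assoc[symmetric] right_diff_distrib add.commute)
    qed
    have "?I (q k) = (iexp (t k * (b \<bullet> \<xi>)) *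
       (LINT x|lborel. iexp (- ((t k *\<^sub>R b + 1 *\<^sub>R x) \<bullet> \<xi>)) * f (t k *\<^sub>R b + 1 *\<^sub>R x)) - ?I f) / complex_of_real (t k)"
      unfolding e using i1 i2 by (simp only: integral_divide_zero Bochner_Integration.integral_diff
          integral_mult_right_zero integrable_mult_right)
    also have "(LINT x|lborel. iexp (- ((t k *\<^sub>R b + 1 *\<^sub>R x) \<bullet> \<xi>)) * f (t k *\<^sub>R b + 1 *\<^sub>R x)) = ?I f"
      using integral_lborel_affine[of "\<lambda>x. iexp (- (x \<bullet> \<xi>)) * f x" 1 "t k *\<^sub>R b"] by simp
    finally show ?thesis by (simp add: field_simps)
  qed
  have "(\<lambda>k. ?I (q k)) \<longlonglongrightarrow> ?I f'"
  proof (rule integral_dominated_convergence)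
    show "integrable lborel (\<lambda>x::'a. C * 2 ^ (DIM('a) + 1) * (1 / (1 + norm x) ^ (DIM('a) + 1)))"
      by (intro integrable_mult_right integrable_inverse_power_decay)
    show "AE x in lborel. (\<lambda>k. iexp (- (x \<bullet> \<xi>)) * q k x) \<longlonglongrightarrow> iexp (- (x \<bullet> \<xi>)) * f' x"
      by (intro AE_I2 tendsto_intros q_lim)
    show "AE x in lborel. norm (iexp (- (x \<bullet> \<xi>)) * q k x) \<le> C * 2 ^ (DIM('a) + 1) * (1 / (1 + norm x) ^ (DIM('a) + 1))" for k
      by (intro AE_I2) (use q_bound in \<open>simp add: norm_mult\<close>)
  qed measurable
  moreover have "(\<lambda>k. ?I (q k)) \<longlonglongrightarrow> \<i> * complex_of_real (b \<bullet> \<xi>) * ?I f"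
  proof -
    have "((\<lambda>z. (exp (\<i> * complex_of_real (b \<bullet> \<xi>) * z) - 1) / z) \<longlongrightarrow> \<i> * complex_of_real (b \<bullet> \<xi>)) (at 0)"
    proof -
      have "((\<lambda>z. exp (\<i> * complex_of_real (b \<bullet> \<xi>) * z)) has_field_derivative \<i> * complex_of_real (b \<bullet> \<xi>)) (at 0)"
        by (auto intro!: derivative_eq_intros)
      then show ?thesis by (simp add: has_field_derivative_iff)
    qed
    moreover have "filterlim (\<lambda>k. complex_of_real (t k)) (at 0) sequentially"
      using t t_lim by (intro filterlim_atI tendsto_of_real[where a=0, simplified]) 
        (auto simp: less_imp_neq[symmetric])
    ultimately have "(\<lambda>k. (exp (\<i> * complex_of_real (b \<bullet> \<xi>) * complex_of_real (t k)) - 1) / complex_of_real (t k))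
        \<longlonglongrightarrow> \<i> * complex_of_real (b \<bullet> \<xi>)"
      by (rule filterlim_compose)
    then show ?thesis unfolding shift by (intro tendsto_intros) (simp add: mult_ac)
  qed
  ultimately have "?I f' = \<i> * complex_of_real (b \<bullet> \<xi>) * ?I f"
    by (rule LIMSEQ_unique)
  then show ?thesis by (simp add: fourier_lborel mult_ac)
qed

text \<open>Only iterated derivatives in one fixed direction are recorded. Taking \<open>b\<close> through a
basis, this is enough for decay of the transform, and it covers both Schwartz functions and bumps of
finite smoothness.\<close>

primrec directionally_smooth :: "'a::euclidean_space \<Rightarrow> nat \<Rightarrow> ('a \<Rightarrow> complex) \<Rightarrow> bool" where
  "directionally_smooth b 0 f \<longleftrightarrow> decaying f"
| "directionally_smooth b (Suc N) f \<longleftrightarrow> decaying f \<and>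
    (\<exists>f'. (\<forall>x. ((\<lambda>t. f (x + t *\<^sub>R b)) has_vector_derivative f' x) (at 0)) \<and> directionally_smooth b N f')"

lemma directionally_smooth_imp_decaying: "directionally_smooth b N f \<Longrightarrow> decaying f"
  by (cases N) auto

lemma directionally_smooth_add:
  "directionally_smooth b N f \<Longrightarrow> directionally_smooth b N g \<Longrightarrow> directionally_smooth b N (\<lambda>x. f x + g x)"
proof (induction N arbitrary: f g)
  case (Suc N)
  then obtain f' g' where
    "\<forall>x. ((\<lambda>t. f (x + t *\<^sub>R b)) has_vector_derivative f' x) (at 0)" "directionally_smooth b N f'"
    "\<forall>x. ((\<lambda>t. g (x + t *\<^sub>R b)) has_vector_derivative g' x) (at 0)" "directionally_smooth b N g'"
    by auto
  then have "\<forall>x. ((\<lambda>t. f (x + t *\<^sub>R b) + g (x + t *\<^sub>R b)) has_vector_derivative f' x + g' x) (at 0)"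
    "directionally_smooth b N (\<lambda>x. f' x + g' x)"
    using Suc.IH by (auto intro: has_vector_derivative_add)
  then show ?case using Suc.prems by (auto intro!: decaying_add exI[of _ "\<lambda>x. f' x + g' x"])
qed (simp add: decaying_add)

lemma directionally_smooth_cmult:
  "directionally_smooth b N f \<Longrightarrow> directionally_smooth b N (\<lambda>x. c * f x)"
proof (induction N arbitrary: f)
  case (Suc N)
  then obtain f' where
    "\<forall>x. ((\<lambda>t. f (x + t *\<^sub>R b)) has_vector_derivative f' x) (at 0)" "directionally_smooth b N f'"
    by auto
  then have "\<forall>x. ((\<lambda>t. c * f (x + t *\<^sub>R b)) has_vector_derivative c * f' x) (at 0)"
    "directionally_smooth b N (\<lambda>x. c * f' x)"
    using Suc.IH by (auto intro: has_vector_derivative_mult_right)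
  then show ?case using Suc.prems by (auto intro!: decaying_cmult exI[of _ "\<lambda>x. c * f' x"])
qed (simp add: decaying_cmult)

lemma fourier_directional_decay:
  assumes "directionally_smooth b N f" "norm b = 1"
  shows "\<exists>C. \<forall>\<xi>. \<bar>b \<bullet> \<xi>\<bar> ^ N * norm (fourier f \<xi>) \<le> C"
  using assms(1)
proof (induction N arbitrary: f)
  case 0
  then show ?case using fourier_bounded[OF decaying_integrable[of f]] by auto
next
  case (Suc N)
  then obtain f' where f': "\<And>x. ((\<lambda>t. f (x + t *\<^sub>R b)) has_vector_derivative f' x) (at 0)"
    "directionally_smooth b N f'" and f: "decaying f" by auto
  from Suc.IH[OF f'(2)] obtain C where C: "\<And>\<xi>. \<bar>b \<bullet> \<xi>\<bar> ^ N * norm (fourier f' \<xi>) \<le> C" by blast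
  have "fourier f' \<xi> = \<i> * complex_of_real (b \<bullet> \<xi>) * fourier f \<xi>" for \<xi>
    by (rule fourier_directional_derivative)
      (use f f' assms(2) directionally_smooth_imp_decaying in auto)
  then have "\<bar>b \<bullet> \<xi>\<bar> ^ Suc N * norm (fourier f \<xi>) \<le> C" for \<xi>
    using C[of \<xi>] by (simp add: norm_mult mult_ac)
  then show ?case by blast
qed

text \<open>Some coordinate of \<open>\<xi>\<close> has absolute value at least \<open>\<bar>\<xi>\<bar> / n\<close>, so decay in each of the
basis directions implies decay in \<open>\<bar>\<xi>\<bar>\<close>.\<close>

lemma fourier_decay:
  fixes f :: "'a::euclidean_space \<Rightarrow> complex"
  assumes f: "\<And>b. b \<in> Basis \<Longrightarrow> directionally_smooth b N f"
  shows "\<exists>C\<ge>0. \<forall>\<xi>. norm (fourier f \<xi>) \<le> C / (1 + norm \<xi>) ^ N"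
proof -
  obtain b0 :: 'a where b0: "b0 \<in> Basis" using nonempty_Basis by blast
  have dec: "decaying f" using f[OF b0] by (rule directionally_smooth_imp_decaying)
  obtain C0 where C0: "C0 \<ge> 0" "\<And>\<xi>. norm (fourier f \<xi>) \<le> C0"
    using fourier_bounded[OF decaying_integrable[OF dec]] by blast
  have "\<forall>b\<in>Basis. \<exists>C. \<forall>\<xi>. \<bar>b \<bullet> \<xi>\<bar> ^ N * norm (fourier f \<xi>) \<le> C"
    using fourier_directional_decay[OF f norm_Basis] by blast
  then obtain C where C: "\<And>b \<xi>. b \<in> Basis \<Longrightarrow> \<bar>b \<bullet> \<xi>\<bar> ^ N * norm (fourier f \<xi>) \<le> C b"
    by metis
  have C_nn: "0 \<le> C b" if "b \<in> Basis" for b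
  proof -
    have "0 \<le> \<bar>b \<bullet> 0\<bar> ^ N * norm (fourier f 0)" by simp
    also have "\<dots> \<le> C b" by (rule C[OF that])
    finally show ?thesis .
  qed
  define D where "D = 2 ^ N * (C0 + real DIM('a) ^ N * (\<Sum>b\<in>Basis. C b))"
  have "norm (fourier f \<xi>) \<le> D / (1 + norm \<xi>) ^ N" for \<xi>
  proof -
    obtain b where b: "b \<in> Basis" "norm \<xi> \<le> real DIM('a) * \<bar>b \<bullet> \<xi>\<bar>"
    proof (rule ccontr)
      assume "\<not> thesis"
      then have "\<And>b. b \<in> Basis \<Longrightarrow> \<bar>b \<bullet> \<xi>\<bar> < norm \<xi> / real DIM('a)"
        using that by (fastforce simp: field_simps not_le)
      then have "(\<Sum>b\<in>Basis. \<bar>b \<bullet> \<xi>\<bar>) < (\<Sum>b\<in>(Basis::'a set). norm \<xi> / real DIM('a))"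
        by (intro sum_strict_mono) auto
      with norm_le_l1[of \<xi>] show False by (simp add: inner_commute)
    qed
    have "(1 + norm \<xi>) ^ N \<le> (2 * max 1 (norm \<xi>)) ^ N" by (intro power_mono) auto
    also have "\<dots> \<le> 2 ^ N * (1 + norm \<xi> ^ N)"
      by (auto simp: power_mult_distrib max_def)
    finally have "(1 + norm \<xi>) ^ N * norm (fourier f \<xi>) \<le> 2 ^ N * (1 + norm \<xi> ^ N) * norm (fourier f \<xi>)"
      by (intro mult_right_mono) auto
    also have "\<dots> = 2 ^ N * (norm (fourier f \<xi>) + norm \<xi> ^ N * norm (fourier f \<xi>))"
      by (simp add: algebra_simps)
    also have "\<dots> \<le> D"
      unfolding D_def
    proof (intro mult_left_mono add_mono C0)
      have "norm \<xi> ^ N * norm (fourier f \<xi>) \<le> (real DIM('a) * \<bar>b \<bullet> \<xi>\<bar>) ^ N * norm (fourier f \<xi>)"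
        using b by (intro mult_right_mono power_mono) auto
      also have "\<dots> = real DIM('a) ^ N * (\<bar>b \<bullet> \<xi>\<bar> ^ N * norm (fourier f \<xi>))"
        by (simp add: power_mult_distrib)
      also have "\<dots> \<le> real DIM('a) ^ N * (\<Sum>b\<in>Basis. C b)"
        using C[OF b(1), of \<xi>] member_le_sum[OF b(1), of C] C_nn by (intro mult_left_mono) auto
      finally show "norm \<xi> ^ N * norm (fourier f \<xi>) \<le> real DIM('a) ^ N * (\<Sum>b\<in>Basis. C b)" .
    qed auto
    finally show ?thesis by (simp add: pos_le_divide_eq add_pos_nonneg mult.commute)
  qed
  moreover have "D \<ge> 0" unfolding D_def using C0 C_nn by (auto intro!: add_nonneg_nonneg mult_nonneg_nonneg sum_nonneg)
  ultimately show ?thesis by blast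
qed

text \<open>Of the \<open>2 n + 1\<close> powers of decay, \<open>n\<close> absorb the factor \<open>\<bar>\<xi>\<bar>\<^sup>s\<close> and \<open>n + 1\<close> are left.\<close>

lemma decaying_powr_fourier:
  fixes f :: "'a::euclidean_space \<Rightarrow> complex"
  assumes f: "\<And>b. b \<in> Basis \<Longrightarrow> directionally_smooth b (2 * DIM('a) + 1) f"
    and s: "0 \<le> s" "s \<le> real DIM('a)"
  shows "decaying (\<lambda>\<xi>. complex_of_real (norm \<xi> powr s) * fourier f \<xi>)"
proof -
  obtain b0 :: 'a where b0: "b0 \<in> Basis" using nonempty_Basis by blast
  have [measurable]: "f \<in> borel_measurable borel"
    using directionally_smooth_imp_decaying[OF f[OF b0]] by (rule decaying_measurable)
  note [measurable] = borel_measurable_fourier[of f]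
  obtain C where C: "C \<ge> 0" "\<And>\<xi>. norm (fourier f \<xi>) \<le> C / (1 + norm \<xi>) ^ (2 * DIM('a) + 1)"
    using fourier_decay[OF f] by blast
  show ?thesis
  proof (rule decayingI)
    fix \<xi> :: 'a
    have "norm \<xi> powr s \<le> (1 + norm \<xi>) powr s" using s by (intro powr_mono2) auto
    also have "\<dots> \<le> (1 + norm \<xi>) powr real DIM('a)" using s by (intro powr_mono) auto
    also have "\<dots> = (1 + norm \<xi>) ^ DIM('a)" by (intro powr_realpow) (simp add: add_pos_nonneg)
    finally have "norm (complex_of_real (norm \<xi> powr s) * fourier f \<xi>) \<le>
        (1 + norm \<xi>) ^ DIM('a) * (C / (1 + norm \<xi>) ^ (2 * DIM('a) + 1))"
      using C(2)[of \<xi>] unfolding norm_mult by (intro mult_mono) auto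
    also have "2 * DIM('a) + 1 = DIM('a) + (DIM('a) + 1)" by simp
    also have "(1 + norm \<xi>) ^ DIM('a) * (C / (1 + norm \<xi>) ^ (DIM('a) + (DIM('a) + 1))) =
        C / (1 + norm \<xi>) ^ (DIM('a) + 1)"
    proof -
      have "1 + norm \<xi> \<noteq> 0" using norm_ge_zero[of \<xi>] by linarith
      then show ?thesis by (subst power_add) simp
    qed
    finally show "norm (complex_of_real (norm \<xi> powr s) * fourier f \<xi>) \<le> C / (1 + norm \<xi>) ^ (DIM('a) + 1)" .
  qed measurable
qed

lemma schwartz_directionally_smooth:
  fixes \<phi> :: "'a::euclidean_space \<Rightarrow> complex"
  assumes \<phi>: "\<phi> \<in> schwartz" and b: "b \<in> Basis"
  shows "directionally_smooth b N \<phi>"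
proof -
  have "directionally_smooth b N (iter_deriv vs \<phi>)" if "vs \<in> lists Basis" for vs
    using that
  proof (induction N arbitrary: vs)
    case (0 vs)
    let ?f = "iter_deriv vs \<phi>"
    have diff: "?f differentiable (at x)" for x using \<phi> 0 unfolding schwartz_def by blast
    have "bounded (range (\<lambda>x. norm x ^ k * norm (?f x)))" for k
      using \<phi> 0 unfolding schwartz_def by blast
    then have "\<forall>k. \<exists>B. \<forall>x. norm (norm x ^ k * norm (?f x)) \<le> B"
      unfolding bounded_iff by blast
    then obtain B where "\<And>k x. norm (norm x ^ k * norm (?f x)) \<le> B k" by metis
    then have B: "norm x ^ k * norm (?f x) \<le> B k" for k x by (metis abs_ge_self order_trans real_norm_def)
    have "decaying ?f"
    proof (rule decayingI)
      have "continuous_on UNIV ?f"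
        using diff by (simp add: continuous_on_eq_continuous_at differentiable_imp_continuous_within)
      then show "?f \<in> borel_measurable borel" by (rule borel_measurable_continuous_onI)
      fix x :: 'a
      let ?n = "DIM('a) + 1"
      have "(1 + norm x) ^ ?n \<le> (2 * max 1 (norm x)) ^ ?n" by (intro power_mono) auto
      also have "\<dots> \<le> 2 ^ ?n * (1 + norm x ^ ?n)"
        by (auto simp: power_mult_distrib max_def)
      finally have "(1 + norm x) ^ ?n * norm (?f x) \<le> 2 ^ ?n * (1 + norm x ^ ?n) * norm (?f x)"
        by (intro mult_right_mono) auto
      also have "\<dots> = 2 ^ ?n * (norm x ^ 0 * norm (?f x) + norm x ^ ?n * norm (?f x))"
        by (simp add: algebra_simps)
      also have "\<dots> \<le> 2 ^ ?n * (B 0 + B ?n)" by (intro mult_left_mono add_mono B) auto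
      finally show "norm (?f x) \<le> 2 ^ ?n * (B 0 + B ?n) / (1 + norm x) ^ ?n"
        by (subst pos_le_divide_eq) (auto simp: add_pos_nonneg mult.commute)
    qed
    then show ?case by simp
  next
    case (Suc N vs)
    let ?f = "iter_deriv vs \<phi>"
    have diff: "?f differentiable (at x)" for x using \<phi> Suc.prems unfolding schwartz_def by blast
    have "((\<lambda>t. ?f (x + t *\<^sub>R b)) has_vector_derivative iter_deriv (b # vs) \<phi> x) (at 0)" for x
    proof -
      have D: "(?f has_derivative frechet_derivative ?f (at x)) (at (x + 0 *\<^sub>R b))"
        using diff[of x] by (simp add: frechet_derivative_works)
      have "((\<lambda>t. x + t *\<^sub>R b) has_derivative (\<lambda>h. h *\<^sub>R b)) (at 0)"
        by (auto intro!: derivative_eq_intros)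
      from has_derivative_compose[OF this D]
      have "((\<lambda>t. ?f (x + t *\<^sub>R b)) has_derivative (\<lambda>h. frechet_derivative ?f (at x) (h *\<^sub>R b))) (at 0)" .
      also have "(\<lambda>h. frechet_derivative ?f (at x) (h *\<^sub>R b)) = (\<lambda>h. h *\<^sub>R frechet_derivative ?f (at x) b)"
        using linear_frechet_derivative[OF diff[of x]] by (simp add: linear_cmul)
      finally show ?thesis by (simp add: has_vector_derivative_def)
    qed
    moreover have "directionally_smooth b N (iter_deriv (b # vs) \<phi>)"
      using Suc.IH[of "b # vs"] Suc.prems b by simp
    moreover have "decaying ?f" using Suc.IH[OF Suc.prems] by (rule directionally_smooth_imp_decaying)
    ultimately show ?case unfolding directionally_smooth.simps by blast
  qed
  from this[of "[]"] show ?thesis by simp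
qed

section \<open>The heat kernel and Fourier inversion\<close>

definition heat_kernel :: "real \<Rightarrow> 'a::euclidean_space \<Rightarrow> real" where
  "heat_kernel s x = (4 * pi * s) powr (- real DIM('a) / 2) * exp (- (norm x)\<^sup>2 / (4 * s))"

lemma borel_measurable_heat_kernel [measurable]:
  "heat_kernel s \<in> borel_measurable borel"
  unfolding heat_kernel_def by measurable

lemma heat_kernel_nonneg: "0 \<le> heat_kernel s x"
  by (simp add: heat_kernel_def)

lemma heat_kernel_minus: "heat_kernel s (- x) = heat_kernel s x"
  by (simp add: heat_kernel_def)

lemma heat_kernel_bound: "0 < s \<Longrightarrow> heat_kernel s (x::'a::euclidean_space) \<le> (4 * pi * s) powr (- real DIM('a) / 2)"
  by (simp add: heat_kernel_def mult_left_le)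

text \<open>Modulation by \<open>exp (i x \<bullet> \<xi>)\<close> moves the centre of the transform of a Gaussian to \<open>x\<close>.\<close>

lemma fourier_modulated_gaussian:
  fixes x y :: "'a::euclidean_space"
  assumes s: "0 < s"
  shows "complex_of_real ((2 * pi) powr (- real DIM('a) / 2)) *
    fourier (\<lambda>\<xi>. iexp (x \<bullet> \<xi>) * complex_of_real (exp (- s * (norm \<xi>)\<^sup>2))) y = complex_of_real (heat_kernel s (x - y))"
proof -
  have "(LINT \<xi>|lborel. iexp (- (\<xi> \<bullet> y)) * (iexp (x \<bullet> \<xi>) * complex_of_real (exp (- s * (norm \<xi>)\<^sup>2)))) =
      (LINT \<xi>|lborel. iexp ((x - y) \<bullet> \<xi>) * complex_of_real (exp (- s * (norm \<xi>)\<^sup>2)))"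
    by (intro Bochner_Integration.integral_cong refl)
      (simp add: inner_diff_left exp_diff exp_minus divide_inverse inner_commute algebra_simps)
  also have "\<dots> = complex_of_real ((pi / s) powr (real DIM('a) / 2) * exp (- (norm (x - y))\<^sup>2 / (4 * s)))"
    by (rule integral_gaussian[OF s])
  finally have "(LINT \<xi>|lborel. iexp (- (\<xi> \<bullet> y)) * (iexp (x \<bullet> \<xi>) * complex_of_real (exp (- s * (norm \<xi>)\<^sup>2)))) =
    complex_of_real ((pi / s) powr (real DIM('a) / 2) * exp (- (norm (x - y))\<^sup>2 / (4 * s)))" .
  moreover have "(2 * pi) powr (- real DIM('a) / 2) * ((2 * pi) powr (- real DIM('a) / 2) * (pi / s) powr (real DIM('a) / 2)) =
      (4 * pi * s) powr (- real DIM('a) / 2)"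
  proof -
    have "(2 * pi) powr (- real DIM('a) / 2) * ((2 * pi) powr (- real DIM('a) / 2) * (pi / s) powr (real DIM('a) / 2)) =
      (2 * pi) powr (- real DIM('a) / 2) * ((2 * pi) powr (- real DIM('a) / 2) * (s / pi) powr (- real DIM('a) / 2))"
      using s by (simp add: powr_minus powr_divide)
    also have "\<dots> = (4 * pi * s) powr (- real DIM('a) / 2)"
      using s by (simp add: powr_mult[symmetric] field_simps)
    finally show ?thesis .
  qed
  ultimately show ?thesis
    by (subst fourier_lborel) (simp_all add: heat_kernel_def mult.assoc flip: of_real_mult)
qed

text \<open>The heat flow in Fourier variables is convolution with the heat kernel. The
Gaussian supplies the convergence in \<open>\<xi>\<close>, so the multiplication formula applies.\<close>

lemma fourier_inv_gaussian_mult: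
  fixes f :: "'a::euclidean_space \<Rightarrow> complex"
  assumes f: "integrable lborel f" and s: "0 < s"
  shows "fourier_inv (\<lambda>\<xi>. complex_of_real (exp (- s * (norm \<xi>)\<^sup>2)) * fourier f \<xi>) x =
    (LINT y|lborel. f y * complex_of_real (heat_kernel s (x - y)))"
proof -
  have [measurable]: "f \<in> borel_measurable borel" using f by auto
  note [measurable] = borel_measurable_fourier[of f]
  let ?g = "\<lambda>\<xi>. iexp (x \<bullet> \<xi>) * complex_of_real (exp (- s * (norm \<xi>)\<^sup>2))"
  let ?c = "complex_of_real ((2 * pi) powr (- real DIM('a) / 2))"
  have "fourier_inv (\<lambda>\<xi>. complex_of_real (exp (- s * (norm \<xi>)\<^sup>2)) * fourier f \<xi>) x =
      ?c * (LINT \<xi>|lborel. fourier f \<xi> * ?g \<xi>)"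
    unfolding fourier_inv_eq_fourier by (subst fourier_lborel) (auto simp: inner_commute mult_ac)
  also have "\<dots> = (LINT y|lborel. ?c * (f y * fourier ?g y))"
    by (subst fourier_multiplication_formula[OF f integrable_gaussian[OF s]]) simp
  also have "\<dots> = (LINT y|lborel. f y * complex_of_real (heat_kernel s (x - y)))"
    using fourier_modulated_gaussian[OF s, of x] by (simp add: mult.left_commute)
  finally show ?thesis .
qed

lemma heat_kernel_integral:
  assumes s: "0 < s"
  shows "integrable lborel (heat_kernel s :: 'a::euclidean_space \<Rightarrow> real)"
    and "(LINT x|lborel. heat_kernel s (x::'a)) = 1"
proof -
  have s': "0 < 1 / (4 * s)" using s by simp
  have eq: "complex_of_real (heat_kernel s (x::'a)) = complex_of_real ((4 * pi * s) powr (- real DIM('a) / 2)) *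
      (iexp (0 \<bullet> x) * complex_of_real (exp (- (1 / (4 * s)) * (norm x)\<^sup>2)))" for x
    by (simp add: heat_kernel_def)
  have "integrable lborel (\<lambda>x::'a. complex_of_real (heat_kernel s x))"
    unfolding eq by (intro integrable_mult_right integrable_gaussian s')
  from integrable_Re[OF this] show "integrable lborel (heat_kernel s :: 'a \<Rightarrow> real)" by simp
  have "complex_of_real (LINT x|lborel. heat_kernel s (x::'a)) = (LINT x|lborel. complex_of_real (heat_kernel s (x::'a)))"
    by simp
  also have "\<dots> = complex_of_real ((4 * pi * s) powr (- real DIM('a) / 2) * (pi / (1 / (4 * s))) powr (real DIM('a) / 2))"
    unfolding eq integral_mult_right_zero integral_gaussian[OF s'] by simp
  also have "(4 * pi * s) powr (- real DIM('a) / 2) * (pi / (1 / (4 * s))) powr (real DIM('a) / 2) = 1"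
    using s by (simp add: powr_minus field_simps)
  finally show "(LINT x|lborel. heat_kernel s (x::'a)) = 1" by (simp only: of_real_1 of_real_eq_1_iff)
qed

lemma fourier_heat_kernel:
  assumes s: "0 < s"
  shows "fourier (\<lambda>x. complex_of_real (heat_kernel s x)) (\<xi>::'a::euclidean_space) =
    complex_of_real ((2 * pi) powr (- real DIM('a) / 2) * exp (- s * (norm \<xi>)\<^sup>2))"
proof -
  have s': "0 < 1 / (4 * s)" using s by simp
  have "(LINT x|lborel. iexp (- (x \<bullet> \<xi>)) * complex_of_real (heat_kernel s x)) =
      (LINT x|lborel. complex_of_real ((4 * pi * s) powr (- real DIM('a) / 2)) *
        (iexp (- \<xi> \<bullet> x) * complex_of_real (exp (- (1 / (4 * s)) * (norm x)\<^sup>2))))"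
    by (intro Bochner_Integration.integral_cong refl) (simp add: heat_kernel_def inner_commute)
  also have "\<dots> = complex_of_real ((4 * pi * s) powr (- real DIM('a) / 2) *
      ((pi / (1 / (4 * s))) powr (real DIM('a) / 2) * exp (- (norm (- \<xi>))\<^sup>2 / (4 * (1 / (4 * s))))))"
    unfolding integral_mult_right_zero integral_gaussian[OF s'] by simp
  also have "(4 * pi * s) powr (- real DIM('a) / 2) *
      ((pi / (1 / (4 * s))) powr (real DIM('a) / 2) * exp (- (norm (- \<xi>))\<^sup>2 / (4 * (1 / (4 * s))))) = exp (- s * (norm \<xi>)\<^sup>2)"
    using s by (simp add: powr_minus field_simps)
  finally show ?thesis by (subst fourier_lborel) simp_all
qed

lemma heat_kernel_scale:
  assumes r: "0 < r"
  shows "r ^ DIM('a) * heat_kernel (r\<^sup>2) (r *\<^sub>R x) = heat_kernel 1 (x::'a::euclidean_space)"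
proof -
  have "(4 * pi * r\<^sup>2) powr (- real DIM('a) / 2) = (4 * pi) powr (- real DIM('a) / 2) * (r powr 2) powr (- real DIM('a) / 2)"
    using r by (simp add: powr_mult)
  also have "(r powr 2) powr (- real DIM('a) / 2) = r powr (- real DIM('a))" using r by (simp only: powr_powr) simp
  also have "\<dots> = 1 / r ^ DIM('a)" using r by (simp add: powr_minus powr_realpow divide_inverse)
  finally show ?thesis using r by (simp add: heat_kernel_def power_mult_distrib)
qed

text \<open>The time is written as a square because \<open>r\<close> is then the length scale that is removed by
the substitution \<open>y = x + r z\<close>.\<close>

lemma heat_kernel_approximate_identity:
  fixes f :: "'a::euclidean_space \<Rightarrow> complex"
  assumes f: "continuous_on UNIV f" "\<And>x. norm (f x) \<le> B"
    and r: "\<And>k. 0 < r k" "r \<longlonglongrightarrow> 0"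
  shows "(\<lambda>k. LINT y|lborel. f y * complex_of_real (heat_kernel ((r k)\<^sup>2) (x - y))) \<longlonglongrightarrow> f x"
proof -
  have [measurable]: "f \<in> borel_measurable borel" using f(1) by (rule borel_measurable_continuous_onI)
  have eq: "(LINT y|lborel. f y * complex_of_real (heat_kernel ((r k)\<^sup>2) (x - y))) =
      (LINT z|lborel. f (x + r k *\<^sub>R z) * complex_of_real (heat_kernel 1 z))" for k
  proof -
    have "(LINT y|lborel. f y * complex_of_real (heat_kernel ((r k)\<^sup>2) (x - y))) =
      \<bar>r k\<bar> ^ DIM('a) *\<^sub>R (LINT z|lborel. f (x + r k *\<^sub>R z) * complex_of_real (heat_kernel ((r k)\<^sup>2) (x - (x + r k *\<^sub>R z))))"
      using r(1)[of k] by (intro integral_lborel_affine) auto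
    also have "\<dots> = (LINT z|lborel. f (x + r k *\<^sub>R z) * complex_of_real ((r k) ^ DIM('a) * heat_kernel ((r k)\<^sup>2) (r k *\<^sub>R z)))"
      using r(1)[of k] by (simp add: heat_kernel_minus scaleR_conv_of_real mult.left_commute
          flip: integral_mult_right_zero)
    finally show ?thesis by (simp only: heat_kernel_scale[OF r(1)])
  qed
  have "(\<lambda>k. LINT z|lborel. f (x + r k *\<^sub>R z) * complex_of_real (heat_kernel 1 z)) \<longlonglongrightarrow>
      (LINT z|lborel. f x * complex_of_real (heat_kernel 1 (z::'a)))"
  proof (rule integral_dominated_convergence)
    show "integrable lborel (\<lambda>z::'a. B * heat_kernel 1 z)"
      by (intro integrable_mult_right heat_kernel_integral) simp
    show "AE z in lborel. (\<lambda>k. f (x + r k *\<^sub>R z) * complex_of_real (heat_kernel 1 z)) \<longlonglongrightarrow> f x * complex_of_real (heat_kernel 1 z)"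
    proof (intro AE_I2 tendsto_mult tendsto_const)
      fix z
      have "(\<lambda>k. x + r k *\<^sub>R z) \<longlonglongrightarrow> x + 0 *\<^sub>R z" by (intro tendsto_intros r)
      moreover have "isCont f x" using f(1) by (simp add: continuous_on_eq_continuous_at)
      ultimately show "(\<lambda>k. f (x + r k *\<^sub>R z)) \<longlonglongrightarrow> f x" 
        using isCont_tendsto_compose[of x f] by simp
    qed
    show "AE z in lborel. norm (f (x + r k *\<^sub>R z) * complex_of_real (heat_kernel 1 z)) \<le> B * heat_kernel 1 z" for k
      using f(2) by (intro AE_I2) (auto simp: norm_mult heat_kernel_nonneg intro!: mult_right_mono)
  qed measurable
  also have "(LINT z|lborel. f x * complex_of_real (heat_kernel 1 (z::'a))) = f x"
    using heat_kernel_integral(2)[of 1, where 'a='a] by simp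
  finally show ?thesis unfolding eq .
qed

text \<open>Insert a Gaussian factor that tends to \<open>1\<close>: the regularised inverse transform is the heat
flow of \<open>f\<close>, which tends to \<open>f x\<close>.\<close>

lemma fourier_inversion:
  fixes f :: "'a::euclidean_space \<Rightarrow> complex"
  assumes f: "integrable lborel f" "continuous_on UNIV f" "\<And>x. norm (f x) \<le> B"
    and Ff: "integrable lborel (fourier f)"
  shows "fourier_inv (fourier f) x = f x"
proof -
  have [measurable]: "f \<in> borel_measurable borel" using f(2) by (rule borel_measurable_continuous_onI)
  note [measurable] = borel_measurable_fourier[of f]
  define r where "r k = 1 / (real k + 1)" for k
  have r: "0 < r k" for k by (simp add: r_def)
  have r0: "r \<longlonglongrightarrow> 0" unfolding r_def by real_asymp
  let ?F = "\<lambda>k. fourier_inv (\<lambda>\<xi>. complex_of_real (exp (- (r k)\<^sup>2 * (norm \<xi>)\<^sup>2)) * fourier f \<xi>) x"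
  have "?F \<longlonglongrightarrow> fourier_inv (fourier f) x"
  proof -
    have "(\<lambda>k. LINT \<xi>|lborel. iexp (- (\<xi> \<bullet> - x)) * (complex_of_real (exp (- (r k)\<^sup>2 * (norm \<xi>)\<^sup>2)) * fourier f \<xi>))
       \<longlonglongrightarrow> (LINT \<xi>|lborel. iexp (- (\<xi> \<bullet> - x)) * fourier f \<xi>)"
    proof (rule integral_dominated_convergence)
      show "integrable lborel (\<lambda>\<xi>. norm (fourier f \<xi>))" using Ff by simp
      show "AE \<xi> in lborel. (\<lambda>k. iexp (- (\<xi> \<bullet> - x)) * (complex_of_real (exp (- (r k)\<^sup>2 * (norm \<xi>)\<^sup>2)) * fourier f \<xi>))
        \<longlonglongrightarrow> iexp (- (\<xi> \<bullet> - x)) * fourier f \<xi>"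
      proof (rule AE_I2)
        fix \<xi>
        have "(\<lambda>k. iexp (- (\<xi> \<bullet> - x)) * (complex_of_real (exp (- (r k)\<^sup>2 * (norm \<xi>)\<^sup>2)) * fourier f \<xi>))
           \<longlonglongrightarrow> iexp (- (\<xi> \<bullet> - x)) * (complex_of_real (exp (- 0\<^sup>2 * (norm \<xi>)\<^sup>2)) * fourier f \<xi>)"
          by (intro tendsto_intros r0)
        then show "(\<lambda>k. iexp (- (\<xi> \<bullet> - x)) * (complex_of_real (exp (- (r k)\<^sup>2 * (norm \<xi>)\<^sup>2)) * fourier f \<xi>))
          \<longlonglongrightarrow> iexp (- (\<xi> \<bullet> - x)) * fourier f \<xi>" by simp
      qed
      show "AE \<xi> in lborel. norm (iexp (- (\<xi> \<bullet> - x)) * (complex_of_real (exp (- (r k)\<^sup>2 * (norm \<xi>)\<^sup>2)) * fourier f \<xi>))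
        \<le> norm (fourier f \<xi>)" for k
        by (intro AE_I2) (auto simp: norm_mult intro!: mult_left_le_one_le)
    qed measurable
    then show ?thesis
      unfolding fourier_inv_eq_fourier by (subst (1 2) fourier_lborel) (auto intro!: tendsto_intros)
  qed
  moreover have "?F \<longlonglongrightarrow> f x"
    using heat_kernel_approximate_identity[OF f(2,3) r r0]
    by (subst fourier_inv_gaussian_mult[OF f(1) zero_less_power[OF r]])
  ultimately show ?thesis by (rule LIMSEQ_unique)
qed

section \<open>A radial bump and its fractional Laplacian\<close>

lemma has_real_derivative_max_0_power:
  fixes t :: real
  assumes k: "2 \<le> k"
  shows "((\<lambda>t. max 0 t ^ k) has_real_derivative real k * max 0 t ^ (k - 1)) (at t)"
proof -
  consider "t > 0" | "t < 0" | "t = 0" by linarith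
  then show ?thesis
  proof cases
    case 1
    have "((\<lambda>t. t ^ k) has_real_derivative real k * max 0 t ^ (k - 1)) (at t)"
      using 1 by (auto intro!: derivative_eq_intros)
    moreover have ev: "\<forall>\<^sub>F x in nhds t. max 0 x ^ k = x ^ k"
      using eventually_nhds_in_open[of "{0<..}" t] 1 by (auto elim!: eventually_mono)
    ultimately show ?thesis using DERIV_cong_ev[OF refl ev refl] by blast
  next
    case 2
    have "((\<lambda>t. 0) has_real_derivative real k * max 0 t ^ (k - 1)) (at t)"
      using 2 k by (auto simp: max_def zero_power)
    moreover have ev: "\<forall>\<^sub>F x in nhds t. max 0 x ^ k = 0"
      using eventually_nhds_in_open[of "{..<0}" t] 2 k by (auto elim!: eventually_mono simp: max_def zero_power)
    ultimately show ?thesis using DERIV_cong_ev[OF refl ev refl] by blast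
  next
    case 3
    have "((\<lambda>h::real. max 0 h ^ k / h) \<longlongrightarrow> 0) (at 0)"
    proof (rule Lim_null_comparison)
      have "\<forall>\<^sub>F h in at (0::real). h \<in> {-1<..<1}" by (rule eventually_at_in_open') auto
      then show "\<forall>\<^sub>F h in at (0::real). norm (max 0 h ^ k / h) \<le> \<bar>h\<bar>"
      proof eventually_elim
        case (elim h)
        have "max 0 h ^ k \<le> max 0 h ^ 2" using elim k by (intro power_decreasing) auto
        also have "\<dots> \<le> \<bar>h\<bar> * \<bar>h\<bar>" by (auto simp: max_def power2_eq_square)
        finally show ?case by (cases "h = 0") (simp_all add: abs_mult divide_le_eq)
      qed
      show "((\<lambda>h::real. \<bar>h\<bar>) \<longlongrightarrow> 0) (at 0)" by (auto intro!: tendsto_eq_intros)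
    qed
    then show ?thesis using 3 k by (simp add: has_field_derivative_iff zero_power)
  qed
qed

text \<open>A bump of finite smoothness. Its derivatives are explicit polynomials times lower powers
of the same function, which would not be so for a smooth cutoff.\<close>

definition bump :: "nat \<Rightarrow> 'a::euclidean_space \<Rightarrow> real" where
  "bump k x = max 0 (1 - (norm x)\<^sup>2) ^ k"

lemma bump_nonneg: "0 \<le> bump k x" and bump_le_1: "bump k x \<le> 1"
  unfolding bump_def by (auto intro!: power_le_one)

lemma bump_0: "bump k 0 = 1" by (simp add: bump_def)

lemma bump_eq_0: "1 \<le> norm x \<Longrightarrow> 0 < k \<Longrightarrow> bump k x = 0"
proof -
  assume "1 \<le> norm x" "0 < k"
  then have "1 \<le> (norm x)\<^sup>2" by (intro one_le_power)
  then show ?thesis using \<open>0 < k\<close> by (simp add: bump_def max_def zero_power)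
qed

lemma continuous_bump: "continuous_on UNIV (bump k)"
  unfolding bump_def by (intro continuous_intros)

lemma borel_measurable_bump: "bump k \<in> borel_measurable borel"
  by (intro borel_measurable_continuous_onI continuous_bump)

text \<open>The family \<open>(x \<bullet> b)\<^sup>i bump k x\<close> is closed, up to linear combinations, under the
derivative in the direction \<open>b\<close>, at the price of lowering \<open>k\<close> by one.\<close>

lemma directionally_smooth_bump_aux:
  fixes b :: "'a::euclidean_space"
  assumes b: "norm b = 1" and N: "N + 1 \<le> k"
  shows "directionally_smooth b N (\<lambda>x. complex_of_real ((x \<bullet> b) ^ i * bump k x))"
  using N
proof (induction N arbitrary: i k)
  case (0 i k)
  show ?case
    unfolding directionally_smooth.simps
  proof (rule decayingI[where C="2 ^ (DIM('a) + 1)"])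
    note borel_measurable_bump[measurable]
    show "(\<lambda>x. complex_of_real ((x \<bullet> b) ^ i * bump k x)) \<in> borel_measurable borel" by measurable
    fix x :: 'a
    show "norm (complex_of_real ((x \<bullet> b) ^ i * bump k x)) \<le> 2 ^ (DIM('a) + 1) / (1 + norm x) ^ (DIM('a) + 1)"
    proof (cases "norm x < 1")
      case True
      have "\<bar>x \<bullet> b\<bar> \<le> 1" using Cauchy_Schwarz_ineq2[of x b] b True by simp
      then have "\<bar>x \<bullet> b\<bar> ^ i * bump k x \<le> 1"
        using bump_nonneg[of k x] bump_le_1[of k x] by (intro mult_le_one power_le_one) auto
      moreover have "(1 + norm x) ^ (DIM('a) + 1) \<le> 2 ^ (DIM('a) + 1)"
        using True by (intro power_mono) auto
      ultimately show ?thesis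
        using bump_nonneg[of k x]
        by (subst pos_le_divide_eq) (auto simp: add_pos_nonneg norm_mult norm_power abs_mult power_abs intro: mult_le_one
            order_trans[OF mult_left_le_one_le])
    next
      case False
      then show ?thesis using bump_eq_0[of x k] 0 by simp
    qed
  qed
next
  case (Suc N i k)
  let ?B = "\<lambda>i k x. complex_of_real ((x \<bullet> b) ^ i * bump k x)"
  let ?f' = "\<lambda>x. of_nat i * ?B (i - 1) k x + (- 2 * of_nat k) * ?B (i + 1) (k - 1) x"
  have "((\<lambda>t. ?B i k (x + t *\<^sub>R b)) has_vector_derivative ?f' x) (at 0)" for x
  proof -
    have bb: "b \<bullet> b = 1" using b by (simp add: norm_eq_1)
    have 1: "((\<lambda>t. 1 - (norm (x + t *\<^sub>R b))\<^sup>2) has_real_derivative - (2 * (x \<bullet> b))) (at 0)"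
      unfolding power2_norm_eq_inner
      by (auto intro!: derivative_eq_intros simp: inner_add_left inner_add_right inner_commute)
    have "((\<lambda>t. bump k (x + t *\<^sub>R b)) has_real_derivative
       real k * max 0 (1 - (norm (x + 0 *\<^sub>R b))\<^sup>2) ^ (k - 1) * (- (2 * (x \<bullet> b)))) (at 0)"
      unfolding bump_def
      by (rule DERIV_chain2[OF has_real_derivative_max_0_power 1]) (use Suc.prems in auto)
    then have 2: "((\<lambda>t. bump k (x + t *\<^sub>R b)) has_real_derivative - 2 * real k * (x \<bullet> b) * bump (k - 1) x) (at 0)"
      by (simp add: bump_def mult_ac)
    have 3: "((\<lambda>t. ((x + t *\<^sub>R b) \<bullet> b) ^ i) has_real_derivative real i * (x \<bullet> b) ^ (i - 1)) (at 0)"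
      by (auto intro!: derivative_eq_intros simp: inner_add_left bb)
    have "((\<lambda>t. ((x + t *\<^sub>R b) \<bullet> b) ^ i * bump k (x + t *\<^sub>R b)) has_real_derivative
       real i * ((x \<bullet> b) ^ (i - 1) * bump k x) + (- 2 * real k) * ((x \<bullet> b) ^ (i + 1) * bump (k - 1) x)) (at 0)"
      using DERIV_mult[OF 3 2] by (simp add: algebra_simps)
    from has_vector_derivative_of_real[OF this, where 'a=complex] show ?thesis by simp
  qed
  moreover have "directionally_smooth b N ?f'"
    by (intro directionally_smooth_add directionally_smooth_cmult Suc.IH) (use Suc.prems in auto)
  moreover have "decaying (?B i k)"
    using Suc.IH[of k i] Suc.prems directionally_smooth_imp_decaying by auto
  ultimately show ?case
    unfolding directionally_smooth.simps by (intro conjI exI[of _ ?f'] allI)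
qed

lemma directionally_smooth_bump:
  assumes "norm b = 1" "N + 1 \<le> k"
  shows "directionally_smooth b N (\<lambda>x. complex_of_real (bump k x))"
  using directionally_smooth_bump_aux[OF assms, of 0] by simp

text \<open>The exponent gives \<open>2 n + 1\<close> directional derivatives, which is enough for the
multiplier \<open>\<bar>\<xi>\<bar>\<^sup>\<sigma>\<close> with \<open>\<sigma> \<le> n\<close> to leave an integrable function.\<close>

definition profile :: "'a::euclidean_space \<Rightarrow> real" where
  "profile = bump (2 * DIM('a) + 2)"

lemma profile_nonneg: "0 \<le> profile x" and profile_le_1: "profile x \<le> 1"
  using bump_nonneg bump_le_1 by (auto simp: profile_def)

lemma profile_eq_0: "1 \<le> norm x \<Longrightarrow> profile x = 0"
  unfolding profile_def by (rule bump_eq_0) auto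

lemma profile_scaled_eq_0: "0 < t \<Longrightarrow> t \<le> norm y \<Longrightarrow> profile ((1 / t) *\<^sub>R y) = 0"
  by (rule profile_eq_0) simp

lemma borel_measurable_profile [measurable]: "profile \<in> borel_measurable borel"
  unfolding profile_def by (rule borel_measurable_bump)

lemma directionally_smooth_profile:
  "b \<in> Basis \<Longrightarrow> directionally_smooth b (2 * DIM('a) + 1) (\<lambda>x::'a::euclidean_space. complex_of_real (profile x))"
  unfolding profile_def by (rule directionally_smooth_bump) auto

lemma decaying_profile: "decaying (\<lambda>x::'a::euclidean_space. complex_of_real (profile x))"
  using directionally_smooth_imp_decaying directionally_smooth_profile nonempty_Basis by blast

lemma integrable_profile: "integrable lborel (\<lambda>x::'a::euclidean_space. complex_of_real (profile x))"
  by (rule decaying_integrable[OF decaying_profile])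

lemma integrable_fourier_profile:
  "integrable lborel (fourier (\<lambda>x::'a::euclidean_space. complex_of_real (profile x)))"
proof -
  have "decaying (\<lambda>\<xi>::'a. complex_of_real (norm \<xi> powr 0) * fourier (\<lambda>x. complex_of_real (profile x)) \<xi>)"
    by (rule decaying_powr_fourier[OF directionally_smooth_profile]) auto
  from decaying_integrable[OF this]
  have "integrable lborel (\<lambda>\<xi>::'a. complex_of_real (norm \<xi> powr 0) * fourier (\<lambda>x. complex_of_real (profile x)) \<xi>)" .
  \<comment> \<open>\<open>0 powr 0 = 0\<close>, so the factor is \<open>1\<close> only away from the origin\<close>
  then show ?thesis
  proof (rule integrable_cong_AE_imp)
    show "AE \<xi>::'a in lborel. complex_of_real (norm \<xi> powr 0) * fourier (\<lambda>x. complex_of_real (profile x)) \<xi> =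
       fourier (\<lambda>x. complex_of_real (profile x)) \<xi>"
      using AE_lborel_singleton[of "0::'a"] by eventually_elim simp
    show "fourier (\<lambda>x::'a. complex_of_real (profile x)) \<in> borel_measurable lborel"
      using borel_measurable_fourier[of "\<lambda>x::'a. complex_of_real (profile x)"] by simp
  qed
qed

lemma fourier_inv_fourier_profile:
  "fourier_inv (fourier (\<lambda>x::'a::euclidean_space. complex_of_real (profile x))) x = complex_of_real (profile x)"
proof (rule fourier_inversion[where B=1])
  show "continuous_on UNIV (\<lambda>x::'a. complex_of_real (profile x))"
    unfolding profile_def by (intro continuous_intros continuous_bump)
  show "norm (complex_of_real (profile x)) \<le> 1" for x :: 'a
    using profile_nonneg[of x] profile_le_1[of x] by simp
qed (auto intro: integrable_profile integrable_fourier_profile)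

definition profile_multiplier :: "real \<Rightarrow> 'a::euclidean_space \<Rightarrow> complex" where
  "profile_multiplier \<sigma> \<xi> = complex_of_real (norm \<xi> powr \<sigma>) * fourier (\<lambda>x. complex_of_real (profile x)) \<xi>"

text \<open>The real part loses nothing: \<open>profile_laplacian_eq\<close> shows that the transform is real.\<close>

definition profile_laplacian :: "real \<Rightarrow> 'a::euclidean_space \<Rightarrow> real" where
  "profile_laplacian \<sigma> x = Re (fourier_inv (profile_multiplier \<sigma>) x)"

context
  fixes \<sigma> :: real
  assumes \<sigma>0: "0 < \<sigma>"
begin

lemma decaying_profile_multiplier:
  assumes "\<sigma> \<le> real DIM('a)"
  shows "decaying (profile_multiplier \<sigma> :: 'a::euclidean_space \<Rightarrow> complex)"
  unfolding profile_multiplier_def[abs_def]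
  by (rule decaying_powr_fourier[OF directionally_smooth_profile]) (use assms \<sigma>0 in auto)

lemma borel_measurable_profile_multiplier [measurable]:
  "(profile_multiplier \<sigma> :: 'a::euclidean_space \<Rightarrow> complex) \<in> borel_measurable borel"
proof -
  note [measurable] = borel_measurable_fourier[of "\<lambda>x::'a. complex_of_real (profile x)"]
  show ?thesis unfolding profile_multiplier_def[abs_def] by measurable
qed

lemma fourier_profile_radial:
  "norm \<xi> = norm \<eta> \<Longrightarrow> fourier (\<lambda>x::'a::euclidean_space. complex_of_real (profile x)) \<xi> =
    fourier (\<lambda>x. complex_of_real (profile x)) (\<eta>::'a)"
  by (rule fourier_radial) (auto simp: profile_def bump_def)

lemma profile_multiplier_radial:
  "norm \<xi> = norm \<eta> \<Longrightarrow> profile_multiplier \<sigma> \<xi> = profile_multiplier \<sigma> (\<eta>::'a)"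
  for \<xi> :: "'a::euclidean_space"
  unfolding profile_multiplier_def using fourier_profile_radial[of \<xi> \<eta>] by simp

text \<open>For radial functions the transform and its inverse agree, and the transform of a real
radial function is real.\<close>

lemma profile_laplacian_eq:
  "complex_of_real (profile_laplacian \<sigma> x) = fourier (profile_multiplier \<sigma>) (x::'a::euclidean_space)"
proof -
  have "fourier (profile_multiplier \<sigma>) x \<in> \<real>"
  proof (rule fourier_radial_real)
    show "profile_multiplier \<sigma> x = profile_multiplier \<sigma> y" if "norm x = norm y" for x y :: 'a
      using that by (rule profile_multiplier_radial)
    have "fourier (\<lambda>x::'a. complex_of_real (profile x)) \<xi> \<in> \<real>" for \<xi>
      by (rule fourier_radial_real) (auto simp: profile_def bump_def)
    then show "profile_multiplier \<sigma> \<xi> \<in> \<real>" for \<xi> :: 'a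
      unfolding profile_multiplier_def by (intro Reals_mult) auto
  qed measurable
  moreover have "fourier (profile_multiplier \<sigma>) (- x) = fourier (profile_multiplier \<sigma>) x"
    by (rule fourier_radial[OF borel_measurable_profile_multiplier profile_multiplier_radial]) auto
  ultimately show ?thesis unfolding profile_laplacian_def fourier_inv_eq_fourier by simp
qed

lemma borel_measurable_profile_laplacian [measurable]:
  "(profile_laplacian \<sigma> :: 'a::euclidean_space \<Rightarrow> real) \<in> borel_measurable borel"
proof -
  have "(\<lambda>x::'a. Re (fourier (profile_multiplier \<sigma>) x)) \<in> borel_measurable borel"
    using borel_measurable_fourier[of "profile_multiplier \<sigma> :: 'a \<Rightarrow> complex"] by simp
  then show ?thesis by (simp flip: profile_laplacian_eq)
qed

lemma profile_laplacian_radial: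
  fixes x y :: "'a::euclidean_space"
  assumes "norm x = norm y"
  shows "profile_laplacian \<sigma> x = profile_laplacian \<sigma> y"
proof -
  have "fourier (profile_multiplier \<sigma>) x = fourier (profile_multiplier \<sigma>) y"
    by (rule fourier_radial[OF borel_measurable_profile_multiplier]) (erule profile_multiplier_radial, rule assms)
  then show ?thesis unfolding profile_laplacian_eq[symmetric] by simp
qed

lemma profile_laplacian_bounded:
  assumes "\<sigma> \<le> real DIM('a)"
  shows "\<exists>C\<ge>0. \<forall>x::'a::euclidean_space. \<bar>profile_laplacian \<sigma> x\<bar> \<le> C"
  using fourier_bounded[OF decaying_integrable[OF decaying_profile_multiplier[OF assms]]]
  by (simp flip: profile_laplacian_eq)

end

section \<open>Decay of the fractional Laplacian of the bump\<close>

context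
  fixes \<sigma> :: real
  assumes \<sigma>0: "0 < \<sigma>"
begin

text \<open>The density that represents \<open>\<bar>\<xi>\<bar>\<^sup>\<sigma>\<close> as an average of heat multipliers.\<close>

definition heat_weight :: "real \<Rightarrow> real" where
  "heat_weight t = indicator {0<..} t * t powr (- \<sigma> / 2 - 1)"

lemma borel_measurable_heat_weight [measurable]: "heat_weight \<in> borel_measurable borel"
  unfolding heat_weight_def[abs_def] by measurable

lemma heat_weight_nonneg: "0 \<le> heat_weight t"
  by (simp add: heat_weight_def indicator_def)

text \<open>Scaling in \<open>t\<close> shows that the integral is a multiple of \<open>l powr (\<sigma> / 2)\<close>; with
\<open>l = \<bar>\<xi>\<bar>\<^sup>2\<close> this is the symbol of the fractional Laplacian. The \<open>M\<close>-th power is needed for convergence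
at \<open>t = 0\<close>, where the integrand is of order \<open>t\<^sup>M\<close> times the weight. Convergence at both ends is
reduced to Gamma integrals.\<close>

lemma subordination:
  assumes M: "\<sigma> / 2 < real M"
  shows "\<exists>A>0. \<forall>l>0. (\<integral>\<^sup>+t. ennreal (heat_weight t * (1 - exp (- t * l)) ^ M) \<partial>lborel) = ennreal (A * l powr (\<sigma> / 2))"
proof -
  define I where "I = (\<integral>\<^sup>+t. ennreal (heat_weight t * (1 - exp (- t)) ^ M) \<partial>lborel)"
  have nn: "0 \<le> heat_weight t * (1 - exp (- t)) ^ M" for t
    by (auto simp: heat_weight_def indicator_def)
  \<comment> \<open>the factors \<open>exp 1 * exp (- t)\<close> and \<open>exp 1 * exp (- 1 / t)\<close> are at least \<open>1\<close> for \<open>t \<le> 1\<close> and \<open>t \<ge> 1\<close> respectively\<close>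
  have "I \<le> (\<integral>\<^sup>+t. ennreal (exp 1) * ennreal (indicator {0<..} t * (t powr ((real M - \<sigma> / 2) - 1) * exp (- 1 * t))) +
      ennreal (exp 1) * ennreal (indicator {0<..} t * (t powr (- (\<sigma> / 2) - 1) * exp (- 1 / t))) \<partial>lborel)"
    unfolding I_def
  proof (rule nn_integral_mono)
    fix t :: real
    show "ennreal (heat_weight t * (1 - exp (- t)) ^ M) \<le>
      ennreal (exp 1) * ennreal (indicator {0<..} t * (t powr ((real M - \<sigma> / 2) - 1) * exp (- 1 * t))) +
      ennreal (exp 1) * ennreal (indicator {0<..} t * (t powr (- (\<sigma> / 2) - 1) * exp (- 1 / t)))"
    proof (cases "0 < t")
      case True
      show ?thesis
      proof (cases "t \<le> 1")
        case le: True
        have "(1 - exp (- t)) ^ M \<le> t ^ M"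
          using True exp_ge_add_one_self[of "- t"] by (intro power_mono) auto
        then have "t powr (- \<sigma> / 2 - 1) * (1 - exp (- t)) ^ M \<le> t powr (- \<sigma> / 2 - 1) * t ^ M"
          by (intro mult_left_mono) auto
        also have "\<dots> = t powr ((real M - \<sigma> / 2) - 1)"
          using True by (simp add: powr_add[symmetric] algebra_simps flip: powr_realpow)
        also have "\<dots> * 1 \<le> t powr ((real M - \<sigma> / 2) - 1) * (exp 1 * exp (- t))"
          using le by (intro mult_left_mono) (auto simp: exp_add[symmetric])
        finally have "heat_weight t * (1 - exp (- t)) ^ M \<le> exp 1 * (t powr ((real M - \<sigma> / 2) - 1) * exp (- t))"
          using True by (simp add: heat_weight_def mult_ac)
        then have "ennreal (heat_weight t * (1 - exp (- t)) ^ M) \<le>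
          ennreal (exp 1) * ennreal (indicator {0<..} t * (t powr ((real M - \<sigma> / 2) - 1) * exp (- 1 * t)))"
          using True by (simp add: ennreal_mult[symmetric])
        then show ?thesis by (rule order_trans) simp
      next
        case ge: False
        have "t powr (- \<sigma> / 2 - 1) * (1 - exp (- t)) ^ M \<le> t powr (- \<sigma> / 2 - 1) * 1"
          using True by (intro mult_left_mono power_le_one) auto
        also have "\<dots> \<le> t powr (- \<sigma> / 2 - 1) * (exp 1 * exp (- 1 / t))"
          using ge by (intro mult_left_mono) (auto simp: exp_add[symmetric])
        finally have "heat_weight t * (1 - exp (- t)) ^ M \<le> exp 1 * (t powr (- (\<sigma> / 2) - 1) * exp (- 1 / t))"
          using True by (simp add: heat_weight_def mult_ac)
        then have "ennreal (heat_weight t * (1 - exp (- t)) ^ M) \<le>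
          ennreal (exp 1) * ennreal (indicator {0<..} t * (t powr (- (\<sigma> / 2) - 1) * exp (- 1 / t)))"
          using True by (simp add: ennreal_mult[symmetric])
        then show ?thesis by (rule order_trans) simp
      qed
    qed (simp add: heat_weight_def)
  qed
  also have "\<dots> = ennreal (exp 1) * ennreal (Gamma (real M - \<sigma> / 2) * 1 powr (- (real M - \<sigma> / 2))) +
      ennreal (exp 1) * ennreal (Gamma (\<sigma> / 2) * 1 powr (- (\<sigma> / 2)))"
    using M \<sigma>0 nn_integral_Gamma_scaled[of "real M - \<sigma> / 2" 1] nn_integral_Gamma_inverse[of "\<sigma> / 2" 1]
    by (subst nn_integral_add) (simp_all add: nn_integral_cmult)
  also have "\<dots> < \<infinity>" by (simp add: ennreal_mult_less_top)
  finally have fin: "I < \<infinity>" .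
  have "I \<noteq> 0"
  proof
    assume "I = 0"
    then have "AE t in lborel. ennreal (heat_weight t * (1 - exp (- t)) ^ M) = 0"
      unfolding I_def by (subst (asm) nn_integral_0_iff_AE) auto
    then have "AE t in lborel. t \<notin> {0::real<..}"
    proof eventually_elim
      case (elim t)
      show ?case
      proof
        assume "t \<in> {0<..}"
        then have "0 < heat_weight t * (1 - exp (- t)) ^ M" by (simp add: heat_weight_def)
        with elim show False by (simp add: ennreal_eq_0_iff)
      qed
    qed
    then have "emeasure lborel {0::real<..} = 0"
      by (subst (asm) AE_iff_measurable[OF _ refl]) (auto simp: greaterThan_def)
    moreover have "emeasure lborel {0::real<..<1} \<le> emeasure lborel {0::real<..}"
      by (intro emeasure_mono) auto
    ultimately show False by simp
  qed
  with fin obtain A where A: "I = ennreal A" "0 < A"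
    by (cases I) (auto simp: less_le)
  have "(\<integral>\<^sup>+t. ennreal (heat_weight t * (1 - exp (- t * l)) ^ M) \<partial>lborel) = ennreal (A * l powr (\<sigma> / 2))"
    if l: "0 < l" for l
  proof -
    have "(\<integral>\<^sup>+t. ennreal (heat_weight t * (1 - exp (- t * l)) ^ M) \<partial>lborel) =
        ennreal \<bar>1 / l\<bar> * (\<integral>\<^sup>+t. ennreal (heat_weight (0 + (1 / l) * t) * (1 - exp (- (0 + (1 / l) * t) * l)) ^ M) \<partial>lborel)"
      by (rule nn_integral_real_affine) (use l in auto)
    also have "(\<lambda>t. heat_weight (0 + (1 / l) * t) * (1 - exp (- (0 + (1 / l) * t) * l)) ^ M) =
        (\<lambda>t. l powr (\<sigma> / 2 + 1) * (heat_weight t * (1 - exp (- t)) ^ M))"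
    proof
      fix t
      have "heat_weight (0 + (1 / l) * t) = l powr (\<sigma> / 2 + 1) * heat_weight t"
      proof (cases "0 < t")
        case True
        have "(t / l) powr (- \<sigma> / 2 - 1) = l powr (\<sigma> / 2 + 1) * t powr (- \<sigma> / 2 - 1)"
        proof -
          have "l powr (\<sigma> / 2 + 1) = l powr (- (- \<sigma> / 2 - 1))" by (simp add: add.commute)
          also have "\<dots> = inverse (l powr (- \<sigma> / 2 - 1))" by (rule powr_minus)
          finally have "l powr (\<sigma> / 2 + 1) = inverse (l powr (- \<sigma> / 2 - 1))" .
          moreover have "(t / l) powr (- \<sigma> / 2 - 1) = t powr (- \<sigma> / 2 - 1) / l powr (- \<sigma> / 2 - 1)"
            by (rule powr_divide)
          ultimately show ?thesis by (simp only: divide_inverse[of "_ powr _"] mult.commute)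
        qed
        then show ?thesis using True l by (simp add: heat_weight_def)
      qed (use l in \<open>simp add: heat_weight_def indicator_def zero_less_divide_iff\<close>)
      then show "heat_weight (0 + (1 / l) * t) * (1 - exp (- (0 + (1 / l) * t) * l)) ^ M =
        l powr (\<sigma> / 2 + 1) * (heat_weight t * (1 - exp (- t)) ^ M)" using l by simp
    qed
    also have "(\<integral>\<^sup>+t. ennreal (l powr (\<sigma> / 2 + 1) * (heat_weight t * (1 - exp (- t)) ^ M)) \<partial>lborel) =
        ennreal (l powr (\<sigma> / 2 + 1)) * ennreal A"
      using nn by (simp add: ennreal_mult nn_integral_cmult A(1)[symmetric] I_def)
    also have "ennreal \<bar>1 / l\<bar> * (ennreal (l powr (\<sigma> / 2 + 1)) * ennreal A) = ennreal (\<bar>1 / l\<bar> * (l powr (\<sigma> / 2 + 1) * A))"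
      using A(2) by (simp only: ennreal_mult mult_nonneg_nonneg abs_ge_zero powr_ge_zero less_imp_le)
    also have "\<bar>1 / l\<bar> * (l powr (\<sigma> / 2 + 1) * A) = A * l powr (\<sigma> / 2)"
      using l by (simp add: powr_add)
    finally show ?thesis .
  qed
  with A show ?thesis by blast
qed

text \<open>Expanding the power by the binomial theorem gives heat flows of the bump at the times
\<open>k t\<close>, \<open>k \<le> M\<close>. The term \<open>k = 0\<close> is the bump itself by Fourier inversion, which vanishes at \<open>x\<close>. For
\<open>k \<ge> 1\<close> every point of the support has distance at least \<open>\<bar>x\<bar> / 2\<close> from \<open>x\<close>, so the heat kernel is as
small as the Gaussian on the right.\<close>

lemma fourier_inv_profile_heat_difference:
  fixes x :: "'a::euclidean_space"
  assumes x: "2 \<le> norm x" and t: "0 < t"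
  shows "norm (fourier_inv (\<lambda>\<xi>. complex_of_real ((1 - exp (- t * (norm \<xi>)\<^sup>2)) ^ M) * fourier (\<lambda>x. complex_of_real (profile x)) \<xi>) x) \<le>
     2 ^ M * (unit_ball_vol (real DIM('a)) * ((4 * pi * t) powr (- real DIM('a) / 2) * exp (- (norm x)\<^sup>2 / (16 * (real M + 1) * t))))"
  (is "norm (fourier_inv (?D M) x) \<le> 2 ^ M * ?B")
proof -
  let ?F = "fourier (\<lambda>x::'a. complex_of_real (profile x))"
  note [measurable] = borel_measurable_fourier[of "\<lambda>x::'a. complex_of_real (profile x)"]
  have intE: "integrable lborel (\<lambda>\<xi>. iexp (- (\<xi> \<bullet> - x)) * (complex_of_real (exp (- (real k * t) * (norm \<xi>)\<^sup>2)) * ?F \<xi>))" for k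
    by (rule Bochner_Integration.integrable_bound[OF integrable_fourier_profile])
      (use t in \<open>auto simp: norm_mult intro!: mult_left_le_one_le\<close>)
  have expand: "(1 - exp (- t * (norm \<xi>)\<^sup>2)) ^ M = (\<Sum>k\<le>M. (-1) ^ k * real (M choose k) * exp (- (real k * t) * (norm \<xi>)\<^sup>2))" for \<xi> :: 'a
  proof -
    have "(1 - exp (- t * (norm \<xi>)\<^sup>2)) ^ M = (- exp (- t * (norm \<xi>)\<^sup>2) + 1) ^ M" by simp
    also have "\<dots> = (\<Sum>k\<le>M. real (M choose k) * (- exp (- t * (norm \<xi>)\<^sup>2)) ^ k * 1 ^ (M - k))"
      by (rule binomial_ring)
    also have "\<dots> = (\<Sum>k\<le>M. (-1) ^ k * real (M choose k) * exp (- (real k * t) * (norm \<xi>)\<^sup>2))"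
      by (intro sum.cong refl) (simp add: power_minus[of "exp _"] exp_of_nat_mult[symmetric] mult_ac)
    finally show ?thesis .
  qed
  have eq: "fourier_inv (?D M) x = (\<Sum>k\<le>M. complex_of_real ((-1) ^ k * real (M choose k)) *
      fourier_inv (\<lambda>\<xi>. complex_of_real (exp (- (real k * t) * (norm \<xi>)\<^sup>2)) * ?F \<xi>) x)"
  proof -
    have "(LINT \<xi>|lborel. iexp (- (\<xi> \<bullet> - x)) * ?D M \<xi>) = (LINT \<xi>|lborel. (\<Sum>k\<le>M. complex_of_real ((-1) ^ k * real (M choose k)) *
        (iexp (- (\<xi> \<bullet> - x)) * (complex_of_real (exp (- (real k * t) * (norm \<xi>)\<^sup>2)) * ?F \<xi>))))"
      unfolding expand of_real_sum by (simp only: sum_distrib_left sum_distrib_right of_real_mult mult_ac)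
    also have "\<dots> = (\<Sum>k\<le>M. complex_of_real ((-1) ^ k * real (M choose k)) *
        (LINT \<xi>|lborel. iexp (- (\<xi> \<bullet> - x)) * (complex_of_real (exp (- (real k * t) * (norm \<xi>)\<^sup>2)) * ?F \<xi>)))"
      by (subst Bochner_Integration.integral_sum) (intro integrable_mult_right intE, simp only: integral_mult_right_zero)
    finally show ?thesis
      unfolding fourier_inv_eq_fourier
      by (subst (1 2) fourier_lborel) (simp_all only: sum_distrib_left mult.left_commute, measurable)
  qed
  have "norm (fourier_inv (?D M) x) \<le> (\<Sum>k\<le>M. real (M choose k) * ?B)"
    unfolding eq
  proof (rule sum_norm_le)
    fix k assume k: "k \<in> {..M}"
    have "norm (fourier_inv (\<lambda>\<xi>. complex_of_real (exp (- (real k * t) * (norm \<xi>)\<^sup>2)) * ?F \<xi>) x) \<le> ?B"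
    proof (cases "k = 0")
      case True
      have "profile x = 0" unfolding profile_def using x by (intro bump_eq_0) auto
      then have "fourier_inv (\<lambda>\<xi>. complex_of_real (exp (- (real k * t) * (norm \<xi>)\<^sup>2)) * ?F \<xi>) x = 0"
        using True fourier_inv_fourier_profile[of x] by simp
      then show ?thesis by simp
    next
      case False
      then have kt: "0 < real k * t" using t by simp
      have pointwise: "norm (complex_of_real (profile y) * complex_of_real (heat_kernel (real k * t) (x - y))) \<le>
          indicator (ball 0 1) y * ((4 * pi * t) powr (- real DIM('a) / 2) * exp (- (norm x)\<^sup>2 / (16 * (real M + 1) * t)))" for y
      proof (cases "norm y < 1")
        case True
        have "norm x / 2 \<le> norm (x - y)"
          using norm_triangle_ineq2[of x y] True x by linarith
        then have "(norm x / 2)\<^sup>2 \<le> (norm (x - y))\<^sup>2" by (intro power_mono) auto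
        then have "(norm x)\<^sup>2 / (16 * (real k * t)) \<le> (norm (x - y))\<^sup>2 / (4 * (real k * t))"
          using kt by (simp add: field_simps power_divide)
        moreover have "(norm x)\<^sup>2 / (16 * (real M + 1) * t) \<le> (norm x)\<^sup>2 / (16 * (real k * t))"
          using kt t k \<open>k \<noteq> 0\<close> by (intro divide_left_mono mult_pos_pos) (auto intro: mult_right_mono)
        ultimately have "exp (- (norm (x - y))\<^sup>2 / (4 * (real k * t))) \<le> exp (- (norm x)\<^sup>2 / (16 * (real M + 1) * t))"
          by simp
        moreover have "(4 * pi * (real k * t)) powr (- real DIM('a) / 2) \<le> (4 * pi * t) powr (- real DIM('a) / 2)"
          using t False by (intro powr_mono2') (auto simp: mult_le_cancel_right1)
        ultimately have "heat_kernel (real k * t) (x - y) \<le>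
            (4 * pi * t) powr (- real DIM('a) / 2) * exp (- (norm x)\<^sup>2 / (16 * (real M + 1) * t))"
          unfolding heat_kernel_def by (intro mult_mono) auto
        then have "profile y * heat_kernel (real k * t) (x - y) \<le>
            1 * ((4 * pi * t) powr (- real DIM('a) / 2) * exp (- (norm x)\<^sup>2 / (16 * (real M + 1) * t)))"
          using bump_le_1 bump_nonneg by (intro mult_mono) (auto simp: profile_def heat_kernel_nonneg)
        then show ?thesis using True profile_nonneg[of y]
          by (simp add: norm_mult heat_kernel_nonneg abs_mult indicator_def)
      next
        case False
        then have "profile y = 0" unfolding profile_def by (intro bump_eq_0) auto
        then show ?thesis by (simp add: indicator_def)
      qed
      have "norm (LINT y|lborel. complex_of_real (profile y) * complex_of_real (heat_kernel (real k * t) (x - y))) \<le>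
         (LINT y|lborel. indicator (ball (0::'a) 1) y * ((4 * pi * t) powr (- real DIM('a) / 2) * exp (- (norm x)\<^sup>2 / (16 * (real M + 1) * t))))"
        (is "norm (integral\<^sup>L lborel ?f) \<le> integral\<^sup>L lborel ?g")
      proof (rule Bochner_Integration.integral_norm_bound_integral)
        show i: "integrable lborel ?g"
          by (intro integrable_mult_left integrable_real_indicator) (use emeasure_lborel_ball_finite[of "0::'a" 1] in auto)
        show "integrable lborel ?f"
        proof (rule Bochner_Integration.integrable_bound[OF integrable_norm[OF integrable_mult_right[OF integrable_profile, of "complex_of_real ((4 * pi * (real k * t)) powr (- real DIM('a) / 2))"]]])
          show "AE y in lborel. norm (?f y) \<le> norm (norm (complex_of_real ((4 * pi * (real k * t)) powr (- real DIM('a) / 2)) * complex_of_real (profile y)))"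
            using mult_left_mono[OF heat_kernel_bound[OF kt] abs_ge_zero]
            by (intro AE_I2) (simp add: norm_mult heat_kernel_nonneg mult_ac)
        qed measurable
      qed (rule pointwise)
      also have "\<dots> = ?B"
        by (simp add: content_ball) 
      finally show ?thesis by (subst fourier_inv_gaussian_mult[OF integrable_profile kt])
    qed
    then show "norm (complex_of_real ((-1) ^ k * real (M choose k)) *
      fourier_inv (\<lambda>\<xi>. complex_of_real (exp (- (real k * t) * (norm \<xi>)\<^sup>2)) * ?F \<xi>) x) \<le> real (M choose k) * ?B"
      by (simp only: norm_mult norm_of_real abs_mult power_abs abs_minus abs_one power_one mult_1 abs_of_nat) (rule mult_left_mono, auto)
  qed
  also have "\<dots> = 2 ^ M * ?B"
    using choose_row_sum[of M] by (simp only: sum_distrib_right[symmetric] of_nat_sum[symmetric] atMost_atLeast0) simp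
  finally show ?thesis .
qed

end

context
  fixes \<sigma> :: real
  assumes \<sigma>0: "0 < \<sigma>"
begin

text \<open>Averaging the preceding estimate in \<open>t\<close> against the subordination weight, a Gamma
integral in \<open>1 / t\<close> produces exactly the power \<open>- \<sigma> - n\<close> of \<open>\<bar>x\<bar>\<close>.\<close>

lemma profile_laplacian_decay:
  assumes \<sigma>: "\<sigma> \<le> real DIM('a)"
  shows "\<exists>C\<ge>0. \<forall>x::'a::euclidean_space. 2 \<le> norm x \<longrightarrow> \<bar>profile_laplacian \<sigma> x\<bar> \<le> C * norm x powr (- \<sigma> - real DIM('a))"
proof -
  \<comment> \<open>any power above \<open>\<sigma> / 2\<close> would do\<close>
  define M where "M = DIM('a)"
  have M: "\<sigma> / 2 < real M" "M \<noteq> 0" using \<sigma> \<sigma>0 by (auto simp: M_def)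
  obtain A where A: "0 < A"
    "\<And>l. 0 < l \<Longrightarrow> (\<integral>\<^sup>+t. ennreal (heat_weight \<sigma> t * (1 - exp (- t * l)) ^ M) \<partial>lborel) = ennreal (A * l powr (\<sigma> / 2))"
    using subordination[OF \<sigma>0 M(1)] by blast
  note [measurable] = borel_measurable_heat_weight[OF \<sigma>0] borel_measurable_profile_multiplier[OF \<sigma>0]
  define d where "d t \<xi> = heat_weight \<sigma> t * (1 - exp (- t * (norm \<xi>)\<^sup>2)) ^ M" for t and \<xi> :: 'a
  have d_nn: "0 \<le> d t \<xi>" for t \<xi>
    by (auto simp: d_def heat_weight_def[OF \<sigma>0] indicator_def intro!: mult_nonneg_nonneg zero_le_power)
  have "(\<integral>\<^sup>+t. ennreal (d t \<xi>) \<partial>lborel) = ennreal (A * norm \<xi> powr \<sigma>)" for \<xi>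
  proof (cases "\<xi> = 0")
    case False
    then show ?thesis using A(2)[of "(norm \<xi>)\<^sup>2"] by (simp add: d_def powr_half_square)
  qed (use M in \<open>simp add: d_def zero_power\<close>)
  then have d_int: "integrable lborel (\<lambda>t. d t \<xi>)" "(LINT t|lborel. d t \<xi>) = A * norm \<xi> powr \<sigma>" for \<xi>
    using A(1) d_nn integrable_of_nn_integral[of "\<lambda>t. d t \<xi>" lborel "A * norm \<xi> powr \<sigma>"]
      integral_of_nn_integral[of "\<lambda>t. d t \<xi>" lborel "A * norm \<xi> powr \<sigma>"]
    by (simp_all add: d_def)
  let ?F = "fourier (\<lambda>x::'a. complex_of_real (profile x))"
  note [measurable] = borel_measurable_fourier[of "\<lambda>x::'a. complex_of_real (profile x)"]
  define a where "a = (\<sigma> + real DIM('a)) / 2"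
  have a: "0 < a" using \<sigma>0 by (simp add: a_def)
  define V where "V = unit_ball_vol (real DIM('a))"
  have V: "0 \<le> V" by (simp add: V_def)
  define C where "C = 2 ^ M * V * (4 * pi) powr (- real DIM('a) / 2) * (Gamma a * (16 * (real M + 1)) powr a) / A"
  have "\<bar>profile_laplacian \<sigma> x\<bar> \<le> C * norm x powr (- \<sigma> - real DIM('a))" if x: "2 \<le> norm x" for x :: 'a
  proof -
    define k where "k \<xi> = iexp (- (\<xi> \<bullet> - x)) * ?F \<xi>" for \<xi>
    have [measurable]: "k \<in> borel_measurable borel" unfolding k_def by measurable
    have mk: "complex_of_real (norm \<xi> powr \<sigma>) * k \<xi> = iexp (- (\<xi> \<bullet> - x)) * profile_multiplier \<sigma> \<xi>" for \<xi>
      by (simp add: k_def profile_multiplier_def)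
    have "integrable lborel (\<lambda>\<xi>. iexp (- (\<xi> \<bullet> - x)) * profile_multiplier \<sigma> \<xi>)"
      by (intro integrable_iexp_mult decaying_integrable decaying_profile_multiplier \<sigma>0 \<sigma>)
    then have mk_int: "integrable lborel (\<lambda>\<xi>. complex_of_real (norm \<xi> powr \<sigma>) * k \<xi>)" unfolding mk .
    \<comment> \<open>integrating \<open>d\<close> in \<open>t\<close> first gives back the integrable multiplier\<close>
    have "integrable (lborel \<Otimes>\<^sub>M lborel) (\<lambda>(\<xi>, t). complex_of_real (d t \<xi>) * k \<xi>)"
    proof (rule lborel_pair.Fubini_integrable)
      show "(\<lambda>(\<xi>, t). complex_of_real (d t \<xi>) * k \<xi>) \<in> borel_measurable (lborel \<Otimes>\<^sub>M lborel)"
        unfolding d_def by measurable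
      have "(\<lambda>\<xi>. LINT t|lborel. norm (case (\<xi>, t) of (\<xi>, t) \<Rightarrow> complex_of_real (d t \<xi>) * k \<xi>)) =
         (\<lambda>\<xi>. A * norm (complex_of_real (norm \<xi> powr \<sigma>) * k \<xi>))"
        using d_nn d_int(2) by (simp add: norm_mult mult.assoc)
      then show "integrable lborel (\<lambda>\<xi>. LINT t|lborel. norm (case (\<xi>, t) of (\<xi>, t) \<Rightarrow> complex_of_real (d t \<xi>) * k \<xi>))"
        using mk_int by simp
      show "AE \<xi> in lborel. integrable lborel (\<lambda>t. case (\<xi>, t) of (\<xi>, t) \<Rightarrow> complex_of_real (d t \<xi>) * k \<xi>)"
        using d_int(1) by (intro AE_I2) (simp add: integrable_mult_left)
    qed
    then have fub: "(LINT t|lborel. LINT \<xi>|lborel. complex_of_real (d t \<xi>) * k \<xi>) =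
        (LINT \<xi>|lborel. LINT t|lborel. complex_of_real (d t \<xi>) * k \<xi>)"
      by (rule lborel_pair.Fubini_integral)
    let ?c = "complex_of_real ((2 * pi) powr (- real DIM('a) / 2))"
    have lhs: "?c * (LINT \<xi>|lborel. LINT t|lborel. complex_of_real (d t \<xi>) * k \<xi>) = complex_of_real (A * profile_laplacian \<sigma> x)"
    proof -
      have "(LINT t|lborel. complex_of_real (d t \<xi>) * k \<xi>) = complex_of_real A * (iexp (- (\<xi> \<bullet> - x)) * profile_multiplier \<sigma> \<xi>)" for \<xi>
      proof -
        have "(LINT t|lborel. complex_of_real (d t \<xi>) * k \<xi>) = complex_of_real (LINT t|lborel. d t \<xi>) * k \<xi>"
          by (simp only: integral_mult_left_zero integral_complex_of_real)
        also have "\<dots> = complex_of_real A * (complex_of_real (norm \<xi> powr \<sigma>) * k \<xi>)"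
          by (simp add: d_int(2))
        finally show ?thesis unfolding mk .
      qed
      then have "?c * (LINT \<xi>|lborel. LINT t|lborel. complex_of_real (d t \<xi>) * k \<xi>) = complex_of_real A * fourier (profile_multiplier \<sigma>) (- x)"
        by (subst fourier_lborel) simp_all
      also have "fourier (profile_multiplier \<sigma>) (- x) = complex_of_real (profile_laplacian \<sigma> x)"
        using profile_laplacian_radial[OF \<sigma>0, of x "- x"] by (simp flip: profile_laplacian_eq[OF \<sigma>0])
      finally show ?thesis by simp
    qed
    have inner: "?c * (LINT \<xi>|lborel. complex_of_real (d t \<xi>) * k \<xi>) = complex_of_real (heat_weight \<sigma> t) *
        fourier_inv (\<lambda>\<xi>. complex_of_real ((1 - exp (- t * (norm \<xi>)\<^sup>2)) ^ M) * ?F \<xi>) x" for t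
    proof -
      have "(LINT \<xi>|lborel. complex_of_real (d t \<xi>) * k \<xi>) = complex_of_real (heat_weight \<sigma> t) *
        (LINT \<xi>|lborel. iexp (- (\<xi> \<bullet> - x)) * (complex_of_real ((1 - exp (- t * (norm \<xi>)\<^sup>2)) ^ M) * ?F \<xi>))"
        unfolding d_def k_def by (subst integral_mult_right_zero[symmetric])
          (intro Bochner_Integration.integral_cong refl, simp only: of_real_mult mult_ac)
      then show ?thesis unfolding fourier_inv_eq_fourier by (subst fourier_lborel) simp_all
    qed
    define c' where "c' = (norm x)\<^sup>2 / (16 * (real M + 1))"
    have c': "0 < c'" using x by (auto simp: c'_def intro!: divide_pos_pos zero_less_power)
    define g where "g t = 2 ^ M * V * (4 * pi) powr (- real DIM('a) / 2) * (indicator {0<..} t * (t powr (- a - 1) * exp (- c' / t)))" for t :: real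
    have "norm (LINT t|lborel. ?c * (LINT \<xi>|lborel. complex_of_real (d t \<xi>) * k \<xi>)) \<le>
        2 ^ M * V * (4 * pi) powr (- real DIM('a) / 2) * (Gamma a * c' powr (- a))"
    proof (rule norm_integral_le_nn_integral)
      show "norm (?c * (LINT \<xi>|lborel. complex_of_real (d t \<xi>) * k \<xi>)) \<le> g t" for t
      proof (cases "0 < t")
        case True
        have "norm (?c * (LINT \<xi>|lborel. complex_of_real (d t \<xi>) * k \<xi>)) = heat_weight \<sigma> t *
          norm (fourier_inv (\<lambda>\<xi>. complex_of_real ((1 - exp (- t * (norm \<xi>)\<^sup>2)) ^ M) * ?F \<xi>) x)"
          unfolding inner using heat_weight_nonneg[OF \<sigma>0, of t] by (simp only: norm_mult norm_of_real abs_of_nonneg)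
        also have "\<dots> \<le> heat_weight \<sigma> t * (2 ^ M * (V * ((4 * pi * t) powr (- real DIM('a) / 2) *
            exp (- (norm x)\<^sup>2 / (16 * (real M + 1) * t)))))"
          unfolding V_def using fourier_inv_profile_heat_difference[OF \<sigma>0 x True, of M] heat_weight_nonneg[OF \<sigma>0, of t]
          by (intro mult_left_mono)
        also have "\<dots> = g t"
        proof -
          have "(4 * pi * t) powr (- real DIM('a) / 2) = (4 * pi) powr (- real DIM('a) / 2) * t powr (- real DIM('a) / 2)"
            using True by (simp only: powr_mult)
          moreover have "t powr (- \<sigma> / 2 - 1) * t powr (- real DIM('a) / 2) = t powr (- a - 1)"
            unfolding powr_add[symmetric] by (rule arg_cong[where f="(powr) t"]) (simp add: a_def add_divide_distrib)
          moreover have "- (norm x)\<^sup>2 / (16 * (real M + 1) * t) = - c' / t"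
            by (simp add: c'_def)
          ultimately show ?thesis using True
            by (simp add: heat_weight_def[OF \<sigma>0] g_def mult_ac)
        qed
        finally show ?thesis .
      next
        case False
        then show ?thesis unfolding inner by (simp add: heat_weight_def[OF \<sigma>0] g_def)
      qed
      have "(\<integral>\<^sup>+t. ennreal (g t) \<partial>lborel) = (\<integral>\<^sup>+t. ennreal (2 ^ M * V * (4 * pi) powr (- real DIM('a) / 2)) *
          ennreal (indicator {0<..} t * (t powr (- a - 1) * exp (- c' / t))) \<partial>lborel)"
        unfolding g_def using V by (intro nn_integral_cong ennreal_mult) auto
      also have "\<dots> = ennreal (2 ^ M * V * (4 * pi) powr (- real DIM('a) / 2)) * ennreal (Gamma a * c' powr (- a))"
        by (subst nn_integral_cmult) (simp, simp only: nn_integral_Gamma_inverse[OF a c'])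
      also have "\<dots> = ennreal (2 ^ M * V * (4 * pi) powr (- real DIM('a) / 2) * (Gamma a * c' powr (- a)))"
        using V a by (intro ennreal_mult[symmetric]) (auto simp: Gamma_real_nonneg)
      finally show "(\<integral>\<^sup>+t. ennreal (g t) \<partial>lborel) \<le>
        ennreal (2 ^ M * V * (4 * pi) powr (- real DIM('a) / 2) * (Gamma a * c' powr (- a)))" by simp
      show "0 \<le> 2 ^ M * V * (4 * pi) powr (- real DIM('a) / 2) * (Gamma a * c' powr (- a))"
        using V a by (auto simp: Gamma_real_nonneg)
    qed
    also have "(LINT t|lborel. ?c * (LINT \<xi>|lborel. complex_of_real (d t \<xi>) * k \<xi>)) = complex_of_real (A * profile_laplacian \<sigma> x)"
      using lhs by (simp only: integral_mult_right_zero fub)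
    also have "norm (complex_of_real (A * profile_laplacian \<sigma> x)) = A * \<bar>profile_laplacian \<sigma> x\<bar>"
      using A(1) by (simp only: norm_of_real abs_mult abs_of_pos)
    also have "c' powr (- a) = (16 * (real M + 1)) powr a * norm x powr (- \<sigma> - real DIM('a))"
    proof -
      have "c' powr (- a) = ((norm x)\<^sup>2) powr (- a) * (16 * (real M + 1)) powr a"
        unfolding c'_def by (subst powr_divide) (simp_all add: powr_minus divide_inverse)
      also have "((norm x)\<^sup>2) powr (- a) = norm x powr (- \<sigma> - real DIM('a))"
      proof -
        have e: "- \<sigma> - real DIM('a) = - 2 * a" by (simp add: a_def)
        show ?thesis unfolding e using powr_half_square[of "norm x" "- 2 * a"] by simp
      qed
      finally show ?thesis by simp
    qed
    finally show ?thesis using A(1) by (simp add: C_def pos_le_divide_eq mult_ac)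
  qed
  moreover have "0 \<le> C" unfolding C_def using A(1) a V by (auto simp: Gamma_real_nonneg intro!: divide_nonneg_nonneg mult_nonneg_nonneg)
  ultimately show ?thesis by blast
qed

text \<open>Enlarging the constant makes the decay estimate valid up to the origin, so that later
estimates need no separate treatment of small arguments.\<close>

lemma profile_laplacian_bounds:
  assumes \<sigma>: "\<sigma> \<le> real DIM('a)"
  shows "\<exists>C>0. \<forall>x::'a::euclidean_space. \<bar>profile_laplacian \<sigma> x\<bar> \<le> C \<and>
    (x \<noteq> 0 \<longrightarrow> \<bar>profile_laplacian \<sigma> x\<bar> \<le> C * norm x powr (- \<sigma> - real DIM('a)))"
proof -
  obtain C0 where C0: "C0 \<ge> 0" "\<And>x::'a. \<bar>profile_laplacian \<sigma> x\<bar> \<le> C0"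
    using profile_laplacian_bounded[OF \<sigma>0 \<sigma>] by blast
  obtain C1 where C1: "C1 \<ge> 0" "\<And>x::'a. 2 \<le> norm x \<Longrightarrow> \<bar>profile_laplacian \<sigma> x\<bar> \<le> C1 * norm x powr (- \<sigma> - real DIM('a))"
    using profile_laplacian_decay[OF \<sigma>] by blast
  define e where "e = \<sigma> + real DIM('a)"
  have e: "0 < e" "- \<sigma> - real DIM('a) = - e" using \<sigma>0 by (auto simp: e_def)
  define C where "C = C0 * 2 powr e + C1 + 1"
  have "1 \<le> 2 powr e" using e by (simp add: ge_one_powr_ge_zero)
  then have "C0 * 1 \<le> C0 * 2 powr e" using C0(1) by (intro mult_left_mono)
  then have "C0 \<le> C" unfolding C_def using C1(1) by linarith
  moreover have "\<bar>profile_laplacian \<sigma> x\<bar> \<le> C * norm x powr (- e)" if "x \<noteq> 0" for x :: 'a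
  proof (cases "2 \<le> norm x")
    case True
    have "C1 * norm x powr (- e) \<le> C * norm x powr (- e)"
      unfolding C_def using C0(1) by (intro mult_right_mono) auto
    then show ?thesis using C1(2)[OF True] e(2) by simp
  next
    case False
    have "norm x powr e \<le> 2 powr e" using False e by (intro powr_mono2) auto
    then have "1 \<le> 2 powr e * norm x powr (- e)"
      using that by (simp add: powr_minus divide_inverse[symmetric])
    then have "C0 * 1 \<le> C0 * (2 powr e * norm x powr (- e))" using C0(1) by (intro mult_left_mono)
    also have "\<dots> \<le> C * norm x powr (- e)"
      unfolding C_def mult.assoc[symmetric] using C1(1) by (intro mult_right_mono) auto
    finally show ?thesis using C0(2)[of x] by simp
  qed
  moreover have "0 < C" unfolding C_def using C0(1) C1(1) by (intro add_nonneg_pos add_nonneg_nonneg) auto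
  ultimately show ?thesis
    unfolding e(2) using order_trans[OF C0(2)] by (intro exI[of _ C] conjI allI impI)
qed

end

section \<open>The Riesz potential at the origin and duality for dilates\<close>

context
  fixes \<sigma> :: real
  assumes \<sigma>0: "0 < \<sigma>"
begin

text \<open>The Riesz potential of order \<open>\<sigma>\<close>, at the origin, of the fractional Laplacian of order \<open>\<sigma>\<close> of
the bump \<open>\<psi>\<close>.
Its kernel is, up to the factor \<open>\<kappa>\<close>, the time integral of the heat kernel with density
\<open>v s = s powr (\<sigma> / 2 - 1)\<close>. For fixed \<open>s\<close> the multiplication formula moves the heat kernel to the
Fourier side, where the time integral of \<open>exp (- s \<bar>\<xi>\<bar>\<^sup>2)\<close> cancels \<open>\<bar>\<xi>\<bar>\<^sup>\<sigma>\<close> and leaves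
\<open>Gamma (\<sigma> / 2)\<close> times the inverse transform of the transform of \<open>\<psi>\<close> at the origin, which is
\<open>\<psi>(0) = 1\<close>.\<close>

lemma
  assumes \<sigma>: "\<sigma> < real DIM('a::euclidean_space)"
  shows integrable_riesz_profile_laplacian:
      "integrable lborel (\<lambda>x::'a. norm x powr (\<sigma> - real DIM('a)) * profile_laplacian \<sigma> x)" (is ?I)
    and integral_riesz_profile_laplacian:
      "(LINT x|lborel. norm (x::'a) powr (\<sigma> - real DIM('a)) * profile_laplacian \<sigma> x) =
        2 powr \<sigma> * pi powr (real DIM('a) / 2) * Gamma (\<sigma> / 2) / Gamma ((real DIM('a) - \<sigma>) / 2)" (is ?E)
proof -
  let ?n = "real DIM('a)"
  let ?h = "profile_laplacian \<sigma> :: 'a \<Rightarrow> real"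
  note [measurable] = borel_measurable_profile_laplacian[OF \<sigma>0] borel_measurable_profile_multiplier[OF \<sigma>0]
  obtain C where C: "0 < C" "\<And>x::'a. \<bar>?h x\<bar> \<le> C"
    "\<And>x::'a. x \<noteq> 0 \<Longrightarrow> \<bar>?h x\<bar> \<le> C * norm x powr (- \<sigma> - ?n)"
    using profile_laplacian_bounds[OF \<sigma>0, where 'a='a] \<sigma> by auto
  show ?I
  proof (rule integrableI_bounded)
    \<comment> \<open>near the origin \<open>h\<close> is bounded and \<open>\<sigma> > 0\<close>, far away \<open>h\<close> decays; both halves become Gamma integrals\<close>
    have "(\<integral>\<^sup>+x. ennreal (norm (norm x powr (\<sigma> - ?n) * ?h x)) \<partial>lborel) \<le>
        (\<integral>\<^sup>+x. ennreal (norm (x::'a) powr (\<sigma> - ?n) * (C * min 1 (norm x powr (- \<sigma> - ?n)))) \<partial>lborel)"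
    proof (rule nn_integral_mono)
      fix x :: 'a
      have "\<bar>?h x\<bar> \<le> C * min 1 (norm x powr (- \<sigma> - ?n))" if "x \<noteq> 0"
        using C(1) C(2)[of x] C(3)[OF that] by (simp add: min_def)
      then show "ennreal (norm (norm x powr (\<sigma> - ?n) * ?h x)) \<le> ennreal (norm (x::'a) powr (\<sigma> - ?n) * (C * min 1 (norm x powr (- \<sigma> - ?n))))"
        by (cases "x = 0") (auto simp: abs_mult intro!: ennreal_leI mult_left_mono)
    qed
    also have "\<dots> = ennreal (sphere_area TYPE('a)) *
        (\<integral>\<^sup>+r. ennreal (indicator {0..} r * r ^ (DIM('a) - 1)) * ennreal (r powr (\<sigma> - ?n) * (C * min 1 (r powr (- \<sigma> - ?n)))) \<partial>lborel)"
      by (rule nn_integral_radial) measurable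
    also have "(\<integral>\<^sup>+r. ennreal (indicator {0..} r * r ^ (DIM('a) - 1)) * ennreal (r powr (\<sigma> - ?n) * (C * min 1 (r powr (- \<sigma> - ?n)))) \<partial>lborel)
        \<le> (\<integral>\<^sup>+r. ennreal (C * exp 1) * ennreal (indicator {0<..} r * (r powr (\<sigma> - 1) * exp (- 1 * r))) +
            ennreal (C * exp 1) * ennreal (indicator {0<..} r * (r powr (- ?n - 1) * exp (- 1 / r))) \<partial>lborel)"
    proof (rule nn_integral_mono)
      fix r :: real
      show "ennreal (indicator {0..} r * r ^ (DIM('a) - 1)) * ennreal (r powr (\<sigma> - ?n) * (C * min 1 (r powr (- \<sigma> - ?n)))) \<le>
        ennreal (C * exp 1) * ennreal (indicator {0<..} r * (r powr (\<sigma> - 1) * exp (- 1 * r))) +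
            ennreal (C * exp 1) * ennreal (indicator {0<..} r * (r powr (- ?n - 1) * exp (- 1 / r)))"
      proof (cases "0 < r")
        case r: True
        have "r ^ (DIM('a) - 1) * r powr (\<sigma> - ?n) = r powr (real (DIM('a) - 1) + (\<sigma> - ?n))"
          by (simp only: powr_add powr_realpow[OF r])
        also have "real (DIM('a) - 1) + (\<sigma> - ?n) = \<sigma> - 1" using DIM_positive[where 'a='a] by (simp add: of_nat_diff)
        finally have pw: "r ^ (DIM('a) - 1) * r powr (\<sigma> - ?n) = r powr (\<sigma> - 1)" .
        have pw2: "r powr (\<sigma> - 1) * r powr (- \<sigma> - ?n) = r powr (- ?n - 1)"
          unfolding powr_add[symmetric] by (rule arg_cong[where f="(powr) r"]) simp
        have eq: "ennreal (indicator {0..} r * r ^ (DIM('a) - 1)) * ennreal (r powr (\<sigma> - ?n) * (C * min 1 (r powr (- \<sigma> - ?n)))) =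
           ennreal (r powr (\<sigma> - 1) * (C * min 1 (r powr (- \<sigma> - ?n))))"
          using r C(1) pw by (simp add: ennreal_mult[symmetric] mult.assoc[symmetric])
        show ?thesis
        proof (cases "r \<le> 1")
          case True
          have "r powr (\<sigma> - 1) * (C * min 1 (r powr (- \<sigma> - ?n))) \<le> r powr (\<sigma> - 1) * (C * (exp 1 * exp (- r)))"
            using C(1) True by (intro mult_left_mono) (auto simp: exp_add[symmetric] min_le_iff_disj)
          also have "\<dots> = C * exp 1 * (r powr (\<sigma> - 1) * exp (- 1 * r))" by simp
          finally have "ennreal (r powr (\<sigma> - 1) * (C * min 1 (r powr (- \<sigma> - ?n)))) \<le>
            ennreal (C * exp 1) * ennreal (indicator {0<..} r * (r powr (\<sigma> - 1) * exp (- 1 * r)))"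
            using r C(1) by (simp add: ennreal_mult[symmetric] ennreal_leI)
          then show ?thesis unfolding eq by (rule order_trans) simp
        next
          case False
          have "r powr (\<sigma> - 1) * (C * min 1 (r powr (- \<sigma> - ?n))) \<le> r powr (\<sigma> - 1) * (C * (r powr (- \<sigma> - ?n) * (exp 1 * exp (- 1 / r))))"
          proof (intro mult_left_mono)
            have "min 1 (r powr (- \<sigma> - ?n)) \<le> r powr (- \<sigma> - ?n) * 1" by simp
            also have "\<dots> \<le> r powr (- \<sigma> - ?n) * (exp 1 * exp (- 1 / r))"
              using False by (intro mult_left_mono) (auto simp: exp_add[symmetric])
            finally show "min 1 (r powr (- \<sigma> - ?n)) \<le> r powr (- \<sigma> - ?n) * (exp 1 * exp (- 1 / r))" .
          qed (use C(1) in auto)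
          also have "\<dots> = C * exp 1 * ((r powr (\<sigma> - 1) * r powr (- \<sigma> - ?n)) * exp (- 1 / r))" by simp
          finally have "ennreal (r powr (\<sigma> - 1) * (C * min 1 (r powr (- \<sigma> - ?n)))) \<le>
            ennreal (C * exp 1) * ennreal (indicator {0<..} r * (r powr (- ?n - 1) * exp (- 1 / r)))"
            unfolding pw2 using r C(1) by (simp add: ennreal_mult[symmetric] ennreal_leI)
          then show ?thesis unfolding eq by (rule order_trans) simp
        qed
      next
        case False
        then have "r = 0 \<or> r \<notin> {0..}" by auto
        then show ?thesis by auto
      qed
    qed
    also have "\<dots> = ennreal (C * exp 1) * ennreal (Gamma \<sigma> * 1 powr (- \<sigma>)) + ennreal (C * exp 1) * ennreal (Gamma ?n * 1 powr (- ?n))"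
      using \<sigma>0 nn_integral_Gamma_scaled[of \<sigma> 1] nn_integral_Gamma_inverse[of ?n 1]
      by (subst nn_integral_add) (simp_all add: nn_integral_cmult)
    also have "ennreal (sphere_area TYPE('a)) * \<dots> < \<infinity>"
      by (simp add: ennreal_mult_less_top)
    finally show "(\<integral>\<^sup>+x. ennreal (norm (norm (x::'a) powr (\<sigma> - ?n) * ?h x)) \<partial>lborel) < \<infinity>"
      by (auto simp: mult_left_mono)
  qed measurable
  define b where "b = (?n - \<sigma>) / 2"
  have b: "0 < b" using \<sigma> by (simp add: b_def)
  define v where "v s = indicator {0<..} s * s powr (\<sigma> / 2 - 1)" for s :: real
  have [measurable]: "v \<in> borel_measurable borel" unfolding v_def by measurable
  have v_nn: "0 \<le> v s" for s by (simp add: v_def indicator_def)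
  define \<kappa> where "\<kappa> = (4 * pi) powr (- ?n / 2) * (Gamma b * 4 powr b)"
  have \<kappa>: "0 < \<kappa>" unfolding \<kappa>_def using b by (intro mult_pos_pos) (auto intro: Gamma_real_pos)
  have [measurable]: "(\<lambda>(x::'a, s). v s * heat_kernel s x) \<in> borel_measurable (borel \<Otimes>\<^sub>M borel)"
    unfolding heat_kernel_def by measurable
  \<comment> \<open>the time integral of the heat kernel is the Riesz kernel\<close>
  have heat: "integrable lborel (\<lambda>s. v s * heat_kernel s x)"
    "(LINT s|lborel. v s * heat_kernel s x) = \<kappa> * norm x powr (\<sigma> - ?n)" if x: "x \<noteq> 0" for x :: 'a
  proof -
    have q: "0 < (norm x)\<^sup>2 / 4" using x by simp
    have eq: "v s * heat_kernel s x = (4 * pi) powr (- ?n / 2) *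
        (indicator {0<..} s * (s powr (- b - 1) * exp (- ((norm x)\<^sup>2 / 4) / s)))" for s
    proof (cases "0 < s")
      case True
      have "(4 * pi * s) powr (- ?n / 2) = (4 * pi) powr (- ?n / 2) * s powr (- ?n / 2)" by (rule powr_mult)
      moreover have "s powr (\<sigma> / 2 - 1) * s powr (- ?n / 2) = s powr (- b - 1)"
        unfolding powr_add[symmetric] by (rule arg_cong[where f="(powr) s"]) (simp add: b_def diff_divide_distrib)
      ultimately show ?thesis using True by (simp add: v_def heat_kernel_def mult_ac)
    qed (simp add: v_def)
    have "(\<integral>\<^sup>+s. ennreal (v s * heat_kernel s x) \<partial>lborel) = (\<integral>\<^sup>+s. ennreal ((4 * pi) powr (- ?n / 2)) *
        ennreal (indicator {0<..} s * (s powr (- b - 1) * exp (- ((norm x)\<^sup>2 / 4) / s))) \<partial>lborel)"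
      unfolding eq by (intro nn_integral_cong ennreal_mult) auto
    also have "\<dots> = ennreal ((4 * pi) powr (- ?n / 2)) * ennreal (Gamma b * ((norm x)\<^sup>2 / 4) powr (- b))"
      by (subst nn_integral_cmult) (simp_all only: nn_integral_Gamma_inverse[OF b q], measurable)
    also have "\<dots> = ennreal ((4 * pi) powr (- ?n / 2) * (Gamma b * ((norm x)\<^sup>2 / 4) powr (- b)))"
      using b by (intro ennreal_mult[symmetric]) (auto simp: Gamma_real_nonneg)
    also have "((norm x)\<^sup>2 / 4) powr (- b) = norm x powr (\<sigma> - ?n) * 4 powr b"
    proof -
      have "((norm x)\<^sup>2 / 4) powr (- b) = ((norm x)\<^sup>2) powr (- b) / 4 powr (- b)" by (rule powr_divide)
      also have "((norm x)\<^sup>2) powr (- b) = norm x powr (\<sigma> - ?n)"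
      proof -
        have e: "\<sigma> - ?n = - 2 * b" by (simp add: b_def)
        show ?thesis unfolding e using powr_half_square[of "norm x" "- 2 * b"] by simp
      qed
      also have "norm x powr (\<sigma> - ?n) / 4 powr (- b) = norm x powr (\<sigma> - ?n) * 4 powr b"
        by (simp only: powr_minus divide_inverse inverse_inverse_eq)
      finally show ?thesis .
    qed
    also have "(4 * pi) powr (- ?n / 2) * (Gamma b * (norm x powr (\<sigma> - ?n) * 4 powr b)) = \<kappa> * norm x powr (\<sigma> - ?n)"
      by (simp add: \<kappa>_def)
    finally have nn: "(\<integral>\<^sup>+s. ennreal (v s * heat_kernel s x) \<partial>lborel) = ennreal (\<kappa> * norm x powr (\<sigma> - ?n))" .
    have m: "(\<lambda>s. v s * heat_kernel s x) \<in> borel_measurable lborel" unfolding heat_kernel_def by measurable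
    show "integrable lborel (\<lambda>s. v s * heat_kernel s x)"
      using nn \<kappa> by (intro integrable_of_nn_integral[OF m]) (auto simp: v_nn heat_kernel_nonneg)
    show "(LINT s|lborel. v s * heat_kernel s x) = \<kappa> * norm x powr (\<sigma> - ?n)"
      using nn \<kappa> by (intro integral_of_nn_integral[OF m]) (auto simp: v_nn heat_kernel_nonneg)
  qed
  have gam: "integrable lborel (\<lambda>s. v s * exp (- s * (norm \<xi>)\<^sup>2))"
    "(LINT s|lborel. v s * exp (- s * (norm \<xi>)\<^sup>2)) * norm \<xi> powr \<sigma> = Gamma (\<sigma> / 2)" if \<xi>: "\<xi> \<noteq> 0" for \<xi> :: 'a
  proof -
    have l: "0 < (norm \<xi>)\<^sup>2" using \<xi> by simp
    have "(\<integral>\<^sup>+s. ennreal (v s * exp (- s * (norm \<xi>)\<^sup>2)) \<partial>lborel) = ennreal (Gamma (\<sigma> / 2) * ((norm \<xi>)\<^sup>2) powr (- (\<sigma> / 2)))"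
      using nn_integral_Gamma_scaled[OF _ l, of "\<sigma> / 2"] \<sigma>0 by (simp add: v_def mult_ac)
    also have "((norm \<xi>)\<^sup>2) powr (- (\<sigma> / 2)) = norm \<xi> powr (- \<sigma>)"
      using powr_half_square[of "norm \<xi>" "- \<sigma>"] by simp
    finally have nn: "(\<integral>\<^sup>+s. ennreal (v s * exp (- s * (norm \<xi>)\<^sup>2)) \<partial>lborel) = ennreal (Gamma (\<sigma> / 2) * norm \<xi> powr (- \<sigma>))" .
    have m: "(\<lambda>s. v s * exp (- s * (norm \<xi>)\<^sup>2)) \<in> borel_measurable lborel" by measurable
    show "integrable lborel (\<lambda>s. v s * exp (- s * (norm \<xi>)\<^sup>2))"
      using nn \<sigma>0 by (intro integrable_of_nn_integral[OF m]) (auto simp: v_nn Gamma_real_nonneg)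
    have "(LINT s|lborel. v s * exp (- s * (norm \<xi>)\<^sup>2)) = Gamma (\<sigma> / 2) * norm \<xi> powr (- \<sigma>)"
      using nn \<sigma>0 by (intro integral_of_nn_integral[OF m]) (auto simp: v_nn Gamma_real_nonneg)
    then show "(LINT s|lborel. v s * exp (- s * (norm \<xi>)\<^sup>2)) * norm \<xi> powr \<sigma> = Gamma (\<sigma> / 2)"
      using \<xi> by (simp add: powr_minus)
  qed
  let ?c = "complex_of_real ((2 * pi) powr (- ?n / 2))"
  let ?M = "profile_multiplier \<sigma> :: 'a \<Rightarrow> complex"
  let ?F = "fourier (\<lambda>x::'a. complex_of_real (profile x))"
  note [measurable] = borel_measurable_fourier[of "\<lambda>x::'a. complex_of_real (profile x)"]
  have M_int: "integrable lborel ?M"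
    by (intro decaying_integrable decaying_profile_multiplier[OF \<sigma>0] less_imp_le[OF \<sigma>])
  \<comment> \<open>for fixed time, pass to the Fourier side\<close>
  have mid: "(LINT x|lborel. complex_of_real (v s * heat_kernel s x * ?h x)) =
      (LINT \<xi>|lborel. ?c * (complex_of_real (v s * exp (- s * (norm \<xi>)\<^sup>2)) * ?M \<xi>))" for s
  proof (cases "0 < s")
    case True
    have "(LINT x|lborel. complex_of_real (v s * heat_kernel s x * ?h x)) =
        complex_of_real (v s) * (LINT x|lborel. fourier ?M x * complex_of_real (heat_kernel s x))"
      by (subst integral_mult_right_zero[symmetric]) (simp add: profile_laplacian_eq[OF \<sigma>0, symmetric] mult_ac)
    also have "\<dots> = complex_of_real (v s) * (LINT \<xi>|lborel. ?M \<xi> * fourier (\<lambda>x. complex_of_real (heat_kernel s x)) \<xi>)"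
      using heat_kernel_integral(1)[OF True, where 'a='a]
      by (subst fourier_multiplication_formula[OF M_int]) auto
    also have "\<dots> = (LINT \<xi>|lborel. ?c * (complex_of_real (v s * exp (- s * (norm \<xi>)\<^sup>2)) * ?M \<xi>))"
      by (subst integral_mult_right_zero[symmetric]) (simp add: fourier_heat_kernel[OF True] mult_ac)
    finally show ?thesis .
  qed (simp add: v_def)
  have fub1: "(LINT s|lborel. LINT x|lborel. complex_of_real (v s * heat_kernel s x * ?h x)) =
      (LINT x|lborel. LINT s|lborel. complex_of_real (v s * heat_kernel s x * ?h x))"
  proof (rule lborel_pair.Fubini_integral, rule lborel_pair.Fubini_integrable)
    show "(\<lambda>(x::'a, s). complex_of_real (v s * heat_kernel s x * ?h x)) \<in> borel_measurable (lborel \<Otimes>\<^sub>M lborel)"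
      unfolding heat_kernel_def by measurable
    have eq: "AE x::'a in lborel. \<kappa> * (norm (norm x powr (\<sigma> - ?n) * ?h x)) =
        (LINT s|lborel. norm (case (x, s) of (x, s) \<Rightarrow> complex_of_real (v s * heat_kernel s x * ?h x)))"
      using AE_lborel_singleton[of "0::'a"]
    proof eventually_elim
      case (elim x)
      have "(LINT s|lborel. norm (case (x, s) of (x, s) \<Rightarrow> complex_of_real (v s * heat_kernel s x * ?h x))) =
        (LINT s|lborel. (v s * heat_kernel s x) * \<bar>?h x\<bar>)"
        by (simp add: norm_mult abs_mult v_nn heat_kernel_nonneg)
      also have "\<dots> = (\<kappa> * norm x powr (\<sigma> - ?n)) * \<bar>?h x\<bar>"
        using heat(2)[of x] elim by (simp only: integral_mult_left_zero) simp
      finally show ?case by (simp add: abs_mult)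
    qed
    have "integrable lborel (\<lambda>x. \<kappa> * (norm (norm x powr (\<sigma> - ?n) * ?h x)))"
      using \<open>?I\<close> by (intro integrable_mult_right integrable_norm)
    then show "integrable lborel (\<lambda>x::'a. LINT s|lborel. norm (case (x, s) of (x, s) \<Rightarrow> complex_of_real (v s * heat_kernel s x * ?h x)))"
    proof (rule integrable_cong_AE_imp[OF _ _ eq])
      show "(\<lambda>x::'a. LINT s|lborel. norm (case (x, s) of (x, s) \<Rightarrow> complex_of_real (v s * heat_kernel s x * ?h x))) \<in> borel_measurable lborel"
        unfolding heat_kernel_def by measurable
    qed
    show "AE x::'a in lborel. integrable lborel (\<lambda>s. case (x, s) of (x, s) \<Rightarrow> complex_of_real (v s * heat_kernel s x * ?h x))"
      using AE_lborel_singleton[of "0::'a"] by eventually_elim (simp add: heat(1) del: of_real_mult)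
  qed
  have fub2: "(LINT s|lborel. LINT \<xi>|lborel. ?c * (complex_of_real (v s * exp (- s * (norm \<xi>)\<^sup>2)) * ?M \<xi>)) =
      (LINT \<xi>|lborel. LINT s|lborel. ?c * (complex_of_real (v s * exp (- s * (norm \<xi>)\<^sup>2)) * ?M \<xi>))"
  proof (rule lborel_pair.Fubini_integral, rule lborel_pair.Fubini_integrable)
    show "(\<lambda>(\<xi>::'a, s). ?c * (complex_of_real (v s * exp (- s * (norm \<xi>)\<^sup>2)) * ?M \<xi>)) \<in> borel_measurable (lborel \<Otimes>\<^sub>M lborel)"
      by measurable
    have eq: "AE \<xi>::'a in lborel. norm ?c * Gamma (\<sigma> / 2) * norm (?F \<xi>) =
        (LINT s|lborel. norm (case (\<xi>, s) of (\<xi>, s) \<Rightarrow> ?c * (complex_of_real (v s * exp (- s * (norm \<xi>)\<^sup>2)) * ?M \<xi>)))"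
      using AE_lborel_singleton[of "0::'a"]
    proof eventually_elim
      case (elim \<xi>)
      have "(LINT s|lborel. norm (case (\<xi>, s) of (\<xi>, s) \<Rightarrow> ?c * (complex_of_real (v s * exp (- s * (norm \<xi>)\<^sup>2)) * ?M \<xi>))) =
        (LINT s|lborel. (v s * exp (- s * (norm \<xi>)\<^sup>2)) * (norm ?c * (norm \<xi> powr \<sigma> * norm (?F \<xi>))))"
        by (intro Bochner_Integration.integral_cong refl)
          (simp add: norm_mult abs_mult v_nn profile_multiplier_def mult_ac)
      also have "\<dots> = (LINT s|lborel. v s * exp (- s * (norm \<xi>)\<^sup>2)) * norm \<xi> powr \<sigma> * (norm ?c * norm (?F \<xi>))"
        by (subst integral_mult_left_zero) (simp only: mult_ac)
      also have "\<dots> = Gamma (\<sigma> / 2) * (norm ?c * norm (?F \<xi>))"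
        using gam(2)[of \<xi>] elim by (simp only:) simp
      finally show ?case by (simp add: mult_ac)
    qed
    have "integrable lborel (\<lambda>\<xi>. norm ?c * Gamma (\<sigma> / 2) * norm (?F \<xi>))"
      by (intro integrable_mult_right integrable_norm integrable_fourier_profile)
    then show "integrable lborel (\<lambda>\<xi>::'a. LINT s|lborel. norm (case (\<xi>, s) of (\<xi>, s) \<Rightarrow> ?c * (complex_of_real (v s * exp (- s * (norm \<xi>)\<^sup>2)) * ?M \<xi>)))"
      by (rule integrable_cong_AE_imp[OF _ _ eq]) measurable
    show "AE \<xi>::'a in lborel. integrable lborel (\<lambda>s. case (\<xi>, s) of (\<xi>, s) \<Rightarrow> ?c * (complex_of_real (v s * exp (- s * (norm \<xi>)\<^sup>2)) * ?M \<xi>))"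
      using AE_lborel_singleton[of "0::'a"]
      by eventually_elim (use gam(1) in \<open>simp add: integrable_mult_right integrable_mult_left del: of_real_mult\<close>)
  qed
  have lhs: "(LINT x|lborel. LINT s|lborel. complex_of_real (v s * heat_kernel s x * ?h x)) =
      complex_of_real (\<kappa> * (LINT x|lborel. norm (x::'a) powr (\<sigma> - ?n) * ?h x))"
  proof -
    have "(LINT x|lborel. LINT s|lborel. complex_of_real (v s * heat_kernel s x * ?h x)) =
        (LINT x|lborel. complex_of_real (\<kappa> * (norm (x::'a) powr (\<sigma> - ?n) * ?h x)))"
    proof (rule integral_cong_AE)
      show "AE x::'a in lborel. (LINT s|lborel. complex_of_real (v s * heat_kernel s x * ?h x)) =
          complex_of_real (\<kappa> * (norm x powr (\<sigma> - ?n) * ?h x))"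
        using AE_lborel_singleton[of "0::'a"]
      proof eventually_elim
        case (elim x)
        have "(LINT s|lborel. complex_of_real (v s * heat_kernel s x * ?h x)) =
            complex_of_real ((LINT s|lborel. v s * heat_kernel s x) * ?h x)"
          by (simp only: integral_complex_of_real integral_mult_left_zero)
        then show ?case using heat(2)[of x] elim by simp
      qed
      show "(\<lambda>x::'a. LINT s|lborel. complex_of_real (v s * heat_kernel s x * ?h x)) \<in> borel_measurable lborel"
        unfolding heat_kernel_def by measurable
    qed measurable
    also have "\<dots> = complex_of_real (\<kappa> * (LINT x|lborel. norm (x::'a) powr (\<sigma> - ?n) * ?h x))"
      by (simp only: integral_complex_of_real integral_mult_right_zero)
    finally show ?thesis .
  qed
  have rhs: "(LINT \<xi>|lborel. LINT s|lborel. ?c * (complex_of_real (v s * exp (- s * (norm \<xi>)\<^sup>2)) * ?M \<xi>)) =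
      complex_of_real (Gamma (\<sigma> / 2))"
  proof -
    have "(LINT \<xi>|lborel. LINT s|lborel. ?c * (complex_of_real (v s * exp (- s * (norm \<xi>)\<^sup>2)) * ?M \<xi>)) =
       (LINT \<xi>|lborel. complex_of_real (Gamma (\<sigma> / 2)) * (?c * (iexp (- (\<xi> \<bullet> (0::'a))) * ?F \<xi>)))"
    proof (rule integral_cong_AE)
      show "AE \<xi>::'a in lborel. (LINT s|lborel. ?c * (complex_of_real (v s * exp (- s * (norm \<xi>)\<^sup>2)) * ?M \<xi>)) =
          complex_of_real (Gamma (\<sigma> / 2)) * (?c * (iexp (- (\<xi> \<bullet> (0::'a))) * ?F \<xi>))"
        using AE_lborel_singleton[of "0::'a"]
      proof eventually_elim
        case (elim \<xi>)
        have "(LINT s|lborel. ?c * (complex_of_real (v s * exp (- s * (norm \<xi>)\<^sup>2)) * ?M \<xi>)) =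
            ?c * (complex_of_real (LINT s|lborel. v s * exp (- s * (norm \<xi>)\<^sup>2)) * ?M \<xi>)"
          by (simp only: integral_mult_right_zero integral_mult_left_zero integral_complex_of_real)
        also have "\<dots> = ?c * (complex_of_real ((LINT s|lborel. v s * exp (- s * (norm \<xi>)\<^sup>2)) * norm \<xi> powr \<sigma>) * ?F \<xi>)"
          by (simp only: profile_multiplier_def of_real_mult mult.assoc)
        also have "(LINT s|lborel. v s * exp (- s * (norm \<xi>)\<^sup>2)) * norm \<xi> powr \<sigma> = Gamma (\<sigma> / 2)"
          using elim by (rule gam(2))
        finally show ?case by (simp add: mult_ac)
      qed
    qed measurable
    also have "\<dots> = complex_of_real (Gamma (\<sigma> / 2)) * fourier_inv ?F 0"
      unfolding fourier_inv_eq_fourier by (subst fourier_lborel) simp_all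
    also have "fourier_inv ?F 0 = 1"
      by (subst fourier_inv_fourier_profile) (simp add: profile_def bump_0)
    finally show ?thesis by simp
  qed
  have "complex_of_real (\<kappa> * (LINT x|lborel. norm (x::'a) powr (\<sigma> - ?n) * ?h x)) = complex_of_real (Gamma (\<sigma> / 2))"
    using fub1 fub2 unfolding mid lhs rhs by simp
  then have *: "\<kappa> * (LINT x|lborel. norm (x::'a) powr (\<sigma> - ?n) * ?h x) = Gamma (\<sigma> / 2)"
    by (simp only: of_real_eq_iff)
  have "\<kappa> * (2 powr \<sigma> * pi powr (?n / 2)) = Gamma b"
  proof -
    have "(4 * pi) powr (- ?n / 2) * (4 powr b * (2 powr \<sigma> * pi powr (?n / 2))) = 1"
    proof -
      have "(4 * pi) powr (- ?n / 2) = 4 powr (- ?n / 2) * pi powr (- ?n / 2)" by (rule powr_mult)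
      moreover have "(2::real) powr \<sigma> = 4 powr (\<sigma> / 2)"
        using powr_half_square[of 2 \<sigma>] by simp
      moreover have "4 powr (- ?n / 2) * (4 powr b * 4 powr (\<sigma> / 2)) = (1::real)"
        unfolding powr_add[symmetric] by (simp add: b_def diff_divide_distrib)
      moreover have "pi powr (- ?n / 2) * pi powr (?n / 2) = 1"
        unfolding powr_add[symmetric] by simp
      moreover have "(A * B) * (D * (E * G)) = (A * (D * E)) * (B * G)" for A B D E G :: real
        by (simp only: mult_ac)
      ultimately show ?thesis by (simp only: mult_1_left)
    qed
    then show ?thesis unfolding \<kappa>_def by (simp add: mult_ac)
  qed
  moreover have "0 < Gamma b" using b by (rule Gamma_real_pos)
  ultimately have "(LINT x|lborel. norm (x::'a) powr (\<sigma> - ?n) * ?h x) =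
      (\<kappa> * (LINT x|lborel. norm (x::'a) powr (\<sigma> - ?n) * ?h x)) * (2 powr \<sigma> * pi powr (?n / 2)) / Gamma b"
    by (simp add: nonzero_eq_divide_eq mult_ac)
  then show ?E unfolding * b_def by (simp only: mult_ac)
qed

text \<open>The symmetry of the multiplier, applied to a translated dilate of the bump: its transform
is a modulated dilate, and \<open>\<bar>\<xi>\<bar>\<^sup>\<sigma>\<close> is homogeneous of degree \<open>\<sigma>\<close>, which produces the factor
\<open>t powr (- \<sigma>)\<close>.\<close>

lemma profile_duality:
  fixes a :: "'a::euclidean_space"
  assumes \<sigma>: "\<sigma> \<le> real DIM('a)" and t: "0 < t" and \<phi>: "\<phi> \<in> schwartz"
  shows "(LINT x|lborel. complex_of_real (profile ((1 / t) *\<^sub>R (x - a))) * frac_laplacian_schwartz (\<sigma> / 2) \<phi> x) =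
    (LINT x|lborel. complex_of_real (t powr (- \<sigma>) * profile_laplacian \<sigma> ((1 / t) *\<^sub>R (x - a))) * \<phi> x)"
proof -
  let ?m = "\<lambda>\<xi>::'a. complex_of_real (norm \<xi> powr \<sigma>)"
  let ?p = "\<lambda>x::'a. complex_of_real (profile x)"
  define P where "P x = ?p (- ((1 / t) *\<^sub>R a) + (1 / t) *\<^sub>R x)" for x
  note [measurable] = borel_measurable_profile_multiplier[OF \<sigma>0] borel_measurable_fourier[of ?p]
  have M_int: "integrable lborel (profile_multiplier \<sigma> :: 'a \<Rightarrow> complex)"
    by (intro decaying_integrable decaying_profile_multiplier[OF \<sigma>0] \<sigma>)
  have P_int: "integrable lborel P"
    unfolding P_def using t by (subst integrable_lborel_affine) (auto simp: integrable_profile)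
  have mFP: "?m \<xi> * fourier P \<xi> = complex_of_real (t ^ DIM('a) * t powr (- \<sigma>)) *
      (iexp (- (a \<bullet> \<xi>)) * profile_multiplier \<sigma> (0 + t *\<^sub>R \<xi>))" for \<xi>
  proof -
    have "fourier P \<xi> = complex_of_real (t ^ DIM('a)) * iexp (- (a \<bullet> \<xi>)) * fourier ?p (t *\<^sub>R \<xi>)"
      unfolding P_def using t fourier_affine[of ?p "1 / t" "- ((1 / t) *\<^sub>R a)" \<xi>]
      by (simp add: power_divide)
    moreover have "norm \<xi> powr \<sigma> = t powr (- \<sigma>) * norm (t *\<^sub>R \<xi>) powr \<sigma>"
      using t by (simp add: powr_mult powr_minus)
    ultimately show ?thesis by (simp add: profile_multiplier_def mult_ac)
  qed
  have mod_int: "integrable lborel (\<lambda>\<xi>. iexp (- (a \<bullet> \<xi>)) * profile_multiplier \<sigma> (0 + t *\<^sub>R \<xi>))"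
  proof (rule Bochner_Integration.integrable_bound)
    show "integrable lborel (\<lambda>\<xi>::'a. profile_multiplier \<sigma> (0 + t *\<^sub>R \<xi>))"
      using t M_int by (subst integrable_lborel_affine) auto
  qed (auto simp: norm_mult)
  have mFP_int: "integrable lborel (\<lambda>\<xi>. ?m \<xi> * fourier P \<xi>)"
    unfolding mFP using mod_int by (rule integrable_mult_right)
  have \<phi>_smooth: "directionally_smooth b N \<phi>" if "b \<in> Basis" for b N
    using \<phi> that by (rule schwartz_directionally_smooth)
  have \<phi>_int: "integrable lborel \<phi>"
    using \<phi>_smooth nonempty_Basis directionally_smooth_imp_decaying decaying_integrable by blast
  have mF\<phi>_int: "integrable lborel (\<lambda>\<xi>. ?m \<xi> * fourier \<phi> \<xi>)"
    by (rule decaying_integrable[OF decaying_powr_fourier[OF \<phi>_smooth]]) (use \<sigma>0 \<sigma> in auto)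
  have "fourier_inv (\<lambda>\<xi>. ?m \<xi> * fourier P \<xi>) x = complex_of_real (t powr (- \<sigma>) * profile_laplacian \<sigma> ((1 / t) *\<^sub>R (x - a)))" for x
  proof -
    have "fourier_inv (\<lambda>\<xi>. ?m \<xi> * fourier P \<xi>) x = complex_of_real (t ^ DIM('a) * t powr (- \<sigma>)) *
        fourier (\<lambda>\<xi>. profile_multiplier \<sigma> (0 + t *\<^sub>R \<xi>)) (a - x)"
    proof -
      have "iexp (- (\<xi> \<bullet> - x)) * (c * (iexp (- (a \<bullet> \<xi>)) * z)) = c * (iexp (- (\<xi> \<bullet> (a - x))) * z)" for \<xi> c z
        by (simp add: inner_diff_right exp_diff exp_minus divide_inverse inner_commute algebra_simps)
      then have pull: "(LINT \<xi>|lborel. iexp (- (\<xi> \<bullet> - x)) * (complex_of_real (t ^ DIM('a) * t powr (- \<sigma>)) *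
            (iexp (- (a \<bullet> \<xi>)) * profile_multiplier \<sigma> (0 + t *\<^sub>R \<xi>)))) =
          complex_of_real (t ^ DIM('a) * t powr (- \<sigma>)) *
            (LINT \<xi>|lborel. iexp (- (\<xi> \<bullet> (a - x))) * profile_multiplier \<sigma> (0 + t *\<^sub>R \<xi>))"
        by (simp only: integral_mult_right_zero)
      have l: "fourier (\<lambda>\<xi>. complex_of_real (t ^ DIM('a) * t powr (- \<sigma>)) *
            (iexp (- (a \<bullet> \<xi>)) * profile_multiplier \<sigma> (0 + t *\<^sub>R \<xi>))) (- x) =
          complex_of_real ((2 * pi) powr (- real DIM('a) / 2)) *
          (LINT \<xi>|lborel. iexp (- (\<xi> \<bullet> - x)) * (complex_of_real (t ^ DIM('a) * t powr (- \<sigma>)) *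
            (iexp (- (a \<bullet> \<xi>)) * profile_multiplier \<sigma> (0 + t *\<^sub>R \<xi>))))"
        by (rule fourier_lborel) measurable
      have r: "fourier (\<lambda>\<xi>. profile_multiplier \<sigma> (0 + t *\<^sub>R \<xi>)) (a - x) =
          complex_of_real ((2 * pi) powr (- real DIM('a) / 2)) *
          (LINT \<xi>|lborel. iexp (- (\<xi> \<bullet> (a - x))) * profile_multiplier \<sigma> (0 + t *\<^sub>R \<xi>))"
        by (rule fourier_lborel) measurable
      show ?thesis
        unfolding fourier_inv_eq_fourier mFP l r pull by (rule mult.left_commute)
    qed
    also have "fourier (\<lambda>\<xi>. profile_multiplier \<sigma> (0 + t *\<^sub>R \<xi>)) (a - x) =
        complex_of_real (1 / t ^ DIM('a)) * fourier (profile_multiplier \<sigma>) ((1 / t) *\<^sub>R (a - x))"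
      using t fourier_affine[OF borel_measurable_profile_multiplier[OF \<sigma>0], of t 0 "a - x"]
      by (simp add: divide_inverse)
    also have "fourier (profile_multiplier \<sigma>) ((1 / t) *\<^sub>R (a - x)) = complex_of_real (profile_laplacian \<sigma> ((1 / t) *\<^sub>R (x - a)))"
      unfolding profile_laplacian_eq[OF \<sigma>0, symmetric]
      by (intro arg_cong[where f=complex_of_real] profile_laplacian_radial[OF \<sigma>0]) (simp add: norm_minus_commute)
    finally show ?thesis using t by simp
  qed
  then have "(LINT x|lborel. P x * fourier_inv (\<lambda>\<xi>. ?m \<xi> * fourier \<phi> \<xi>) x) =
      (LINT x|lborel. complex_of_real (t powr (- \<sigma>) * profile_laplacian \<sigma> ((1 / t) *\<^sub>R (x - a))) * \<phi> x)"
    using multiplier_duality[OF P_int \<phi>_int _ mFP_int mF\<phi>_int] by simp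
  moreover have "P x = ?p ((1 / t) *\<^sub>R (x - a))" for x
    by (simp add: P_def scaleR_diff_right)
  ultimately show ?thesis by (simp add: frac_laplacian_schwartz_def)
qed

end

section \<open>Truncated logarithms\<close>

text \<open>A regular version of the logarithm of \<open>r / \<bar>x - a\<bar>\<close>, truncated at height
\<open>ln (r / \<epsilon>)\<close>: the measure \<open>dt / t\<close> is invariant under dilations and a dilate of the bump by \<open>t\<close> is
close to \<open>1\<close> for \<open>\<bar>x - a\<bar>\<close> much smaller than \<open>t\<close> and \<open>0\<close> for \<open>\<bar>x - a\<bar> \<ge> t\<close>.\<close>

definition log_bump :: "'a::euclidean_space \<Rightarrow> real \<Rightarrow> real \<Rightarrow> 'a \<Rightarrow> real" where
  "log_bump a \<epsilon> r x = (LINT t|lborel. profile ((1 / t) *\<^sub>R (x - a)) / t * indicator {\<epsilon>..r} t)"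

definition log_bump_laplacian :: "real \<Rightarrow> 'a::euclidean_space \<Rightarrow> real \<Rightarrow> real \<Rightarrow> 'a \<Rightarrow> real" where
  "log_bump_laplacian \<sigma> a \<epsilon> r x =
    (LINT t|lborel. t powr (- \<sigma> - 1) * profile_laplacian \<sigma> ((1 / t) *\<^sub>R (x - a)) * indicator {\<epsilon>..r} t)"

context
  fixes a :: "'a::euclidean_space" and \<epsilon> r :: real
  assumes \<epsilon>: "0 < \<epsilon>" and r: "\<epsilon> < r"
begin

lemma integral_inverse_Icc:
  assumes "0 < c" "c \<le> r"
  shows "integrable lborel (\<lambda>t. 1 / t * indicator {c..r} t)" "(LINT t|lborel. 1 / t * indicator {c..r} t) = ln r - ln c"
proof -
  have "has_bochner_integral lborel (\<lambda>t. 1 / t * indicator {c..r} t) (ln r - ln c)"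
    by (rule has_bochner_integral_FTC_Icc_nonneg) (use assms in \<open>auto intro!: derivative_eq_intros\<close>)
  then show "integrable lborel (\<lambda>t. 1 / t * indicator {c..r} t)" "(LINT t|lborel. 1 / t * indicator {c..r} t) = ln r - ln c"
    by (auto simp: has_bochner_integral_iff)
qed

lemma borel_measurable_log_bump [measurable]: "log_bump a \<epsilon> r \<in> borel_measurable borel"
  unfolding log_bump_def[abs_def] by measurable

lemma integrable_log_bump_integrand:
  "integrable lborel (\<lambda>t. profile ((1 / t) *\<^sub>R (x - a)) / t * indicator {\<epsilon>..r} t)"
proof (rule Bochner_Integration.integrable_bound[OF integral_inverse_Icc(1)[OF \<epsilon> less_imp_le[OF r]]])
  show "AE t in lborel. norm (profile ((1 / t) *\<^sub>R (x - a)) / t * indicator {\<epsilon>..r} t) \<le> norm (1 / t * indicator {\<epsilon>..r} t)"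
  proof (rule AE_I2)
    fix t
    show "norm (profile ((1 / t) *\<^sub>R (x - a)) / t * indicator {\<epsilon>..r} t) \<le> norm (1 / t * indicator {\<epsilon>..r} t)"
      using \<epsilon> profile_nonneg[of "(1 / t) *\<^sub>R (x - a)"] profile_le_1[of "(1 / t) *\<^sub>R (x - a)"]
      by (simp only: norm_mult norm_divide) (intro mult_right_mono divide_right_mono, auto)
  qed
qed measurable

lemma log_bump_nonneg: "0 \<le> log_bump a \<epsilon> r x"
  unfolding log_bump_def
proof (rule Bochner_Integration.integral_nonneg)
  fix t
  show "0 \<le> profile ((1 / t) *\<^sub>R (x - a)) / t * indicator {\<epsilon>..r} t"
    using \<epsilon> profile_nonneg[of "(1 / t) *\<^sub>R (x - a)"] by (cases "t \<in> {\<epsilon>..r}") simp_all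
qed

lemma log_bump_eq_0:
  assumes "r \<le> norm (x - a)"
  shows "log_bump a \<epsilon> r x = 0"
proof -
  have z: "profile ((1 / t) *\<^sub>R (x - a)) / t * indicator {\<epsilon>..r} t = 0" for t
  proof (cases "t \<in> {\<epsilon>..r}")
    case True
    then have "profile ((1 / t) *\<^sub>R (x - a)) = 0" using \<epsilon> assms by (intro profile_scaled_eq_0) auto
    then show ?thesis by simp
  qed simp
  show ?thesis unfolding log_bump_def z by simp
qed

text \<open>Scales \<open>t\<close> below \<open>\<bar>x - a\<bar>\<close> do not contribute, so the integral may be started at \<open>c\<close>.\<close>

lemma log_bump_le_ln_bound:
  assumes c: "\<epsilon> \<le> c" "c \<le> r" "\<epsilon> < c \<Longrightarrow> c \<le> norm (x - a)"
  shows "log_bump a \<epsilon> r x \<le> ln r - ln c"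
proof -
  have c0: "0 < c" using \<epsilon> c by simp
  have "log_bump a \<epsilon> r x \<le> (LINT t|lborel. 1 / t * indicator {c..r} t)"
    unfolding log_bump_def
  proof (rule integral_mono[OF integrable_log_bump_integrand integral_inverse_Icc(1)[OF c0 c(2)]])
    fix t
    consider "t \<in> {\<epsilon>..r}" "c \<le> t" | "t \<in> {\<epsilon>..r}" "t < c" | "t \<notin> {\<epsilon>..r}" by fastforce
    then show "profile ((1 / t) *\<^sub>R (x - a)) / t * indicator {\<epsilon>..r} t \<le> 1 / t * indicator {c..r} t"
    proof cases
      case 1
      then show ?thesis using profile_le_1[of "(1 / t) *\<^sub>R (x - a)"] \<epsilon> by (auto simp: indicator_def intro!: divide_right_mono)
    next
      case 2
      then have "profile ((1 / t) *\<^sub>R (x - a)) = 0" using c \<epsilon> by (intro profile_scaled_eq_0) auto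
      then show ?thesis using 2 by simp
    next
      case 3
      then show ?thesis using c0 by (simp add: indicator_def)
    qed
  qed
  then show ?thesis by (simp only: integral_inverse_Icc(2)[OF c0 c(2)])
qed

lemma log_bump_le: "log_bump a \<epsilon> r x \<le> ln r - ln \<epsilon>"
  using log_bump_le_ln_bound[of \<epsilon> x] r by auto

lemma log_bump_le_ln:
  assumes "0 < norm (x - a)" "norm (x - a) < r"
  shows "log_bump a \<epsilon> r x \<le> ln (r / norm (x - a))"
proof -
  have "log_bump a \<epsilon> r x \<le> ln r - ln (max \<epsilon> (norm (x - a)))"
    using assms r by (intro log_bump_le_ln_bound) auto
  also have "\<dots> \<le> ln r - ln (norm (x - a))" using assms by (intro diff_left_mono ln_mono) auto
  also have "\<dots> = ln (r / norm (x - a))" using assms r \<epsilon> by (simp add: ln_div)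
  finally show ?thesis .
qed

text \<open>Bernoulli's inequality bounds the defect \<open>1 - profile\<close> by a multiple of
\<open>\<bar>x - a\<bar>\<^sup>2 / t\<^sup>2 \<le> \<epsilon> / t\<close>, whose integral against \<open>dt / t\<close> over \<open>t \<ge> \<epsilon>\<close> is bounded.\<close>

lemma log_bump_ge:
  assumes x: "norm (x - a) \<le> \<epsilon>"
  shows "ln (r / \<epsilon>) - real (2 * DIM('a) + 2) \<le> log_bump a \<epsilon> r x"
proof -
  let ?k = "2 * DIM('a) + 2"
  have 1: "has_bochner_integral lborel (\<lambda>t. 1 / t\<^sup>2 * indicator {\<epsilon>..r} t) (- 1 / r - (- 1 / \<epsilon>))"
    by (rule has_bochner_integral_FTC_Icc_nonneg)
      (use \<epsilon> r in \<open>auto intro!: derivative_eq_intros simp: power2_eq_square\<close>)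
  have 2: "has_bochner_integral lborel (\<lambda>t. 1 / t * indicator {\<epsilon>..r} t) (ln r - ln \<epsilon>)"
    using integral_inverse_Icc[OF \<epsilon>] r by (auto simp: has_bochner_integral_iff)
  have 3: "has_bochner_integral lborel (\<lambda>t. 1 / t * indicator {\<epsilon>..r} t - (real ?k * \<epsilon>) * (1 / t\<^sup>2 * indicator {\<epsilon>..r} t))
     ((ln r - ln \<epsilon>) - (real ?k * \<epsilon>) * (- 1 / r - (- 1 / \<epsilon>)))"
    by (intro has_bochner_integral_diff has_bochner_integral_mult_right 1 2) 
  have "(\<epsilon> * (- 1 / r - (- 1 / \<epsilon>))) \<le> 1" using \<epsilon> r by (simp add: field_simps)
  then have "real ?k * (\<epsilon> * (- 1 / r - (- 1 / \<epsilon>))) \<le> real ?k * 1" by (rule mult_left_mono) simp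
  moreover have "ln (r / \<epsilon>) = ln r - ln \<epsilon>" using \<epsilon> r by (simp add: ln_div)
  moreover have "L - k \<le> (R - E) - k * X" if "k * X \<le> k * 1" "L = R - E" for L k R E X :: real
    using that by simp
  ultimately have "ln (r / \<epsilon>) - real ?k \<le> (ln r - ln \<epsilon>) - (real ?k * \<epsilon>) * (- 1 / r - (- 1 / \<epsilon>))"
    unfolding mult.assoc by blast
  also have "\<dots> = (LINT t|lborel. 1 / t * indicator {\<epsilon>..r} t - (real ?k * \<epsilon>) * (1 / t\<^sup>2 * indicator {\<epsilon>..r} t))"
    using 3 by (simp only: has_bochner_integral_integral_eq)
  also have "\<dots> \<le> log_bump a \<epsilon> r x"
    unfolding log_bump_def
  proof (rule integral_mono[OF _ integrable_log_bump_integrand])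
    show "integrable lborel (\<lambda>t. 1 / t * indicator {\<epsilon>..r} t - (real ?k * \<epsilon>) * (1 / t\<^sup>2 * indicator {\<epsilon>..r} t))"
      using 3 by (simp only: has_bochner_integral_iff)
    fix t
    show "1 / t * indicator {\<epsilon>..r} t - (real ?k * \<epsilon>) * (1 / t\<^sup>2 * indicator {\<epsilon>..r} t) \<le>
      profile ((1 / t) *\<^sub>R (x - a)) / t * indicator {\<epsilon>..r} t"
    proof (cases "t \<in> {\<epsilon>..r}")
      case True
      then have t: "0 < t" "\<epsilon> \<le> t" using \<epsilon> by auto
      define y where "y = norm ((1 / t) *\<^sub>R (x - a))"
      have y: "0 \<le> y" "y \<le> \<epsilon> / t" unfolding y_def using x t by (auto intro: divide_right_mono)
      \<comment> \<open>since \<open>y \<le> \<epsilon> / t \<le> 1\<close>, the square may be replaced by \<open>\<epsilon> / t\<close>\<close>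
      have "\<epsilon> / t \<le> 1" using t by simp
      then have "y\<^sup>2 \<le> 1 * (\<epsilon> / t)" unfolding power2_eq_square using y by (intro mult_mono) auto
      then have y2: "y\<^sup>2 \<le> \<epsilon> / t" "y\<^sup>2 \<le> 1" using \<open>\<epsilon> / t \<le> 1\<close> by auto
      have "1 - real ?k * (\<epsilon> / t) \<le> 1 - real ?k * y\<^sup>2"
        using y2(1) by (intro diff_left_mono mult_left_mono) auto
      also have "\<dots> = 1 + real ?k * (- y\<^sup>2)" by simp
      also have "\<dots> \<le> (1 + - y\<^sup>2) ^ ?k" using y2 by (intro Bernoulli_inequality) auto
      also have "\<dots> = profile ((1 / t) *\<^sub>R (x - a))"
        unfolding profile_def bump_def y_def[symmetric] using y2 by (simp add: max_def)
      finally have "(1 - real ?k * (\<epsilon> / t)) / t \<le> profile ((1 / t) *\<^sub>R (x - a)) / t"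
        using t by (intro divide_right_mono) auto
      moreover have "(1 - real ?k * (\<epsilon> / t)) / t = 1 / t - (real ?k * \<epsilon>) * (1 / t\<^sup>2)"
        using t by (simp add: diff_divide_distrib power2_eq_square)
      ultimately show ?thesis using True by simp
    qed simp
  qed
  finally show ?thesis .
qed

lemma integrable_log_bump: "integrable lborel (log_bump a \<epsilon> r)"
proof (rule Bochner_Integration.integrable_bound)
  show "integrable lborel (\<lambda>x::'a. (ln r - ln \<epsilon>) * indicator (ball a r) x)"
    using emeasure_lborel_ball_finite[of a r] by (intro integrable_mult_right integrable_real_indicator) auto
  show "AE x in lborel. norm (log_bump a \<epsilon> r x) \<le> norm ((ln r - ln \<epsilon>) * indicator (ball a r) x)"
  proof (intro AE_I2)
    fix x
    show "norm (log_bump a \<epsilon> r x) \<le> norm ((ln r - ln \<epsilon>) * indicator (ball a r) x)"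
      using log_bump_nonneg[of x] log_bump_le[of x] log_bump_eq_0[of x] \<epsilon> r
      by (cases "x \<in> ball a r") (auto simp: dist_norm norm_minus_commute)
  qed
qed measurable

text \<open>What matters is that the bound does not involve \<open>\<epsilon>\<close>. The logarithm is at most a multiple
of the power \<open>1 / (2 p)\<close>, whose \<open>p\<close>-th power is integrable at the origin in every dimension.\<close>

lemma nn_integral_log_bump_powr_le:
  assumes p: "1 < p"
  shows "(\<integral>\<^sup>+x. ennreal (log_bump a \<epsilon> r x powr p) \<partial>lborel) \<le>
    ennreal (sphere_area TYPE('a) * ((2 * p) powr p * r powr (1 / 2) * r ^ (DIM('a) - 1) * exp r * Gamma (1 / 2)))"
proof -
  have r0: "0 < r" using \<epsilon> r by simp
  define F where "F \<rho> = (2 * p) powr p * r powr (1 / 2) * (\<rho> powr (- 1 / 2) * indicator {..<r} \<rho>)" for \<rho> :: real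
  have [measurable]: "F \<in> borel_measurable borel" unfolding F_def by measurable
  have F_nn: "0 \<le> F \<rho>" for \<rho> by (simp add: F_def)
  have bound: "log_bump a \<epsilon> r x powr p \<le> F (norm (x - a))" if "x \<noteq> a" for x
  proof (cases "norm (x - a) < r")
    case True
    define y where "y = r / norm (x - a)"
    have n: "0 < norm (x - a)" using that by simp
    have y: "0 < y" unfolding y_def using n r0 by simp
    have "ln y = (2 * p) * ln (y powr (1 / (2 * p)))" using y p by (simp add: ln_powr)
    also have "\<dots> \<le> (2 * p) * y powr (1 / (2 * p))"
      using y p ln_le_minus_one[of "y powr (1 / (2 * p))"] by (intro mult_left_mono) auto
    finally have "log_bump a \<epsilon> r x \<le> (2 * p) * y powr (1 / (2 * p))"
      using log_bump_le_ln[OF n True] unfolding y_def by linarith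
    then have "log_bump a \<epsilon> r x powr p \<le> ((2 * p) * y powr (1 / (2 * p))) powr p"
      using log_bump_nonneg p by (intro powr_mono2) auto
    also have "\<dots> = (2 * p) powr p * y powr (1 / 2)"
      using p by (simp add: powr_mult powr_powr)
    also have "y powr (1 / 2) = r powr (1 / 2) * norm (x - a) powr (- 1 / 2)"
      using powr_minus[of "norm (x - a)" "1 / 2"] unfolding y_def powr_divide
      by (simp only: minus_divide_left divide_inverse[of "r powr _"])
    finally show ?thesis using True by (simp add: F_def mult_ac)
  next
    case False
    then show ?thesis using log_bump_eq_0[of x] p F_nn by simp
  qed
  have "(\<integral>\<^sup>+x. ennreal (log_bump a \<epsilon> r x powr p) \<partial>lborel) \<le> (\<integral>\<^sup>+x. ennreal (F (norm (x - a))) \<partial>lborel)"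
    by (rule nn_integral_mono_AE, rule eventually_mono[OF AE_lborel_singleton[of a]]) (intro ennreal_leI bound)
  also have "\<dots> = (\<integral>\<^sup>+x. ennreal (F (norm (x::'a))) \<partial>lborel)"
    using nn_integral_lborel_translation[of "\<lambda>x. ennreal (F (norm x))" "- a"] by simp
  also have "\<dots> = ennreal (sphere_area TYPE('a)) * (\<integral>\<^sup>+\<rho>. ennreal (indicator {0..} \<rho> * \<rho> ^ (DIM('a) - 1)) * ennreal (F \<rho>) \<partial>lborel)"
    by (rule nn_integral_radial) measurable
  also have "(\<integral>\<^sup>+\<rho>. ennreal (indicator {0..} \<rho> * \<rho> ^ (DIM('a) - 1)) * ennreal (F \<rho>) \<partial>lborel) \<le>
      (\<integral>\<^sup>+\<rho>. ennreal ((2 * p) powr p * r powr (1 / 2) * r ^ (DIM('a) - 1) * exp r) *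
         ennreal (indicator {0<..} \<rho> * (\<rho> powr (1 / 2 - 1) * exp (- 1 * \<rho>))) \<partial>lborel)"
  proof (rule nn_integral_mono)
    fix \<rho> :: real
    show "ennreal (indicator {0..} \<rho> * \<rho> ^ (DIM('a) - 1)) * ennreal (F \<rho>) \<le>
      ennreal ((2 * p) powr p * r powr (1 / 2) * r ^ (DIM('a) - 1) * exp r) *
         ennreal (indicator {0<..} \<rho> * (\<rho> powr (1 / 2 - 1) * exp (- 1 * \<rho>)))"
    proof (cases "0 < \<rho> \<and> \<rho> < r")
      case True
      have "\<rho> ^ (DIM('a) - 1) * F \<rho> \<le> r ^ (DIM('a) - 1) * (F \<rho> * (exp r * exp (- \<rho>)))"
        using True F_nn[of \<rho>] by (intro mult_mono power_mono) (auto simp: exp_add[symmetric] mult_le_cancel_left1)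
      also have "\<dots> = (2 * p) powr p * r powr (1 / 2) * r ^ (DIM('a) - 1) * exp r * (\<rho> powr (1 / 2 - 1) * exp (- 1 * \<rho>))"
        using True by (simp add: F_def)
      finally show ?thesis using True F_nn[of \<rho>] by (simp add: ennreal_mult[symmetric] ennreal_leI)
    next
      case False
      then show ?thesis by (auto simp: F_def indicator_def not_less)
    qed
  qed
  also have "\<dots> = ennreal ((2 * p) powr p * r powr (1 / 2) * r ^ (DIM('a) - 1) * exp r) * ennreal (Gamma (1 / 2) * 1 powr (- (1 / 2)))"
  proof -
    have G: "(\<integral>\<^sup>+\<rho>. ennreal (indicator {0<..} \<rho> * (\<rho> powr (1 / 2 - 1) * exp (- 1 * \<rho>))) \<partial>lborel) =
        ennreal (Gamma (1 / 2) * 1 powr (- (1 / 2)))"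
      by (rule nn_integral_Gamma_scaled) auto
    show ?thesis unfolding G[symmetric] by (rule nn_integral_cmult) measurable
  qed
  also have "ennreal (sphere_area TYPE('a)) * \<dots> =
    ennreal (sphere_area TYPE('a) * ((2 * p) powr p * r powr (1 / 2) * r ^ (DIM('a) - 1) * exp r * Gamma (1 / 2)))"
    using sphere_area_pos[where 'a='a] r0 Gamma_real_pos[of "1 / 2"] by (simp add: ennreal_mult[symmetric])
  finally show ?thesis by (simp add: mult_left_mono)
qed

lemma log_bump_in_L_space: "log_bump a \<epsilon> r \<in> L_space s"
proof -
  have int: "integrable lebesgue (log_bump a \<epsilon> r)"
    using integrable_log_bump by (simp add: integrable_completion)
  have "log_bump a \<epsilon> r absolutely_integrable_on K" if "compact K" for K
    unfolding set_integrable_def using that int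
    by (intro integrable_mult_indicator) (auto intro: lmeasurable_compact fmeasurableD)
  moreover have "integrable lebesgue (\<lambda>x::'a. \<bar>log_bump a \<epsilon> r x\<bar> / (1 + norm x powr (real DIM('a) + 2 * s)))"
  proof (rule Bochner_Integration.integrable_bound[OF int])
    show "(\<lambda>x::'a. \<bar>log_bump a \<epsilon> r x\<bar> / (1 + norm x powr (real DIM('a) + 2 * s))) \<in> borel_measurable lebesgue"
      by (intro measurable_completion) simp
    show "AE x::'a in lebesgue. norm (\<bar>log_bump a \<epsilon> r x\<bar> / (1 + norm x powr (real DIM('a) + 2 * s))) \<le> norm (log_bump a \<epsilon> r x)"
    proof (intro AE_I2)
      fix x :: 'a
      have "\<bar>log_bump a \<epsilon> r x\<bar> / (1 + norm x powr (real DIM('a) + 2 * s)) \<le> \<bar>log_bump a \<epsilon> r x\<bar> / 1"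
        by (intro divide_left_mono) (auto simp: add_pos_nonneg)
      then show "norm (\<bar>log_bump a \<epsilon> r x\<bar> / (1 + norm x powr (real DIM('a) + 2 * s))) \<le> norm (log_bump a \<epsilon> r x)"
        by (simp add: add_pos_nonneg abs_of_pos)
    qed
  qed
  ultimately show ?thesis unfolding L_space_def by blast
qed

lemma borel_measurable_log_bump_laplacian:
  assumes "0 < \<sigma>"
  shows "log_bump_laplacian \<sigma> a \<epsilon> r \<in> borel_measurable borel"
proof -
  note [measurable] = borel_measurable_profile_laplacian[OF assms]
  show ?thesis unfolding log_bump_laplacian_def[abs_def] by measurable
qed

text \<open>The duality for a single dilate, integrated over the scales with Fubini's theorem on
both sides.\<close>

lemma has_frac_laplacian_log_bump:
  assumes \<sigma>: "0 < \<sigma>" "\<sigma> \<le> real DIM('a)"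
  shows "has_frac_laplacian (\<sigma> / 2) (log_bump a \<epsilon> r) (log_bump_laplacian \<sigma> a \<epsilon> r)"
  unfolding has_frac_laplacian_def
proof (intro conjI ballI log_bump_in_L_space)
  fix \<phi> :: "'a \<Rightarrow> complex" assume \<phi>: "\<phi> \<in> schwartz"
  note [measurable] = borel_measurable_profile_laplacian[OF \<sigma>(1)] borel_measurable_log_bump_laplacian[OF \<sigma>(1)]
  let ?h = "profile_laplacian \<sigma> :: 'a \<Rightarrow> real"
  let ?L = "frac_laplacian_schwartz (\<sigma> / 2) \<phi>"
  have \<phi>_smooth: "directionally_smooth b N \<phi>" if "b \<in> Basis" for b N
    using \<phi> that by (rule schwartz_directionally_smooth)
  have \<phi>_int: "integrable lborel \<phi>"
    using \<phi>_smooth nonempty_Basis directionally_smooth_imp_decaying decaying_integrable by blast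
  then have [measurable]: "\<phi> \<in> borel_measurable borel" by auto
  have m_int: "integrable lborel (\<lambda>\<xi>. complex_of_real (norm \<xi> powr \<sigma>) * fourier \<phi> \<xi>)"
    by (rule decaying_integrable[OF decaying_powr_fourier[OF \<phi>_smooth]]) (use \<sigma> in auto)
  have L_eq: "?L x = fourier (\<lambda>\<xi>. complex_of_real (norm \<xi> powr \<sigma>) * fourier \<phi> \<xi>) (- x)" for x
    by (simp add: frac_laplacian_schwartz_def fourier_inv_eq_fourier)
  obtain B where B: "0 \<le> B" "\<And>x. norm (?L x) \<le> B"
    using fourier_bounded[OF m_int] unfolding L_eq by blast
  have [measurable]: "?L \<in> borel_measurable borel"
  proof -
    have "fourier (\<lambda>\<xi>. complex_of_real (norm \<xi> powr \<sigma>) * fourier \<phi> \<xi>) \<in> borel_measurable borel"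
      using m_int by (intro borel_measurable_fourier) auto
    then show ?thesis unfolding L_eq[abs_def] by measurable
  qed
  obtain C where C: "0 < C" "\<And>x. \<bar>?h x\<bar> \<le> C"
    using profile_laplacian_bounds[OF \<sigma>] by blast
  have ind_int: "integrable lborel (indicator {\<epsilon>..r} :: real \<Rightarrow> real)"
    using r by (intro integrable_real_indicator) auto
  let ?f1 = "\<lambda>x t. complex_of_real (profile ((1 / t) *\<^sub>R (x - a)) / t * indicator {\<epsilon>..r} t) * ?L x"
  let ?f2 = "\<lambda>x t. complex_of_real (t powr (- \<sigma> - 1) * ?h ((1 / t) *\<^sub>R (x - a)) * indicator {\<epsilon>..r} t) * \<phi> x"
  have int1: "integrable (lborel \<Otimes>\<^sub>M lborel) (\<lambda>(x, t). ?f1 x t)"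
  proof (rule Bochner_Integration.integrable_bound[OF integrable_lborel_pair_mult])
    show "integrable lborel (\<lambda>x. B / \<epsilon> * indicator (ball a r) x)"
      using emeasure_lborel_ball_finite[of a r] by (intro integrable_mult_right integrable_real_indicator) auto
    show "integrable lborel (indicator {\<epsilon>..r} :: real \<Rightarrow> real)" by (rule ind_int)
    show "AE z in lborel \<Otimes>\<^sub>M lborel. norm (case z of (x, t) \<Rightarrow> ?f1 x t) \<le>
        norm (case z of (x, t) \<Rightarrow> B / \<epsilon> * indicator (ball a r) x * indicator {\<epsilon>..r} t)"
    proof (intro AE_I2, clarify)
      fix x t
      show "norm (?f1 x t) \<le> norm (B / \<epsilon> * indicator (ball a r) x * indicator {\<epsilon>..r} t)"
      proof (cases "t \<in> {\<epsilon>..r}")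
        case True
        then have t: "0 < t" "\<epsilon> \<le> t" using \<epsilon> by auto
        show ?thesis
        proof (cases "x \<in> ball a r")
          case x: True
          have "profile ((1 / t) *\<^sub>R (x - a)) / t \<le> 1 / \<epsilon>"
            using profile_nonneg[of "(1 / t) *\<^sub>R (x - a)"] profile_le_1[of "(1 / t) *\<^sub>R (x - a)"] t \<epsilon> by (intro frac_le) auto
          then have "profile ((1 / t) *\<^sub>R (x - a)) / t * norm (?L x) \<le> 1 / \<epsilon> * B"
            using B profile_nonneg[of "(1 / t) *\<^sub>R (x - a)"] t \<epsilon> by (intro mult_mono) auto
          then show ?thesis using x True t B \<epsilon> profile_nonneg[of "(1 / t) *\<^sub>R (x - a)"] by (simp add: norm_mult norm_divide)
        next
          case False
          then have "profile ((1 / t) *\<^sub>R (x - a)) = 0"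
            using True t by (intro profile_scaled_eq_0) (auto simp: dist_norm norm_minus_commute)
          then show ?thesis by simp
        qed
      qed simp
    qed
  qed measurable
  have int2: "integrable (lborel \<Otimes>\<^sub>M lborel) (\<lambda>(x, t). ?f2 x t)"
  proof (rule Bochner_Integration.integrable_bound[OF integrable_lborel_pair_mult])
    show "integrable lborel (\<lambda>x. \<epsilon> powr (- \<sigma> - 1) * C * norm (\<phi> x))"
      using \<phi>_int by (intro integrable_mult_right integrable_norm)
    show "integrable lborel (indicator {\<epsilon>..r} :: real \<Rightarrow> real)" by (rule ind_int)
    show "AE z in lborel \<Otimes>\<^sub>M lborel. norm (case z of (x, t) \<Rightarrow> ?f2 x t) \<le>
        norm (case z of (x, t) \<Rightarrow> \<epsilon> powr (- \<sigma> - 1) * C * norm (\<phi> x) * indicator {\<epsilon>..r} t)"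
    proof (intro AE_I2, clarify)
      fix x t
      show "norm (?f2 x t) \<le> norm (\<epsilon> powr (- \<sigma> - 1) * C * norm (\<phi> x) * indicator {\<epsilon>..r} t)"
      proof (cases "t \<in> {\<epsilon>..r}")
        case True
        then have "t powr (- \<sigma> - 1) \<le> \<epsilon> powr (- \<sigma> - 1)" using \<epsilon> \<sigma> by (intro powr_mono2') auto
        then have "t powr (- \<sigma> - 1) * \<bar>?h ((1 / t) *\<^sub>R (x - a))\<bar> * norm (\<phi> x) \<le> \<epsilon> powr (- \<sigma> - 1) * C * norm (\<phi> x)"
          using C by (intro mult_right_mono mult_mono) auto
        then show ?thesis using True C by (simp add: norm_mult abs_mult)
      qed simp
    qed
  qed measurable
  have g_eq: "(LINT t|lborel. ?f2 x t) = complex_of_real (log_bump_laplacian \<sigma> a \<epsilon> r x) * \<phi> x" for x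
    unfolding log_bump_laplacian_def by (simp only: integral_mult_left_zero integral_complex_of_real)
  have u_eq: "(LINT t|lborel. ?f1 x t) = complex_of_real (log_bump a \<epsilon> r x) * ?L x" for x
    unfolding log_bump_def by (simp only: integral_mult_left_zero integral_complex_of_real)
  have "integrable lborel (\<lambda>x. LINT t|lborel. ?f2 x t)"
    using lborel_pair.integrable_fst[OF int2] by simp
  then have gi: "integrable lborel (\<lambda>x. complex_of_real (log_bump_laplacian \<sigma> a \<epsilon> r x) * \<phi> x)"
    unfolding g_eq .
  then show "integrable lebesgue (\<lambda>x. complex_of_real (log_bump_laplacian \<sigma> a \<epsilon> r x) * \<phi> x)"
    by (subst integrable_completion) auto
  have slice: "(LINT x|lborel. ?f1 x t) = (LINT x|lborel. ?f2 x t)" for t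
  proof (cases "t \<in> {\<epsilon>..r}")
    case True
    then have t: "0 < t" using \<epsilon> by auto
    have "(LINT x|lborel. ?f1 x t) = complex_of_real (1 / t) *
        (LINT x|lborel. complex_of_real (profile ((1 / t) *\<^sub>R (x - a))) * ?L x)"
      using True by (subst integral_mult_right_zero[symmetric]) (simp add: mult_ac)
    also have "\<dots> = complex_of_real (1 / t) *
        (LINT x|lborel. complex_of_real (t powr (- \<sigma>) * ?h ((1 / t) *\<^sub>R (x - a))) * \<phi> x)"
      using profile_duality[OF \<sigma> t \<phi>] by simp
    also have "\<dots> = (LINT x|lborel. ?f2 x t)"
    proof (subst integral_mult_right_zero[symmetric], rule Bochner_Integration.integral_cong[OF refl])
      fix x
      have "t powr (- \<sigma> - 1) = 1 / t * t powr (- \<sigma>)" using t by (simp add: powr_diff)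
      then show "complex_of_real (1 / t) * (complex_of_real (t powr (- \<sigma>) * ?h ((1 / t) *\<^sub>R (x - a))) * \<phi> x) = ?f2 x t"
        using True by simp
    qed
    finally show ?thesis .
  qed simp
  have "frac_laplacian (\<sigma> / 2) (log_bump a \<epsilon> r) \<phi> = (LINT x|lborel. complex_of_real (log_bump a \<epsilon> r x) * ?L x)"
    unfolding frac_laplacian_def by (subst integral_completion) auto
  also have "\<dots> = (LINT t|lborel. LINT x|lborel. ?f1 x t)"
    unfolding u_eq[symmetric] by (rule lborel_pair.Fubini_integral[OF int1, symmetric])
  also have "\<dots> = (LINT x|lborel. LINT t|lborel. ?f2 x t)"
    unfolding slice by (rule lborel_pair.Fubini_integral[OF int2])
  also have "\<dots> = (LINT x|lebesgue. complex_of_real (log_bump_laplacian \<sigma> a \<epsilon> r x) * \<phi> x)"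
    unfolding g_eq by (subst integral_completion) auto
  finally show "frac_laplacian (\<sigma> / 2) (log_bump a \<epsilon> r) \<phi> =
    (LINT x|lebesgue. complex_of_real (log_bump_laplacian \<sigma> a \<epsilon> r x) * \<phi> x)" .
qed

end

section \<open>The sharp bound for the fractional Laplacian of a truncated logarithm\<close>

text \<open>An arbitrary direction in which radial functions are evaluated.\<close>

definition unit_vector :: "'a::euclidean_space" where
  "unit_vector = (SOME b. b \<in> Basis)"

lemma norm_unit_vector: "norm (unit_vector :: 'a::euclidean_space) = 1"
proof -
  have "(unit_vector :: 'a) \<in> Basis" unfolding unit_vector_def using nonempty_Basis by (simp add: some_in_eq)
  then show ?thesis by simp
qed

text \<open>The coefficient \<open>K\<close> in \<open>K \<rho>\<^sup>-\<^sup>\<sigma>\<close>, the fractional Laplacian of the untruncated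
superposition of all dilates of the bump.\<close>

definition profile_moment :: "'a::euclidean_space itself \<Rightarrow> real \<Rightarrow> real" where
  "profile_moment _ \<sigma> = (LINT s|lborel. indicator {0<..} s * (s powr (\<sigma> - 1) * profile_laplacian \<sigma> (s *\<^sub>R (unit_vector :: 'a))))"

context
  fixes \<sigma> :: real
  assumes \<sigma>0: "0 < \<sigma>"
begin

lemma profile_laplacian_ray:
  "0 < t \<Longrightarrow> profile_laplacian \<sigma> ((1 / t) *\<^sub>R x) = profile_laplacian \<sigma> ((norm x / t) *\<^sub>R (unit_vector :: 'a))" for x :: "'a::euclidean_space"
  by (rule profile_laplacian_radial[OF \<sigma>0]) (simp add: norm_unit_vector)

text \<open>The Riesz potential at the origin in polar coordinates.\<close>

lemma
  assumes \<sigma>: "\<sigma> < real DIM('a::euclidean_space)"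
  shows integrable_profile_moment: "integrable lborel (\<lambda>s. indicator {0<..} s * (s powr (\<sigma> - 1) * profile_laplacian \<sigma> (s *\<^sub>R (unit_vector :: 'a))))" (is ?I)
    and profile_moment_eq: "sphere_area TYPE('a) * profile_moment TYPE('a) \<sigma> =
      2 powr \<sigma> * pi powr (real DIM('a) / 2) * Gamma (\<sigma> / 2) / Gamma ((real DIM('a) - \<sigma>) / 2)" (is ?E)
proof -
  note [measurable] = borel_measurable_profile_laplacian[OF \<sigma>0]
  define F where "F s = s powr (\<sigma> - real DIM('a)) * profile_laplacian \<sigma> (s *\<^sub>R (unit_vector :: 'a))" for s
  have [measurable]: "F \<in> borel_measurable borel" unfolding F_def by measurable
  have 1: "norm x powr (\<sigma> - real DIM('a)) * profile_laplacian \<sigma> x = F (norm x)" for x :: 'a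
    using profile_laplacian_ray[of 1 x] by (simp add: F_def)
  have 2: "indicator {0..} s * s ^ (DIM('a) - 1) * F s =
      indicator {0<..} s * (s powr (\<sigma> - 1) * profile_laplacian \<sigma> (s *\<^sub>R (unit_vector :: 'a)))" for s :: real
  proof (cases "0 < s")
    case True
    have "s ^ (DIM('a) - 1) * s powr (\<sigma> - real DIM('a)) = s powr (real (DIM('a) - 1) + (\<sigma> - real DIM('a)))"
      by (simp only: powr_add powr_realpow[OF True])
    also have "real (DIM('a) - 1) + (\<sigma> - real DIM('a)) = \<sigma> - 1"
      using DIM_positive[where 'a='a] by (simp add: of_nat_diff)
    finally show ?thesis using True by (simp add: F_def mult.assoc[symmetric])
  next
    case False
    then have "s = 0 \<or> s \<notin> {0..}" by auto
    then show ?thesis by (auto simp: F_def)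
  qed
  show ?I
    using integrable_riesz_profile_laplacian[OF \<sigma>0 \<sigma>] integrable_radial_iff[of F, where 'a='a] unfolding 1 2 by simp
  show ?E
    using integral_riesz_profile_laplacian[OF \<sigma>0 \<sigma>] integral_radial[of F, where 'a='a]
    unfolding 1 2 profile_moment_def by simp
qed

text \<open>The substitution \<open>s = \<bar>x\<bar> / t\<close> and the radial symmetry of \<open>h\<close>. This is the
integral over all scales, of which the truncated logarithm keeps the part between \<open>\<epsilon>\<close> and \<open>r\<close>.\<close>

lemma
  assumes \<sigma>: "\<sigma> < real DIM('a::euclidean_space)" and x: "x \<noteq> (0::'a)"
  shows integrable_dilations: "integrable lborel (\<lambda>t. indicator {0<..} t * (t powr (- \<sigma> - 1) * profile_laplacian \<sigma> ((1 / t) *\<^sub>R x)))" (is ?I)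
    and integral_dilations: "(LINT t|lborel. indicator {0<..} t * (t powr (- \<sigma> - 1) * profile_laplacian \<sigma> ((1 / t) *\<^sub>R x))) =
      norm x powr (- \<sigma>) * profile_moment TYPE('a) \<sigma>" (is ?E)
proof -
  note [measurable] = borel_measurable_profile_laplacian[OF \<sigma>0]
  define \<rho> where "\<rho> = norm x"
  have \<rho>: "0 < \<rho>" using x by (simp add: \<rho>_def)
  define f where "f s = s powr (\<sigma> - 1) * profile_laplacian \<sigma> (s *\<^sub>R (unit_vector :: 'a))" for s
  have [measurable]: "f \<in> borel_measurable borel" unfolding f_def by measurable
  have f_int: "set_integrable lborel {0<..} f"
    using integrable_profile_moment[OF \<sigma>] by (simp add: set_integrable_def f_def)
  have f_abs: "f absolutely_integrable_on {0<..}"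
    using f_int unfolding set_integrable_def by (subst integrable_completion) auto
  have f_eq: "integral {0<..} f = profile_moment TYPE('a) \<sigma>"
    using set_borel_integral_eq_integral(2)[OF f_int] by (simp add: profile_moment_def set_lebesgue_integral_def f_def)
  have img: "(\<lambda>t. \<rho> / t) ` {0<..} = {0<..}"
  proof
    show "{0<..} \<subseteq> (\<lambda>t. \<rho> / t) ` {0<..}"
    proof
      fix y :: real assume "y \<in> {0<..}"
      then have "y = \<rho> / (\<rho> / y)" "\<rho> / y \<in> {0<..}" using \<rho> by auto
      then show "y \<in> (\<lambda>t. \<rho> / t) ` {0<..}" by blast
    qed
  qed (use \<rho> in auto)
  let ?g = "\<lambda>t. \<bar>- \<rho> / t\<^sup>2\<bar> *\<^sub>R f (\<rho> / t)"
  have "?g absolutely_integrable_on {0<..} \<and> integral {0<..} ?g = profile_moment TYPE('a) \<sigma> \<longleftrightarrow>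
      f absolutely_integrable_on (\<lambda>t. \<rho> / t) ` {0<..} \<and> integral ((\<lambda>t. \<rho> / t) ` {0<..}) f = profile_moment TYPE('a) \<sigma>"
  proof (rule has_absolute_integral_change_of_variables_real)
    show "((\<lambda>t. \<rho> / t) has_real_derivative - \<rho> / t\<^sup>2) (at t within {0<..})" if "t \<in> {0<..}" for t
      using that by (auto intro!: derivative_eq_intros simp: power2_eq_square)
    show "inj_on ((/) \<rho>) {0<..}" using \<rho> by (auto simp: inj_on_def)
  qed auto
  then have g: "?g absolutely_integrable_on {0<..}" "integral {0<..} ?g = profile_moment TYPE('a) \<sigma>"
    unfolding img using f_abs f_eq by auto
  have g_set: "set_integrable lborel {0<..} ?g"
    using g(1) unfolding set_integrable_def by (subst (asm) integrable_completion) auto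
  have eq: "indicator {0<..} t *\<^sub>R ?g t = \<rho> powr \<sigma> * (indicator {0<..} t * (t powr (- \<sigma> - 1) * profile_laplacian \<sigma> ((1 / t) *\<^sub>R x)))" for t
  proof (cases "0 < t")
    case True
    have "\<bar>- \<rho> / t\<^sup>2\<bar> * (\<rho> / t) powr (\<sigma> - 1) = \<rho> powr \<sigma> * t powr (- \<sigma> - 1)"
    proof -
      have "\<bar>- \<rho> / t\<^sup>2\<bar> = \<rho> powr 1 * t powr (- 2)"
        using \<rho> True by (simp add: powr_minus divide_inverse)
      moreover have "(\<rho> / t) powr (\<sigma> - 1) = \<rho> powr (\<sigma> - 1) * t powr (- (\<sigma> - 1))"
        unfolding powr_divide powr_minus by (simp only: divide_inverse)
      ultimately have "\<bar>- \<rho> / t\<^sup>2\<bar> * (\<rho> / t) powr (\<sigma> - 1) =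
          (\<rho> powr 1 * \<rho> powr (\<sigma> - 1)) * (t powr (- 2) * t powr (- (\<sigma> - 1)))"
        by (simp only: mult_ac)
      also have "\<rho> powr 1 * \<rho> powr (\<sigma> - 1) = \<rho> powr \<sigma>"
        unfolding powr_add[symmetric] by simp
      also have "t powr (- 2) * t powr (- (\<sigma> - 1)) = t powr (- \<sigma> - 1)"
        unfolding powr_add[symmetric] by (rule arg_cong[where f="(powr) t"]) simp
      finally show ?thesis .
    qed
    then show ?thesis
      using True profile_laplacian_ray[OF True, of x] by (simp add: f_def \<rho>_def[symmetric] mult.assoc[symmetric])
  qed simp
  have ginv: "indicator {0<..} t * (t powr (- \<sigma> - 1) * profile_laplacian \<sigma> ((1 / t) *\<^sub>R x)) = \<rho> powr (- \<sigma>) * (indicator {0<..} t *\<^sub>R ?g t)" for t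
    unfolding eq using \<rho> by (simp add: mult.assoc[symmetric] powr_add[symmetric])
  have gi: "integrable lborel (\<lambda>t. indicator {0<..} t *\<^sub>R ?g t)"
    using g_set unfolding set_integrable_def .
  show ?I unfolding ginv using gi by (rule integrable_mult_right)
  have "(LINT t|lborel. indicator {0<..} t *\<^sub>R ?g t) = profile_moment TYPE('a) \<sigma>"
    using set_borel_integral_eq_integral(2)[OF g_set] g(2) unfolding set_lebesgue_integral_def by simp
  then show ?E unfolding ginv \<rho>_def[symmetric] by (simp only: integral_mult_right_zero)
qed

text \<open>Contributions of the scales below and above \<open>c\<close>. At small scales the argument of \<open>h\<close> is
large and its decay is used; at large scales its boundedness suffices.\<close>

lemma
  fixes x :: "'a::euclidean_space"
  assumes C: "0 < C" "\<And>x::'a. \<bar>profile_laplacian \<sigma> x\<bar> \<le> C"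
      "\<And>x::'a. x \<noteq> 0 \<Longrightarrow> \<bar>profile_laplacian \<sigma> x\<bar> \<le> C * norm x powr (- \<sigma> - real DIM('a))"
    and x: "x \<noteq> 0" and c: "0 < c"
  shows dilation_integral_small: "A \<subseteq> {0<..c} \<Longrightarrow>
      \<bar>LINT t|lborel. t powr (- \<sigma> - 1) * profile_laplacian \<sigma> ((1 / t) *\<^sub>R x) * indicator A t\<bar> \<le>
        C / real DIM('a) * (norm x powr (- \<sigma>) * (c / norm x) powr real DIM('a))"
    and dilation_integral_large: "A \<subseteq> {c..} \<Longrightarrow>
      \<bar>LINT t|lborel. t powr (- \<sigma> - 1) * profile_laplacian \<sigma> ((1 / t) *\<^sub>R x) * indicator A t\<bar> \<le> C / \<sigma> * c powr (- \<sigma>)"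
proof -
  let ?n = "real DIM('a)"
  let ?q = "\<lambda>A t. t powr (- \<sigma> - 1) * profile_laplacian \<sigma> ((1 / t) *\<^sub>R x) * indicator A t"
  have n: "0 < ?n" by simp
  show "\<bar>LINT t|lborel. ?q A t\<bar> \<le> C / ?n * (norm x powr (- \<sigma>) * (c / norm x) powr ?n)" if A: "A \<subseteq> {0<..c}"
  proof -
    define B where "B = C * norm x powr (- \<sigma> - ?n)"
    have B: "0 \<le> B" using C(1) by (simp add: B_def)
    have "norm (LINT t|lborel. ?q A t) \<le> B * (c ^ DIM('a) / ?n)"
    proof (rule norm_integral_le_nn_integral)
      show "norm (?q A t) \<le> B * t ^ (DIM('a) - 1) * indicator {0..c} t" for t
      proof (cases "t \<in> A")
        case True
        then have t: "0 < t" "t \<le> c" using A by auto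
        have "norm ((1 / t) *\<^sub>R x) = norm x / t" using t by simp
        then have "\<bar>profile_laplacian \<sigma> ((1 / t) *\<^sub>R x)\<bar> \<le> C * (norm x / t) powr (- \<sigma> - ?n)"
          using C(3)[of "(1 / t) *\<^sub>R x"] t x by simp
        then have "t powr (- \<sigma> - 1) * \<bar>profile_laplacian \<sigma> ((1 / t) *\<^sub>R x)\<bar> \<le> t powr (- \<sigma> - 1) * (C * (norm x / t) powr (- \<sigma> - ?n))"
          by (intro mult_left_mono) auto
        also have "(norm x / t) powr (- \<sigma> - ?n) = norm x powr (- \<sigma> - ?n) * t powr (\<sigma> + ?n)"
        proof -
          have "(norm x / t) powr (- \<sigma> - ?n) = norm x powr (- \<sigma> - ?n) * t powr (- (- \<sigma> - ?n))"
            unfolding powr_divide powr_minus by (simp only: divide_inverse)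
          then show ?thesis by (simp add: add.commute)
        qed
        also have "t powr (- \<sigma> - 1) * (C * (norm x powr (- \<sigma> - ?n) * t powr (\<sigma> + ?n))) =
            B * (t powr (- \<sigma> - 1) * t powr (\<sigma> + ?n))" by (simp add: B_def)
        also have "t powr (- \<sigma> - 1) * t powr (\<sigma> + ?n) = t powr (real (DIM('a) - 1))"
          unfolding powr_add[symmetric] by (rule arg_cong[where f="(powr) t"]) (simp add: of_nat_diff)
        also have "t powr (real (DIM('a) - 1)) = t ^ (DIM('a) - 1)" using t by (simp only: powr_realpow)
        finally show ?thesis using True t by (simp add: abs_mult)
      qed (use B in \<open>simp add: indicator_def\<close>)
      have "(\<integral>\<^sup>+t. ennreal (B * t ^ (DIM('a) - 1)) * indicator {0..c} t \<partial>lborel) =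
          ennreal (B * (c ^ DIM('a) / ?n) - B * (0 ^ DIM('a) / ?n))"
      proof (rule nn_integral_FTC_Icc[where F="\<lambda>t. B * (t ^ DIM('a) / ?n)"])
        show "((\<lambda>t. B * (t ^ DIM('a) / ?n)) has_real_derivative B * t ^ (DIM('a) - 1)) (at t)" for t
          by (auto intro!: derivative_eq_intros)
      qed (use B c in auto)
      moreover have "(\<integral>\<^sup>+t. ennreal (B * t ^ (DIM('a) - 1) * indicator {0..c} t) \<partial>lborel) =
          (\<integral>\<^sup>+t. ennreal (B * t ^ (DIM('a) - 1)) * indicator {0..c} t \<partial>lborel)"
        by (intro nn_integral_cong) (auto simp: indicator_def)
      ultimately show "(\<integral>\<^sup>+t. ennreal (B * t ^ (DIM('a) - 1) * indicator {0..c} t) \<partial>lborel) \<le> ennreal (B * (c ^ DIM('a) / ?n))"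
        by (simp add: zero_power)
      show "0 \<le> B * (c ^ DIM('a) / ?n)" using B c by simp
    qed
    also have "B * (c ^ DIM('a) / ?n) = C / ?n * (norm x powr (- \<sigma>) * (c / norm x) powr ?n)"
    proof -
      have "norm x powr (- \<sigma> - ?n) = norm x powr (- \<sigma>) / norm x powr ?n" by (simp only: powr_diff)
      then show ?thesis unfolding B_def powr_divide using c by (simp add: powr_realpow mult_ac)
    qed
    finally show ?thesis by simp
  qed
  show "\<bar>LINT t|lborel. ?q A t\<bar> \<le> C / \<sigma> * c powr (- \<sigma>)" if A: "A \<subseteq> {c..}"
  proof -
    have "norm (LINT t|lborel. ?q A t) \<le> C / \<sigma> * c powr (- \<sigma>)"
    proof (rule norm_integral_le_nn_integral)
      show "norm (?q A t) \<le> C * t powr (- \<sigma> - 1) * indicator {c..} t" for t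
      proof (cases "t \<in> A")
        case True
        then have "t \<in> {c..}" using A by auto
        then show ?thesis using True mult_left_mono[OF C(2)[of "(1 / t) *\<^sub>R x"], of "t powr (- \<sigma> - 1)"]
          by (simp add: abs_mult mult.commute[of C])
      qed (use C(1) in \<open>simp add: indicator_def\<close>)
      have "(\<integral>\<^sup>+t. ennreal (C * t powr (- \<sigma> - 1)) * indicator {c..} t \<partial>lborel) = ennreal (0 - (- (C / \<sigma>) * c powr (- \<sigma>)))"
      proof (rule nn_integral_FTC_atLeast)
        show "DERIV (\<lambda>t. - (C / \<sigma>) * t powr (- \<sigma>)) t :> C * t powr (- \<sigma> - 1)" if "c \<le> t" for t
          using that c \<sigma>0 by (auto intro!: derivative_eq_intros)
        have "((\<lambda>t::real. t powr (- \<sigma>)) \<longlongrightarrow> 0) at_top"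
          using \<sigma>0 by (intro tendsto_neg_powr filterlim_ident) auto
        then show "((\<lambda>t. - (C / \<sigma>) * t powr (- \<sigma>)) \<longlongrightarrow> 0) at_top"
          using tendsto_mult_right_zero by blast
      qed (use C(1) in auto)
      moreover have "(\<integral>\<^sup>+t. ennreal (C * t powr (- \<sigma> - 1) * indicator {c..} t) \<partial>lborel) =
          (\<integral>\<^sup>+t. ennreal (C * t powr (- \<sigma> - 1)) * indicator {c..} t \<partial>lborel)"
        by (intro nn_integral_cong) (auto simp: indicator_def)
      ultimately show "(\<integral>\<^sup>+t. ennreal (C * t powr (- \<sigma> - 1) * indicator {c..} t) \<partial>lborel) \<le> ennreal (C / \<sigma> * c powr (- \<sigma>))"
        by simp
      show "0 \<le> C / \<sigma> * c powr (- \<sigma>)" using C(1) \<sigma>0 by simp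
    qed
    then show ?thesis by simp
  qed
qed

text \<open>The three bounds are meant for \<open>\<rho> \<le> \<epsilon>\<close>, for \<open>\<rho> \<ge> r\<close> and for the range in between,
although each of them holds everywhere. The last one subtracts the missing scales from the complete
integral, so that the leading coefficient is exact.\<close>

lemma log_bump_laplacian_pointwise:
  fixes x a :: "'a::euclidean_space"
  assumes C: "0 < C" "\<And>x::'a. \<bar>profile_laplacian \<sigma> x\<bar> \<le> C"
      "\<And>x::'a. x \<noteq> 0 \<Longrightarrow> \<bar>profile_laplacian \<sigma> x\<bar> \<le> C * norm x powr (- \<sigma> - real DIM('a))"
    and \<sigma>: "\<sigma> < real DIM('a)" and \<epsilon>: "0 < \<epsilon>" "\<epsilon> < r" and x: "x \<noteq> a"
  defines "\<rho> \<equiv> norm (x - a)"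
  shows "\<bar>log_bump_laplacian \<sigma> a \<epsilon> r x\<bar> \<le> C / \<sigma> * \<epsilon> powr (- \<sigma>)"
    and "\<bar>log_bump_laplacian \<sigma> a \<epsilon> r x\<bar> \<le> \<rho> powr (- \<sigma>) * (C / real DIM('a) * (r / \<rho>) powr real DIM('a))"
    and "\<bar>log_bump_laplacian \<sigma> a \<epsilon> r x\<bar> \<le> \<rho> powr (- \<sigma>) *
      (\<bar>profile_moment TYPE('a) \<sigma>\<bar> + (C / real DIM('a) * (\<epsilon> / \<rho>) powr real DIM('a) + C / \<sigma> * (\<rho> / r) powr \<sigma>))"
proof -
  have xa: "x - a \<noteq> 0" using x by simp
  have r0: "0 < r" using \<epsilon> by simp
  have \<rho>: "0 < \<rho>" using x by (simp add: \<rho>_def)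
  let ?n = "real DIM('a)"
  let ?q = "\<lambda>A t. t powr (- \<sigma> - 1) * profile_laplacian \<sigma> ((1 / t) *\<^sub>R (x - a)) * indicator A t"
  show "\<bar>log_bump_laplacian \<sigma> a \<epsilon> r x\<bar> \<le> C / \<sigma> * \<epsilon> powr (- \<sigma>)"
    unfolding log_bump_laplacian_def by (rule dilation_integral_large[OF C xa \<epsilon>(1)]) auto
  have "\<bar>log_bump_laplacian \<sigma> a \<epsilon> r x\<bar> \<le> C / ?n * (\<rho> powr (- \<sigma>) * (r / \<rho>) powr ?n)"
    unfolding log_bump_laplacian_def \<rho>_def by (rule dilation_integral_small[OF C xa r0]) (use \<epsilon> in auto)
  then show "\<bar>log_bump_laplacian \<sigma> a \<epsilon> r x\<bar> \<le> \<rho> powr (- \<sigma>) * (C / ?n * (r / \<rho>) powr ?n)"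
    by (simp only: mult.left_commute)
  have int: "integrable lborel (?q {0<..})"
    using integrable_dilations[OF \<sigma> xa] by (simp add: mult_ac)
  have int_sub: "integrable lborel (?q A)" if "A \<in> sets borel" "A \<subseteq> {0<..}" for A
  proof -
    have "integrable lborel (\<lambda>t. indicator A t *\<^sub>R ?q {0<..} t)"
      using that(1) int by (intro integrable_mult_indicator) auto
    moreover have ind: "indicator A t *\<^sub>R ?q {0<..} t = ?q A t" for t
      using that(2) by (auto simp: indicator_def)
    ultimately show ?thesis unfolding ind by simp
  qed
  have split: "?q {\<epsilon>..r} t = ?q {0<..} t - ?q {0<..<\<epsilon>} t - ?q {r<..} t" for t
    using \<epsilon> by (auto simp: indicator_def)
  have "log_bump_laplacian \<sigma> a \<epsilon> r x = (LINT t|lborel. ?q {0<..} t - ?q {0<..<\<epsilon>} t - ?q {r<..} t)"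
    unfolding log_bump_laplacian_def split ..
  also have "\<dots> = (LINT t|lborel. ?q {0<..} t) - (LINT t|lborel. ?q {0<..<\<epsilon>} t) - (LINT t|lborel. ?q {r<..} t)"
  proof -
    have i: "integrable lborel (?q {0<..})" "integrable lborel (?q {0<..<\<epsilon>})" "integrable lborel (?q {r<..})"
      using r0 by (auto intro!: int_sub)
    show ?thesis
      unfolding Bochner_Integration.integral_diff[OF Bochner_Integration.integrable_diff[OF i(1,2)] i(3)]
        Bochner_Integration.integral_diff[OF i(1,2)] ..
  qed
  also have "(LINT t|lborel. ?q {0<..} t) = \<rho> powr (- \<sigma>) * profile_moment TYPE('a) \<sigma>"
    using integral_dilations[OF \<sigma> xa] by (simp add: mult_ac \<rho>_def)
  finally have "\<bar>log_bump_laplacian \<sigma> a \<epsilon> r x\<bar> \<le> \<bar>\<rho> powr (- \<sigma>) * profile_moment TYPE('a) \<sigma>\<bar> +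
      \<bar>LINT t|lborel. ?q {0<..<\<epsilon>} t\<bar> + \<bar>LINT t|lborel. ?q {r<..} t\<bar>" by linarith
  moreover have "\<bar>LINT t|lborel. ?q {0<..<\<epsilon>} t\<bar> \<le> C / ?n * (\<rho> powr (- \<sigma>) * (\<epsilon> / \<rho>) powr ?n)"
    unfolding \<rho>_def by (rule dilation_integral_small[OF C xa \<epsilon>(1)]) auto
  moreover have "\<bar>LINT t|lborel. ?q {r<..} t\<bar> \<le> C / \<sigma> * r powr (- \<sigma>)"
    by (rule dilation_integral_large[OF C xa r0]) auto
  moreover have "r powr (- \<sigma>) = \<rho> powr (- \<sigma>) * (\<rho> / r) powr \<sigma>"
    unfolding powr_divide powr_minus using \<rho> by (simp add: divide_inverse)
  ultimately show "\<bar>log_bump_laplacian \<sigma> a \<epsilon> r x\<bar> \<le> \<rho> powr (- \<sigma>) *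
      (\<bar>profile_moment TYPE('a) \<sigma>\<bar> + (C / ?n * (\<epsilon> / \<rho>) powr ?n + C / \<sigma> * (\<rho> / r) powr \<sigma>))"
    by (simp add: abs_mult distrib_left mult_ac)
qed

end

lemma profile_moment_pos:
  assumes \<sigma>: "0 < \<sigma>" "\<sigma> < real DIM('a::euclidean_space)"
  shows "0 < profile_moment TYPE('a) \<sigma>"
proof -
  have "0 < sphere_area TYPE('a) * profile_moment TYPE('a) \<sigma>"
    unfolding profile_moment_eq[OF \<sigma>] using \<sigma>
    by (intro divide_pos_pos mult_pos_pos Gamma_real_pos) auto
  then show ?thesis using sphere_area_pos[where 'a='a] by (simp add: zero_less_mult_iff)
qed

text \<open>In polar coordinates the leading term is \<open>K\<^sup>p\<close> times the integral of \<open>1 / \<rho>\<close> from \<open>\<epsilon>\<close> to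
\<open>r\<close>, because \<open>\<sigma> p = n\<close>. All other contributions are invariant under simultaneous scaling of \<open>\<rho>\<close>, \<open>\<epsilon>\<close>
and \<open>r\<close> and converge at the respective end, hence are bounded uniformly.\<close>

lemma nn_integral_log_bump_laplacian_powr_le:
  assumes p: "1 < p" and \<sigma>p: "\<sigma> * p = real DIM('a::euclidean_space)"
  shows "\<exists>D\<ge>0. \<forall>(a::'a) \<epsilon> r. 0 < \<epsilon> \<longrightarrow> \<epsilon> < r \<longrightarrow>
    (\<integral>\<^sup>+x. ennreal (\<bar>log_bump_laplacian \<sigma> a \<epsilon> r x\<bar> powr p) \<partial>lborel) \<le>
      ennreal (sphere_area TYPE('a) * (profile_moment TYPE('a) \<sigma> powr p * ln (r / \<epsilon>)) + D)"
proof -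
  let ?n = "real DIM('a)"
  have n: "0 < ?n" by simp
  have \<sigma>0: "0 < \<sigma>" using \<sigma>p n p by (metis zero_less_mult_pos2 less_trans zero_less_one)
  have \<sigma>n: "\<sigma> < ?n" unfolding \<sigma>p[symmetric] using \<sigma>0 p by simp
  define K where "K = profile_moment TYPE('a) \<sigma>"
  have K: "0 < K" unfolding K_def by (rule profile_moment_pos[OF \<sigma>0 \<sigma>n])
  obtain C where C: "0 < C" "\<And>x::'a. \<bar>profile_laplacian \<sigma> x\<bar> \<le> C"
    "\<And>x::'a. x \<noteq> 0 \<Longrightarrow> \<bar>profile_laplacian \<sigma> x\<bar> \<le> C * norm x powr (- \<sigma> - ?n)"
    using profile_laplacian_bounds[OF \<sigma>0 less_imp_le[OF \<sigma>n]] by blast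
  define S where "S = sphere_area TYPE('a)"
  have S: "0 < S" unfolding S_def by (rule sphere_area_pos)
  define A B where "A = C / ?n" and "B = C / \<sigma>"
  have AB: "0 < A" "0 < B" using C(1) \<sigma>0 by (auto simp: A_def B_def)
  \<comment> \<open>\<open>A + B\<close> bounds the relative error on the middle range, so \<open>M\<close> is the slope of the power there\<close>
  define M where "M = p * (K + (A + B)) powr (p - 1)"
  have M: "0 \<le> M" using p by (simp add: M_def)
  define D where "D = S * (B powr p / ?n + (M * A / ?n + M * B / \<sigma>) + A powr p / (?n * p))"
  have D: "0 \<le> D" unfolding D_def using S M AB \<sigma>0 p by (intro mult_nonneg_nonneg add_nonneg_nonneg divide_nonneg_nonneg) auto
  have "(\<integral>\<^sup>+x. ennreal (\<bar>log_bump_laplacian \<sigma> a \<epsilon> r x\<bar> powr p) \<partial>lborel) \<le> ennreal (S * (K powr p * ln (r / \<epsilon>)) + D)"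
    if \<epsilon>: "0 < \<epsilon>" "\<epsilon> < r" for a :: 'a and \<epsilon> r
  proof -
    have r0: "0 < r" using \<epsilon> by simp
    define y where "y \<rho> = A * (\<epsilon> / \<rho>) powr ?n + B * (\<rho> / r) powr \<sigma>" for \<rho>
    \<comment> \<open>one radial majorant per range; the exponents use \<open>\<sigma> * p = n\<close>\<close>
    define F where "F \<rho> = indicator {0<..\<epsilon>} \<rho> * (B powr p * \<epsilon> powr (- ?n)) +
      indicator {\<epsilon><..<r} \<rho> * (\<rho> powr (- ?n) * (K powr p + M * y \<rho>)) +
      indicator {r..} \<rho> * (\<rho> powr (- ?n) * (A powr p * (r / \<rho>) powr (?n * p)))" for \<rho> :: real
    have [measurable]: "F \<in> borel_measurable borel" unfolding F_def y_def by measurable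
    have pw_neg: "(\<rho> powr (- \<sigma>)) powr p = \<rho> powr (- ?n)" for \<rho> :: real
      unfolding \<sigma>p[symmetric] by (simp add: powr_powr)
    have pointwise: "\<bar>log_bump_laplacian \<sigma> a \<epsilon> r x\<bar> powr p \<le> F (norm (x - a))" if x: "x \<noteq> a" for x
    proof -
      define \<rho> where "\<rho> = norm (x - a)"
      have \<rho>: "0 < \<rho>" using x by (simp add: \<rho>_def)
      note b = log_bump_laplacian_pointwise[OF \<sigma>0 C \<sigma>n \<epsilon> x, folded \<rho>_def A_def B_def K_def]
      consider "\<rho> \<le> \<epsilon>" | "\<epsilon> < \<rho>" "\<rho> < r" | "r \<le> \<rho>" by linarith
      then have "\<bar>log_bump_laplacian \<sigma> a \<epsilon> r x\<bar> powr p \<le> F \<rho>"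
      proof cases
        case 1
        have "\<bar>log_bump_laplacian \<sigma> a \<epsilon> r x\<bar> powr p \<le> (B * \<epsilon> powr (- \<sigma>)) powr p"
          using b(1) p by (intro powr_mono2) auto
        also have "\<dots> = B powr p * \<epsilon> powr (- ?n)" by (simp only: powr_mult pw_neg)
        finally show ?thesis using 1 \<rho> \<epsilon> by (simp add: F_def)
      next
        case 2
        have y: "0 \<le> y \<rho>" "y \<rho> \<le> A + B"
        proof -
          show "0 \<le> y \<rho>" unfolding y_def using AB by (intro add_nonneg_nonneg mult_nonneg_nonneg) auto
          have "(\<epsilon> / \<rho>) powr ?n \<le> 1" using 2 \<epsilon> by (intro powr_le1) auto
          moreover have "(\<rho> / r) powr \<sigma> \<le> 1" using 2 \<epsilon> \<rho> \<sigma>0 by (intro powr_le1) auto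
          ultimately have "A * (\<epsilon> / \<rho>) powr ?n \<le> A * 1" "B * (\<rho> / r) powr \<sigma> \<le> B * 1"
            using AB by (auto intro: mult_left_mono)
          then show "y \<rho> \<le> A + B" unfolding y_def by linarith
        qed
        have "\<bar>log_bump_laplacian \<sigma> a \<epsilon> r x\<bar> powr p \<le> (\<rho> powr (- \<sigma>) * (K + y \<rho>)) powr p"
          using b(3) p K unfolding y_def[symmetric] by (intro powr_mono2) auto
        also have "\<dots> = \<rho> powr (- ?n) * (K + y \<rho>) powr p" by (simp only: powr_mult pw_neg)
        also have "\<dots> \<le> \<rho> powr (- ?n) * (K powr p + M * y \<rho>)"
          unfolding M_def using powr_add_le_linear[OF p K y] by (intro mult_left_mono) auto
        finally show ?thesis using 2 by (simp add: F_def)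
      next
        case 3
        have "\<bar>log_bump_laplacian \<sigma> a \<epsilon> r x\<bar> powr p \<le> (\<rho> powr (- \<sigma>) * (A * (r / \<rho>) powr ?n)) powr p"
          using b(2) p by (intro powr_mono2) auto
        also have "\<dots> = \<rho> powr (- ?n) * (A powr p * (r / \<rho>) powr (?n * p))"
          by (simp only: powr_mult pw_neg powr_powr[of "r / \<rho>"])
        finally show ?thesis using 3 \<epsilon> by (simp add: F_def)
      qed
      then show ?thesis by (simp only: \<rho>_def)
    qed
    let ?J1 = "\<lambda>\<rho>. ennreal (B powr p * \<epsilon> powr (- ?n) * \<rho> ^ (DIM('a) - 1)) * indicator {0..\<epsilon>} \<rho>"
    let ?j2 = "\<lambda>\<rho>. K powr p * (1 / \<rho>) + (M * A * \<epsilon> powr ?n * \<rho> powr (- ?n - 1) + M * B * r powr (- \<sigma>) * \<rho> powr (\<sigma> - 1))"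
    let ?J2 = "\<lambda>\<rho>. ennreal (?j2 \<rho>) * indicator {\<epsilon>..r} \<rho>"
    let ?J3 = "\<lambda>\<rho>. ennreal (A powr p * r powr (?n * p) * \<rho> powr (- (?n * p) - 1)) * indicator {r..} \<rho>"
    \<comment> \<open>with the polar weight the majorant splits into three integrable pieces with explicit primitives\<close>
    have split: "ennreal (indicator {0..} \<rho> * \<rho> ^ (DIM('a) - 1)) * ennreal (F \<rho>) \<le> ?J1 \<rho> + (?J2 \<rho> + ?J3 \<rho>)" for \<rho>
    proof (cases "0 < \<rho>")
      case \<rho>: True
      have pn: "\<rho> ^ (DIM('a) - 1) * \<rho> powr (- ?n) = \<rho> powr (- 1)"
      proof -
        have "\<rho> ^ (DIM('a) - 1) * \<rho> powr (- ?n) = \<rho> powr (real (DIM('a) - 1) + - ?n)"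
          by (simp only: powr_add powr_realpow[OF \<rho>])
        also have "real (DIM('a) - 1) + - ?n = - 1" using DIM_positive[where 'a='a] by (simp add: of_nat_diff)
        finally show ?thesis .
      qed
      have lhs: "ennreal (indicator {0..} \<rho> * \<rho> ^ (DIM('a) - 1)) * ennreal (F \<rho>) = ennreal (\<rho> ^ (DIM('a) - 1) * F \<rho>)"
        using \<rho> by (simp add: ennreal_mult')
      have div: "(c / \<rho>) powr e = c powr e * \<rho> powr (- e)" "(\<rho> / c) powr e = c powr (- e) * \<rho> powr e" for c e
        unfolding powr_divide powr_minus by (simp_all only: divide_inverse mult.commute)
      consider "\<rho> \<le> \<epsilon>" | "\<epsilon> < \<rho>" "\<rho> < r" | "r \<le> \<rho>" by linarith
      then show ?thesis
      proof cases
        case 1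
        then have "ennreal (\<rho> ^ (DIM('a) - 1) * F \<rho>) = ?J1 \<rho>" using \<rho> \<epsilon> by (simp add: F_def mult_ac)
        then show ?thesis unfolding lhs by simp
      next
        case 2
        have "\<rho> ^ (DIM('a) - 1) * F \<rho> = \<rho> powr (- 1) * (K powr p + M * y \<rho>)"
          using 2 by (simp add: F_def mult.assoc[symmetric] pn[simplified])
        also have "\<dots> = ?j2 \<rho>"
        proof -
          have e: "\<rho> powr (- 1) * \<rho> powr (- ?n) = \<rho> powr (- ?n - 1)" "\<rho> powr (- 1) * \<rho> powr \<sigma> = \<rho> powr (\<sigma> - 1)"
            unfolding powr_add[symmetric] by (rule arg_cong[where f="(powr) \<rho>"]; simp)+
          have eq: "\<rho> powr (- 1) * (K powr p + M * y \<rho>) = K powr p * \<rho> powr (- 1) +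
              (M * A * \<epsilon> powr ?n * (\<rho> powr (- 1) * \<rho> powr (- ?n)) + M * B * r powr (- \<sigma>) * (\<rho> powr (- 1) * \<rho> powr \<sigma>))"
            unfolding y_def div by (simp only: distrib_left mult_ac)
          have r1: "\<rho> powr (- 1) = 1 / \<rho>" using \<rho> by (simp add: powr_minus divide_inverse)
          show ?thesis unfolding eq e by (simp only: r1)
        qed
        finally have "ennreal (\<rho> ^ (DIM('a) - 1) * F \<rho>) = ?J2 \<rho>" using 2 by simp
        then show ?thesis unfolding lhs by simp
      next
        case 3
        have "\<rho> ^ (DIM('a) - 1) * F \<rho> = \<rho> powr (- 1) * (A powr p * (r / \<rho>) powr (?n * p))"
          using 3 \<epsilon> by (simp add: F_def mult.assoc[symmetric] pn[simplified])
        also have "\<dots> = A powr p * r powr (?n * p) * (\<rho> powr (- 1) * \<rho> powr (- (?n * p)))"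
          unfolding div by (simp only: mult_ac)
        also have "\<rho> powr (- 1) * \<rho> powr (- (?n * p)) = \<rho> powr (- (?n * p) - 1)"
          unfolding powr_add[symmetric] by (rule arg_cong[where f="(powr) \<rho>"]) simp
        finally have "ennreal (\<rho> ^ (DIM('a) - 1) * F \<rho>) = ?J3 \<rho>" using 3 by simp
        then show ?thesis unfolding lhs by simp
      qed
    next
      case False
      then have "F \<rho> = 0" using \<epsilon> by (auto simp: F_def)
      then show ?thesis by simp
    qed
    have J1: "(\<integral>\<^sup>+\<rho>. ?J1 \<rho> \<partial>lborel) = ennreal (B powr p / ?n)"
    proof -
      have "(\<integral>\<^sup>+\<rho>. ?J1 \<rho> \<partial>lborel) = ennreal (B powr p * \<epsilon> powr (- ?n) * (\<epsilon> ^ DIM('a) / ?n) - B powr p * \<epsilon> powr (- ?n) * (0 ^ DIM('a) / ?n))"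
      proof (rule nn_integral_FTC_Icc[where F="\<lambda>t. B powr p * \<epsilon> powr (- ?n) * (t ^ DIM('a) / ?n)"])
        show "((\<lambda>t. B powr p * \<epsilon> powr (- ?n) * (t ^ DIM('a) / ?n)) has_real_derivative B powr p * \<epsilon> powr (- ?n) * \<rho> ^ (DIM('a) - 1)) (at \<rho>)" for \<rho>
          by (auto intro!: derivative_eq_intros)
      qed (use \<epsilon> in auto)
      also have "B powr p * \<epsilon> powr (- ?n) * (\<epsilon> ^ DIM('a) / ?n) - B powr p * \<epsilon> powr (- ?n) * (0 ^ DIM('a) / ?n) = B powr p / ?n"
        using \<epsilon> by (simp add: powr_minus powr_realpow zero_power)
      finally show ?thesis .
    qed
    have J2: "(\<integral>\<^sup>+\<rho>. ?J2 \<rho> \<partial>lborel) \<le> ennreal (K powr p * ln (r / \<epsilon>) + (M * A / ?n + M * B / \<sigma>))"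
    proof -
      let ?G = "\<lambda>\<rho>. K powr p * ln \<rho> + (M * A * \<epsilon> powr ?n * (- (\<rho> powr (- ?n)) / ?n) + M * B * r powr (- \<sigma>) * (\<rho> powr \<sigma> / \<sigma>))"
      have "(\<integral>\<^sup>+\<rho>. ?J2 \<rho> \<partial>lborel) = ennreal (?G r - ?G \<epsilon>)"
      proof (rule nn_integral_FTC_Icc[where F="?G"])
        fix \<rho> assume "\<rho> \<in> {\<epsilon>..r}"
        then have \<rho>: "0 < \<rho>" using \<epsilon> by auto
        show "(?G has_real_derivative ?j2 \<rho>) (at \<rho>)"
          using \<rho> \<sigma>0 by (auto intro!: derivative_eq_intros)
        show "0 \<le> ?j2 \<rho>" using \<rho> M AB by (intro add_nonneg_nonneg mult_nonneg_nonneg) auto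
      qed (use \<epsilon> in auto)
      also have "?G r - ?G \<epsilon> \<le> K powr p * ln (r / \<epsilon>) + (M * A / ?n + M * B / \<sigma>)"
      proof -
        have "ln (r / \<epsilon>) = ln r - ln \<epsilon>" using \<epsilon> by (simp add: ln_div)
        moreover have "\<epsilon> powr ?n * (\<epsilon> powr (- ?n) / ?n) = 1 / ?n" "r powr (- \<sigma>) * (r powr \<sigma> / \<sigma>) = 1 / \<sigma>"
          using \<epsilon> r0 by (simp_all add: powr_minus)
        moreover have "0 \<le> \<epsilon> powr ?n * (r powr (- ?n) / ?n)" "0 \<le> r powr (- \<sigma>) * (\<epsilon> powr \<sigma> / \<sigma>)"
          using \<sigma>0 by (auto intro!: mult_nonneg_nonneg)
        moreover have "\<epsilon> powr ?n * (- (r powr (- ?n)) / ?n) - \<epsilon> powr ?n * (- (\<epsilon> powr (- ?n)) / ?n) =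
            \<epsilon> powr ?n * (\<epsilon> powr (- ?n) / ?n) - \<epsilon> powr ?n * (r powr (- ?n) / ?n)" by simp
        ultimately have "\<epsilon> powr ?n * (- (r powr (- ?n)) / ?n) - \<epsilon> powr ?n * (- (\<epsilon> powr (- ?n)) / ?n) \<le> 1 / ?n"
          "r powr (- \<sigma>) * (r powr \<sigma> / \<sigma>) - r powr (- \<sigma>) * (\<epsilon> powr \<sigma> / \<sigma>) \<le> 1 / \<sigma>"
          "ln (r / \<epsilon>) = ln r - ln \<epsilon>" by linarith+
        note b = this
        have "0 \<le> M * A" "0 \<le> M * B" using M AB by auto
        from mult_left_mono[OF b(1) this(1)] mult_left_mono[OF b(2) this(2)]
        have f12: "(M * A) * (\<epsilon> powr ?n * (- (r powr (- ?n)) / ?n) - \<epsilon> powr ?n * (- (\<epsilon> powr (- ?n)) / ?n)) \<le> (M * A) * (1 / ?n)"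
          "(M * B) * (r powr (- \<sigma>) * (r powr \<sigma> / \<sigma>) - r powr (- \<sigma>) * (\<epsilon> powr \<sigma> / \<sigma>)) \<le> (M * B) * (1 / \<sigma>)" .
        have f3: "K powr p * ln (r / \<epsilon>) = K powr p * ln r - K powr p * ln \<epsilon>"
          by (simp only: b(3) right_diff_distrib)
        have combine: "(k1 + (MA * e * g1 + MB * s * h1)) - (k2 + (MA * e * g2 + MB * s * h2)) \<le> k + (X + Y)"
          if "MA * (e * g1 - e * g2) \<le> X" "MB * (s * h1 - s * h2) \<le> Y" "k = k1 - k2"
          for k1 k2 k MA MB e s g1 g2 h1 h2 X Y :: real
        proof -
          have "(k1 + (MA * e * g1 + MB * s * h1)) - (k2 + (MA * e * g2 + MB * s * h2)) =
              (k1 - k2) + (MA * (e * g1 - e * g2) + MB * (s * h1 - s * h2))"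
            by (simp add: right_diff_distrib mult.assoc)
          with that show ?thesis by linarith
        qed
        show ?thesis
          by (rule order_trans[OF combine[OF f12 f3]]) simp
      qed
      finally show ?thesis by (simp add: ennreal_leI)
    qed
    have J3: "(\<integral>\<^sup>+\<rho>. ?J3 \<rho> \<partial>lborel) = ennreal (A powr p / (?n * p))"
    proof -
      have np: "0 < ?n * p" using p by simp
      let ?G = "\<lambda>\<rho>. A powr p * r powr (?n * p) * (- (\<rho> powr (- (?n * p))) / (?n * p))"
      have lim: "(?G \<longlongrightarrow> 0) at_top"
      proof -
        have "((\<lambda>\<rho>::real. \<rho> powr (- (?n * p))) \<longlongrightarrow> 0) at_top"
          using np by (intro tendsto_neg_powr filterlim_ident) auto
        then have "(?G \<longlongrightarrow> A powr p * r powr (?n * p) * (- 0 / (?n * p))) at_top"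
          by (intro tendsto_intros) (use np in auto)
        then show ?thesis by simp
      qed
      have deriv: "(?G has_real_derivative A powr p * r powr (?n * p) * \<rho> powr (- (?n * p) - 1)) (at \<rho>)" if "r \<le> \<rho>" for \<rho>
        using that r0 np by (auto intro!: derivative_eq_intros)
      have "(\<integral>\<^sup>+\<rho>. ?J3 \<rho> \<partial>lborel) = ennreal (0 - ?G r)"
        by (rule nn_integral_FTC_atLeast[OF _ deriv _ lim]) auto
      also have "0 - ?G r = A powr p / (?n * p)" using r0 by (simp add: powr_minus)
      finally show ?thesis .
    qed
    have "(\<integral>\<^sup>+x. ennreal (\<bar>log_bump_laplacian \<sigma> a \<epsilon> r x\<bar> powr p) \<partial>lborel) \<le> (\<integral>\<^sup>+x. ennreal (F (norm (x - a))) \<partial>lborel)"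
      by (rule nn_integral_mono_AE, rule eventually_mono[OF AE_lborel_singleton[of a]]) (intro ennreal_leI pointwise)
    also have "\<dots> = (\<integral>\<^sup>+x. ennreal (F (norm (x::'a))) \<partial>lborel)"
      using nn_integral_lborel_translation[of "\<lambda>x. ennreal (F (norm x))" "- a"] by simp
    also have "\<dots> = ennreal S * (\<integral>\<^sup>+\<rho>. ennreal (indicator {0..} \<rho> * \<rho> ^ (DIM('a) - 1)) * ennreal (F \<rho>) \<partial>lborel)"
      unfolding S_def by (rule nn_integral_radial) measurable
    also have "\<dots> \<le> ennreal S * (\<integral>\<^sup>+\<rho>. ?J1 \<rho> + (?J2 \<rho> + ?J3 \<rho>) \<partial>lborel)"
      by (intro mult_left_mono nn_integral_mono split) auto
    also have "(\<integral>\<^sup>+\<rho>. ?J1 \<rho> + (?J2 \<rho> + ?J3 \<rho>) \<partial>lborel) = (\<integral>\<^sup>+\<rho>. ?J1 \<rho> \<partial>lborel) + ((\<integral>\<^sup>+\<rho>. ?J2 \<rho> \<partial>lborel) + (\<integral>\<^sup>+\<rho>. ?J3 \<rho> \<partial>lborel))"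
    proof -
      have m: "?J1 \<in> borel_measurable lborel" "?J2 \<in> borel_measurable lborel" "?J3 \<in> borel_measurable lborel"
        by measurable
      show ?thesis
        by (simp only: nn_integral_add[OF m(1) borel_measurable_add[OF m(2,3)]] nn_integral_add[OF m(2,3)])
    qed
    also have "\<dots> \<le> ennreal (B powr p / ?n) + (ennreal (K powr p * ln (r / \<epsilon>) + (M * A / ?n + M * B / \<sigma>)) + ennreal (A powr p / (?n * p)))"
      unfolding J1 J3 by (intro add_mono J2 order_refl)
    also have "\<dots> = ennreal (B powr p / ?n + ((K powr p * ln (r / \<epsilon>) + (M * A / ?n + M * B / \<sigma>)) + A powr p / (?n * p)))"
    proof -
      have "0 \<le> ln (r / \<epsilon>)" using \<epsilon> by simp
      then have "0 \<le> K powr p * ln (r / \<epsilon>) + (M * A / ?n + M * B / \<sigma>)"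
        using M AB \<sigma>0 by (intro add_nonneg_nonneg mult_nonneg_nonneg divide_nonneg_nonneg) auto
      moreover have "0 \<le> B powr p / ?n" "0 \<le> A powr p / (?n * p)" using p by auto
      ultimately show ?thesis by (simp only: ennreal_plus add_nonneg_nonneg)
    qed
    also have "ennreal S * \<dots> = ennreal (S * (B powr p / ?n + ((K powr p * ln (r / \<epsilon>) + (M * A / ?n + M * B / \<sigma>)) + A powr p / (?n * p))))"
      using S by (simp only: ennreal_mult' less_imp_le)
    also have "S * (B powr p / ?n + ((K powr p * ln (r / \<epsilon>) + (M * A / ?n + M * B / \<sigma>)) + A powr p / (?n * p))) =
        S * (K powr p * ln (r / \<epsilon>)) + D"
      unfolding D_def by (simp only: distrib_left add_ac)
    finally show ?thesis by (simp add: mult_left_mono)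
  qed
  with D show ?thesis unfolding S_def K_def by blast
qed

section \<open>Normalisation and divergence\<close>

lemma has_frac_laplacian_cmult:
  assumes "has_frac_laplacian s u g"
  shows "has_frac_laplacian s (\<lambda>x. c * u x) (\<lambda>x. c * g x)"
proof -
  have u: "u \<in> L_space s" using assms by (simp add: has_frac_laplacian_def)
  have "(\<lambda>x. c * u x) \<in> L_space s"
    unfolding L_space_def
  proof (intro CollectI conjI allI impI)
    fix K :: "'a set" assume "compact K"
    then have "u absolutely_integrable_on K" using u unfolding L_space_def by blast
    then show "(\<lambda>x. c * u x) absolutely_integrable_on K" by (rule set_integrable_mult_right)
  next
    have "integrable lebesgue (\<lambda>x. \<bar>c\<bar> * (\<bar>u x\<bar> / (1 + norm x powr (real DIM('a) + 2 * s))))"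
      using u unfolding L_space_def by (intro integrable_mult_right) blast
    then show "integrable lebesgue (\<lambda>x. \<bar>c * u x\<bar> / (1 + norm x powr (real DIM('a) + 2 * s)))"
      by (simp add: abs_mult)
  qed
  moreover have "integrable lebesgue (\<lambda>x. complex_of_real (c * g x) * \<phi> x) \<and>
      frac_laplacian s (\<lambda>x. c * u x) \<phi> = (LINT x|lebesgue. complex_of_real (c * g x) * \<phi> x)"
    if \<phi>: "\<phi> \<in> schwartz" for \<phi>
  proof -
    have g: "integrable lebesgue (\<lambda>x. complex_of_real (g x) * \<phi> x)"
      "frac_laplacian s u \<phi> = (LINT x|lebesgue. complex_of_real (g x) * \<phi> x)"
      using assms \<phi> unfolding has_frac_laplacian_def by auto
    have "integrable lebesgue (\<lambda>x. complex_of_real c * (complex_of_real (g x) * \<phi> x))"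
      using g(1) by (rule integrable_mult_right)
    moreover have "frac_laplacian s (\<lambda>x. c * u x) \<phi> = complex_of_real c * frac_laplacian s u \<phi>"
      unfolding frac_laplacian_def by (simp add: mult.assoc)
    ultimately show ?thesis using g(2) by (simp add: mult.assoc)
  qed
  ultimately show ?thesis unfolding has_frac_laplacian_def by blast
qed

lemma
  fixes f :: "'a::euclidean_space \<Rightarrow> real"
  assumes f: "f \<in> borel_measurable borel" and A: "A \<in> sets lebesgue" and p: "0 < p" and B: "0 \<le> B"
    and le: "(\<integral>\<^sup>+x. ennreal (\<bar>f x\<bar> powr p) \<partial>lborel) \<le> ennreal B"
  shows Lp_borelI: "f \<in> Lp p A" and Lp_norm_powr_le: "Lp_norm p A f powr p \<le> B"
proof -
  have f_leb: "f \<in> borel_measurable (lebesgue_on A)"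
    using f by (intro measurable_restrict_space1 measurable_completion) simp
  have "(\<integral>\<^sup>+x. ennreal (\<bar>f x\<bar> powr p) \<partial>lebesgue_on A) \<le> (\<integral>\<^sup>+x. ennreal (\<bar>f x\<bar> powr p) \<partial>lebesgue)"
    using A by (subst nn_integral_restrict_space) (auto intro!: nn_integral_mono simp: indicator_def)
  also have "\<dots> \<le> ennreal B" using le by (simp add: nn_integral_completion)
  finally have nn: "(\<integral>\<^sup>+x. ennreal (\<bar>f x\<bar> powr p) \<partial>lebesgue_on A) \<le> ennreal B" .
  have int: "integrable (lebesgue_on A) (\<lambda>x. \<bar>f x\<bar> powr p)"
  proof (rule integrableI_bounded)
    show "(\<lambda>x. \<bar>f x\<bar> powr p) \<in> borel_measurable (lebesgue_on A)" using f_leb by measurable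
    have "(\<integral>\<^sup>+x. ennreal (norm (\<bar>f x\<bar> powr p)) \<partial>lebesgue_on A) \<le> ennreal B" using nn by simp
    also have "ennreal B < \<infinity>" by simp
    finally show "(\<integral>\<^sup>+x. ennreal (norm (\<bar>f x\<bar> powr p)) \<partial>lebesgue_on A) < \<infinity>" .
  qed
  then show "f \<in> Lp p A" using f_leb by (simp add: Lp_def)
  have I0: "0 \<le> (LINT x|lebesgue_on A. \<bar>f x\<bar> powr p)" by simp
  have "ennreal (LINT x|lebesgue_on A. \<bar>f x\<bar> powr p) = (\<integral>\<^sup>+x. ennreal (\<bar>f x\<bar> powr p) \<partial>lebesgue_on A)"
    using int by (intro nn_integral_eq_integral[symmetric]) auto
  with nn have "(LINT x|lebesgue_on A. \<bar>f x\<bar> powr p) \<le> B" using B I0 by (simp flip: ennreal_le_iff)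
  then show "Lp_norm p A f powr p \<le> B" unfolding Lp_norm_def using p I0 by (simp add: powr_powr)
qed

lemma nn_integral_cmult_powr_le:
  fixes f :: "'a::euclidean_space \<Rightarrow> real"
  assumes [measurable]: "f \<in> borel_measurable borel" and c: "0 \<le> c" and B: "0 \<le> B"
    and le: "(\<integral>\<^sup>+x. ennreal (\<bar>f x\<bar> powr p) \<partial>lborel) \<le> ennreal B"
  shows "(\<integral>\<^sup>+x. ennreal (\<bar>c * f x\<bar> powr p) \<partial>lborel) \<le> ennreal (c powr p * B)"
proof -
  have "(\<integral>\<^sup>+x. ennreal (\<bar>c * f x\<bar> powr p) \<partial>lborel) = (\<integral>\<^sup>+x. ennreal (c powr p) * ennreal (\<bar>f x\<bar> powr p) \<partial>lborel)"
    using c by (intro nn_integral_cong) (simp add: abs_mult powr_mult ennreal_mult)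
  also have "\<dots> = ennreal (c powr p) * (\<integral>\<^sup>+x. ennreal (\<bar>f x\<bar> powr p) \<partial>lborel)"
    by (rule nn_integral_cmult) measurable
  also have "\<dots> \<le> ennreal (c powr p) * ennreal B" using le by (intro mult_left_mono) auto
  also have "\<dots> = ennreal (c powr p * B)" using B by (simp add: ennreal_mult)
  finally show ?thesis .
qed

text \<open>The sharp constant expressed by the leading coefficient \<open>K\<close> of the test functions.\<close>

lemma moser_alpha_eq:
  assumes p: "1 < p"
  defines "n \<equiv> real DIM('a::euclidean_space)"
  shows "moser_alpha TYPE('a) p = n / sphere_area TYPE('a) *
    (sphere_area TYPE('a) * profile_moment TYPE('a) (n / p)) powr (p / (p - 1))"
proof -
  have n: "0 < n" by (simp add: n_def)
  have s: "0 < n / p" "n / p < n" using n p by (auto simp: field_simps)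
  have "sphere_area TYPE('a) * profile_moment TYPE('a) (n / p) =
      2 powr (n / p) * pi powr (n / 2) * Gamma (n / p / 2) / Gamma ((n - n / p) / 2)"
    unfolding n_def by (rule profile_moment_eq) (use s in \<open>auto simp: n_def\<close>)
  moreover have "n / p / 2 = n / (2 * p)" by simp
  moreover have "(n - n / p) / 2 = (n * p - n) / (2 * p)" using p by (simp add: field_simps)
  ultimately have "sphere_area TYPE('a) * profile_moment TYPE('a) (n / p) =
      Gamma (n / (2 * p)) * 2 powr (n / p) * pi powr (n / 2) / Gamma ((n * p - n) / (2 * p))"
    by (simp add: mult_ac)
  then show ?thesis
    unfolding moser_alpha_def Let_def sphere_area_def n_def by simp
qed

text \<open>The constants of the normalisation cancel exactly, and Bernoulli's inequality shows that
lower order terms in numerator and denominator cost only a bounded amount. Here \<open>X\<close> is the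
logarithm up to an additive constant, \<open>X - d\<close> a lower bound for the test function and \<open>S K\<^sup>p X\<close> an
upper bound for the \<open>p\<close>-th power of its norm.\<close>

lemma normalised_exponent_lower_bound:
  fixes p n S K L d :: real
  assumes p: "1 < p" and n: "0 < n" and SK: "0 < S" "0 < K" and d: "0 \<le> d" and X: "0 < X" "d \<le> X"
  shows "n * (X - p / (p - 1) * d) \<le>
    n / S * (S * K) powr (p / (p - 1)) * ((X - d) * (S * K powr p * X) powr (- 1 / p)) powr (p / (p - 1))"
proof -
  define q where "q = p / (p - 1)"
  have q: "1 < q" "q / p = q - 1" "p * (q - 1) = q" using p by (auto simp: q_def field_simps)
  have bern: "1 - q * (d / X) \<le> (1 - d / X) powr q"
  proof (cases "d < X")
    case True
    have "(1 - d / X + d / X) powr q \<le> (1 - d / X) powr q + q * (1 - d / X + d / X) powr (q - 1) * (d / X)"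
      by (rule powr_add_le_linear) (use q True d X in auto)
    then show ?thesis by simp
  next
    case False
    then have "d = X" using X by simp
    then show ?thesis using X q by simp
  qed
  have "n / S * (S * K) powr q * ((X - d) * (S * K powr p * X) powr (- 1 / p)) powr q =
      n / S * (S powr q * K powr q) * ((X - d) powr q * (S * K powr p * X) powr (- (q - 1)))"
  proof -
    have "((S * K powr p * X) powr (- 1 / p)) powr q = (S * K powr p * X) powr (- (q - 1))"
      unfolding powr_powr q(2)[symmetric] by simp
    then show ?thesis by (simp only: powr_mult)
  qed
  also have "(S * K powr p * X) powr (- (q - 1)) = S powr (- (q - 1)) * K powr (- q) * X powr (- (q - 1))"
  proof -
    have "(K powr p) powr (- (q - 1)) = K powr (- q)" unfolding powr_powr mult_minus_right q(3) ..
    then show ?thesis by (simp only: powr_mult)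
  qed
  also have "n / S * (S powr q * K powr q) * ((X - d) powr q * (S powr (- (q - 1)) * K powr (- q) * X powr (- (q - 1)))) =
      n * ((1 / S) * (S powr q * S powr (- (q - 1)))) * (K powr q * K powr (- q)) * ((X - d) powr q * X powr (- (q - 1)))"
    by (simp add: mult_ac)
  also have "S powr q * S powr (- (q - 1)) = S" unfolding powr_add[symmetric] using SK by simp
  also have "K powr q * K powr (- q) = 1" unfolding powr_add[symmetric] using SK by simp
  also have "(X - d) powr q * X powr (- (q - 1)) = X * (1 - d / X) powr q"
  proof -
    have "X - d = X * (1 - d / X)" using X by (simp add: right_diff_distrib)
    then have "(X - d) powr q = X powr q * (1 - d / X) powr q" by (metis powr_mult)
    moreover have "X powr q * X powr (- (q - 1)) = X" unfolding powr_add[symmetric] using X by simp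
    ultimately show ?thesis by (simp add: mult_ac)
  qed
  also have "n * (1 / S * S) * 1 * (X * (1 - d / X) powr q) = n * (X * (1 - d / X) powr q)" using SK by simp
  finally have eq: "n / S * (S * K) powr q * ((X - d) * (S * K powr p * X) powr (- 1 / p)) powr q =
      n * (X * (1 - d / X) powr q)" .
  have "X - q * d = X * (1 - q * (d / X))" using X by (simp add: right_diff_distrib)
  also have "\<dots> \<le> X * (1 - d / X) powr q" using bern X by (intro mult_left_mono) auto
  finally have "n * (X - q * d) \<le> n * (X * (1 - d / X) powr q)" using n by (intro mult_left_mono) auto
  then show ?thesis by (simp only: eq q_def[symmetric])
qed

text \<open>The result in an arbitrary Euclidean space. Given a level \<open>T\<close>, the truncation \<open>\<epsilon>\<close> is
chosen so small that \<open>f \<ge> T\<close> on the ball where the normalised function is largest; the integral over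
this ball is then at least \<open>T\<close> times a positive constant independent of \<open>T\<close>.\<close>

lemma sharp_exponential_supremum_infinite:
  fixes \<Omega> :: "'a::euclidean_space set" and p :: real and f :: "real \<Rightarrow> real"
  assumes \<Omega>: "open \<Omega>" "\<Omega> \<noteq> {}" and p: "1 < p"
    and f0: "\<And>t. 0 \<le> t \<Longrightarrow> 0 \<le> f t" and f: "filterlim f at_top at_top"
  shows "(SUP u \<in> {u \<in> H_tilde (real DIM('a) / p) p \<Omega>.
              \<exists>g \<in> Lp p UNIV. has_frac_laplacian (real DIM('a) / (2 * p)) u g \<and>
                Lp_norm p \<Omega> u powr p + Lp_norm p UNIV g powr p \<le> 1}.
            \<integral>\<^sup>+x. ennreal (f \<bar>u x\<bar> * exp (moser_alpha TYPE('a) p * \<bar>u x\<bar> powr (p / (p - 1))))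
              \<partial>lebesgue_on \<Omega>) = \<infinity>" (is "(SUP u \<in> ?U. ?I u) = \<infinity>")
proof -
  define n where "n = real DIM('a)"
  define \<sigma> where "\<sigma> = n / p"
  have n: "0 < n" by (simp add: n_def)
  have \<sigma>: "0 < \<sigma>" "\<sigma> < n" "\<sigma> * p = n" using n p by (auto simp: \<sigma>_def field_simps)
  define S where "S = sphere_area TYPE('a)"
  define K where "K = profile_moment TYPE('a) \<sigma>"
  have S: "0 < S" unfolding S_def by (rule sphere_area_pos)
  have K: "0 < K" unfolding K_def by (rule profile_moment_pos) (use \<sigma> in \<open>auto simp: n_def\<close>)
  obtain a r where r: "0 < r" and ball: "ball a r \<subseteq> \<Omega>"
    using \<Omega> by (meson ex_in_conv openE)
  obtain M where M: "0 \<le> M" "\<And>\<epsilon>. 0 < \<epsilon> \<Longrightarrow> \<epsilon> < r \<Longrightarrow>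
      (\<integral>\<^sup>+x. ennreal (log_bump a \<epsilon> r x powr p) \<partial>lborel) \<le> ennreal M"
  proof -
    have "0 \<le> S * ((2 * p) powr p * r powr (1 / 2) * r ^ (DIM('a) - 1) * exp r * Gamma (1 / 2))"
      using S r Gamma_real_pos[of "1 / 2"] by (intro mult_nonneg_nonneg) auto
    then show ?thesis using that nn_integral_log_bump_powr_le[OF _ _ p] unfolding S_def by blast
  qed
  obtain D where D: "0 \<le> D" "\<And>\<epsilon>. 0 < \<epsilon> \<Longrightarrow> \<epsilon> < r \<Longrightarrow>
      (\<integral>\<^sup>+x. ennreal (\<bar>log_bump_laplacian \<sigma> a \<epsilon> r x\<bar> powr p) \<partial>lborel) \<le> ennreal (S * (K powr p * ln (r / \<epsilon>)) + D)"
    using nn_integral_log_bump_laplacian_powr_le[OF p, of \<sigma>, where 'a='a] \<sigma>(3) unfolding S_def K_def n_def by blast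
  define P where "P = S * K powr p"
  have P: "0 < P" using S K by (simp add: P_def)
  \<comment> \<open>the bounded terms of the norm, in units of the coefficient of the logarithm\<close>
  define c2 where "c2 = (M + D) / P"
  have c2: "0 \<le> c2" using M D P by (simp add: c2_def)
  define N where "N = real (2 * DIM('a) + 2)"
  define d where "d = N + c2"
  have N: "0 \<le> N" by (simp add: N_def)
  have d: "0 \<le> d" using c2 N by (simp add: d_def)
  define q where "q = p / (p - 1)"
  have q: "1 < q" using p by (simp add: q_def field_simps)
  define \<alpha> where "\<alpha> = moser_alpha TYPE('a) p"
  have \<alpha>_eq: "\<alpha> = n / S * (S * K) powr q"
    unfolding \<alpha>_def S_def K_def \<sigma>_def n_def q_def by (rule moser_alpha_eq[OF p])
  have \<alpha>: "0 < \<alpha>" unfolding \<alpha>_eq using n S K by simp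
  define V where "V = unit_ball_vol n"
  have V: "0 < V" unfolding V_def n_def by simp
  define c0 where "c0 = exp (n * (c2 - q * d)) * (V * r ^ DIM('a))"
  have c0: "0 < c0" using V r by (simp add: c0_def)
  have main: "\<exists>u\<in>?U. ennreal (T * c0) \<le> ?I u" if T: "0 \<le> T" for T
  proof -
    obtain t0 where t0: "\<And>t. t0 \<le> t \<Longrightarrow> T \<le> f t"
      using f unfolding filterlim_at_top eventually_at_top_linorder by blast
    define t1 where "t1 = max t0 0"
    \<comment> \<open>\<open>L\<close> is to become \<open>ln (r / \<epsilon>)\<close>; the last lower bound forces \<open>\<alpha> * m powr q\<close> above \<open>\<alpha> * t1 powr q\<close>, hence \<open>t1 \<le> m\<close>\<close>
    define L where "L = max 1 (max N (\<alpha> * t1 powr q / n + q * d))"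
    have L: "1 \<le> L" "N \<le> L" "\<alpha> * t1 powr q / n + q * d \<le> L" unfolding L_def by auto
    define \<epsilon> where "\<epsilon> = r * exp (- L)"
    have \<epsilon>: "0 < \<epsilon>" "\<epsilon> < r" using r L by (auto simp: \<epsilon>_def)
    have ln_L: "ln (r / \<epsilon>) = L" using r by (simp add: \<epsilon>_def ln_div)
    define X where "X = L + c2"
    have X: "0 < X" "d \<le> X" "X - d = L - N" using L c2 by (auto simp: X_def d_def)
    have PX: "0 < P * X" "P * X = M + (S * (K powr p * L) + D)"
    proof -
      show "0 < P * X" using P X(1) by simp
      have "P * c2 = M + D" using P by (simp add: c2_def)
      then show "P * X = M + (S * (K powr p * L) + D)"
        by (simp add: X_def distrib_left P_def mult.assoc)
    qed
    define c where "c = (P * X) powr (- 1 / p)"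
    have c: "0 < c" "c powr p = 1 / (P * X)"
    proof -
      show "0 < c" using P X(1) by (simp add: c_def)
      have "c powr p = (P * X) powr (- 1)" unfolding c_def powr_powr using p by simp
      also have "\<dots> = 1 / (P * X)" using powr_minus_divide[of "P * X" 1] P X(1) by simp
      finally show "c powr p = 1 / (P * X)" .
    qed
    define u where "u x = c * log_bump a \<epsilon> r x" for x
    define g where "g x = c * log_bump_laplacian \<sigma> a \<epsilon> r x" for x
    note [measurable] = borel_measurable_log_bump[OF \<epsilon>, of a] borel_measurable_log_bump_laplacian[OF \<epsilon> \<sigma>(1), of a]
    have u_m: "u \<in> borel_measurable borel" and g_m: "g \<in> borel_measurable borel"
      unfolding u_def g_def by measurable
    have u_nn: "(\<integral>\<^sup>+x. ennreal (\<bar>u x\<bar> powr p) \<partial>lborel) \<le> ennreal (c powr p * M)"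
      unfolding u_def using M c log_bump_nonneg[OF \<epsilon>, of a] \<epsilon>
      by (intro nn_integral_cmult_powr_le) (auto simp: abs_of_nonneg)
    have SL: "0 \<le> S * (K powr p * L) + D"
      using S L(1) D(1) by (intro add_nonneg_nonneg mult_nonneg_nonneg) auto
    have g_nn: "(\<integral>\<^sup>+x. ennreal (\<bar>g x\<bar> powr p) \<partial>lborel) \<le> ennreal (c powr p * (S * (K powr p * L) + D))"
      unfolding g_def using D(2)[OF \<epsilon>] c SL
      by (intro nn_integral_cmult_powr_le) (auto simp: ln_L)
    have \<Omega>_leb: "\<Omega> \<in> sets lebesgue" using \<Omega>(1) by (simp add: borel_open sets_completionI_sets)
    have p0: "0 < p" using p by simp
    have cM: "0 \<le> c powr p * M" "0 \<le> c powr p * (S * (K powr p * L) + D)"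
      using M SL by (auto intro: mult_nonneg_nonneg)
    have u_Lp: "u \<in> Lp p \<Omega>" "Lp_norm p \<Omega> u powr p \<le> c powr p * M"
      using Lp_borelI[OF u_m \<Omega>_leb p0 cM(1) u_nn] Lp_norm_powr_le[OF u_m \<Omega>_leb p0 cM(1) u_nn] by auto
    have g_Lp: "g \<in> Lp p UNIV" "Lp_norm p UNIV g powr p \<le> c powr p * (S * (K powr p * L) + D)"
      using Lp_borelI[OF g_m _ p0 cM(2) g_nn] Lp_norm_powr_le[OF g_m _ p0 cM(2) g_nn] by auto
    have "has_frac_laplacian (\<sigma> / 2) u g"
      unfolding u_def[abs_def] g_def[abs_def]
      by (intro has_frac_laplacian_cmult has_frac_laplacian_log_bump[OF \<epsilon>]) (use \<sigma> in \<open>auto simp: n_def\<close>)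
    then have lap: "has_frac_laplacian (n / (2 * p)) u g" "has_frac_laplacian (n / p / 2) u g"
      by (simp_all add: \<sigma>_def mult.commute)
    have "u x = 0" if "x \<notin> \<Omega>" for x
    proof -
      have "x \<notin> ball a r" using that ball by blast
      then show ?thesis unfolding u_def
        using log_bump_eq_0[OF \<epsilon>, of x a] by (simp add: dist_norm norm_minus_commute)
    qed
    then have "u \<in> H_tilde (n / p) p \<Omega>"
      unfolding H_tilde_def using u_Lp(1) g_Lp(1) lap(2) by auto
    moreover have "Lp_norm p \<Omega> u powr p + Lp_norm p UNIV g powr p \<le> 1"
    proof -
      have "Lp_norm p \<Omega> u powr p + Lp_norm p UNIV g powr p \<le> c powr p * (M + (S * (K powr p * L) + D))"
        using u_Lp(2) g_Lp(2) by (simp add: distrib_left)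
      also have "\<dots> = 1" unfolding PX(2)[symmetric] c(2) using P X(1) by simp
      finally show ?thesis .
    qed
    ultimately have "u \<in> ?U" using g_Lp(1) lap(1) unfolding n_def by auto
    moreover have "ennreal (T * c0) \<le> ?I u"
    proof -
      \<comment> \<open>a lower bound for the normalised function on the ball of radius \<open>\<epsilon>\<close>\<close>
      define m where "m = (X - d) * (P * X) powr (- 1 / p)"
      have m0: "0 \<le> m" using X by (simp add: m_def)
      have \<alpha>m: "n * (X - q * d) \<le> \<alpha> * m powr q"
        unfolding \<alpha>_eq m_def P_def q_def
        by (rule normalised_exponent_lower_bound[OF p n S K d X(1,2)])
      have t1m: "t1 \<le> m"
      proof (rule ccontr)
        assume "\<not> t1 \<le> m"
        then have "m powr q < t1 powr q" using m0 q by (intro powr_less_mono2) auto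
        then have "\<alpha> * m powr q < \<alpha> * t1 powr q" using \<alpha> by simp
        moreover have "\<alpha> * t1 powr q \<le> n * (L - q * d)" using L(3) n by (simp add: field_simps)
        moreover have "n * (L - q * d) \<le> n * (X - q * d)" using n c2 by (simp add: X_def)
        ultimately show False using \<alpha>m by linarith
      qed
      have ge: "T * exp (n * (X - q * d)) \<le> f \<bar>u x\<bar> * exp (\<alpha> * \<bar>u x\<bar> powr q)" if x: "x \<in> ball a \<epsilon>" for x
      proof -
        have "norm (x - a) \<le> \<epsilon>" using x by (simp add: dist_norm norm_minus_commute)
        then have "L - N \<le> log_bump a \<epsilon> r x" using log_bump_ge[OF \<epsilon>, of x a] by (simp add: ln_L N_def)
        then have "m \<le> u x"
          unfolding m_def u_def X(3) c_def[symmetric] using c(1) by (simp add: mult.commute mult_left_mono)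
        then have um: "m \<le> \<bar>u x\<bar>" by simp
        then have "T \<le> f \<bar>u x\<bar>" using t0 t1m unfolding t1_def by auto
        moreover have "\<alpha> * m powr q \<le> \<alpha> * \<bar>u x\<bar> powr q"
          using um m0 q \<alpha> by (intro mult_left_mono powr_mono2) auto
        then have "exp (n * (X - q * d)) \<le> exp (\<alpha> * \<bar>u x\<bar> powr q)" using \<alpha>m by simp
        ultimately show ?thesis using T by (intro mult_mono) auto
      qed
      have sub: "ball a \<epsilon> \<subseteq> \<Omega>" using ball \<epsilon> by (meson ball_subset_ball_iff less_imp_le order_trans subset_ball)
      \<comment> \<open>\<open>exp (n * L)\<close> cancels the factor \<open>exp (- L) ^ n\<close> in the volume of the ball\<close>
      have "ennreal (T * c0) = ennreal (T * exp (n * (X - q * d))) * ennreal (V * \<epsilon> ^ DIM('a))"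
      proof -
        have "exp (n * (X - q * d)) * (V * \<epsilon> ^ DIM('a)) = c0"
        proof -
          have "exp (n * (X - q * d)) = exp (n * (c2 - q * d)) * exp (n * L)"
            unfolding exp_add[symmetric] X_def by (simp add: algebra_simps)
          moreover have "\<epsilon> ^ DIM('a) = r ^ DIM('a) * exp (- (n * L))"
            unfolding \<epsilon>_def power_mult_distrib n_def by (simp add: exp_of_nat_mult[symmetric])
          moreover have "exp (n * L) * exp (- (n * L)) = 1" unfolding exp_add[symmetric] by simp
          ultimately show ?thesis unfolding c0_def by (simp add: mult_ac)
        qed
        then have "T * c0 = (T * exp (n * (X - q * d))) * (V * \<epsilon> ^ DIM('a))" by (simp add: mult.assoc)
        then show ?thesis using T V \<epsilon> by (simp only: ennreal_mult' mult_nonneg_nonneg exp_ge_zero)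
      qed
      also have "ennreal (V * \<epsilon> ^ DIM('a)) = emeasure lebesgue (ball a \<epsilon>)"
        unfolding V_def n_def using \<epsilon> by (simp add: emeasure_ball)
      also have "ennreal (T * exp (n * (X - q * d))) * emeasure lebesgue (ball a \<epsilon>) =
          (\<integral>\<^sup>+x. ennreal (T * exp (n * (X - q * d))) * indicator (ball a \<epsilon>) x \<partial>lebesgue)"
        by (rule nn_integral_cmult_indicator[symmetric]) simp
      also have "\<dots> \<le> (\<integral>\<^sup>+x. ennreal (f \<bar>u x\<bar> * exp (\<alpha> * \<bar>u x\<bar> powr q)) * indicator \<Omega> x \<partial>lebesgue)"
        using ge sub by (intro nn_integral_mono) (auto simp: indicator_def intro!: ennreal_leI)
      also have "\<dots> = ?I u"
        unfolding \<alpha>_def q_def using \<Omega>_leb by (subst nn_integral_restrict_space) auto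
      finally show ?thesis .
    qed
    ultimately show ?thesis by blast
  qed
  show ?thesis
  proof (rule ccontr)
    assume "(SUP u \<in> ?U. ?I u) \<noteq> \<infinity>"
    then obtain y where y: "(SUP u \<in> ?U. ?I u) = ennreal y" "0 \<le> y"
      by (cases "(SUP u \<in> ?U. ?I u)") auto
    obtain u where u: "u \<in> ?U" "ennreal ((y + 1) / c0 * c0) \<le> ?I u"
      using main[of "(y + 1) / c0"] y(2) c0 by auto
    have "ennreal (y + 1) \<le> (SUP u \<in> ?U. ?I u)"
      using u(2) c0 by (intro SUP_upper2[OF u(1)]) simp
    then show False using y by (simp add: ennreal_le_iff)
  qed
qed

theorem theorem1p1:
  fixes \<Omega> :: "(real ^ 'n) set" and p :: real and f :: "real \<Rightarrow> real"
  assumes "open \<Omega>" and "\<Omega> \<noteq> {}" and "emeasure lebesgue \<Omega> < \<infinity>"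
    and "1 < p"
    and "f \<in> borel_measurable (restrict_space borel {0..})"
    and "\<And>t. 0 \<le> t \<Longrightarrow> 0 \<le> f t"
    and "filterlim f at_top at_top"
  shows "(SUP u \<in> {u \<in> H_tilde (real CARD('n) / p) p \<Omega>.
              \<exists>g \<in> Lp p UNIV. has_frac_laplacian (real CARD('n) / (2 * p)) u g \<and>
                Lp_norm p \<Omega> u powr p + Lp_norm p UNIV g powr p \<le> 1}.
            \<integral>\<^sup>+x. ennreal (f \<bar>u x\<bar> *
                 exp (moser_alpha TYPE(real ^ 'n) p * \<bar>u x\<bar> powr (p / (p - 1))))
              \<partial>lebesgue_on \<Omega>) = \<infinity>"
  using sharp_exponential_supremum_infinite[of \<Omega> p f] assms by simp

end
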